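(* For every fixed $\varepsilon>0$ there is an algorithm running in time polynomial in $n$ that, given an instance $I$ of the bicriteria problem $1|r_j|L_{\max},C_{\max}$, outputs a set $\mathcal F_\varepsilon$ of job sequences such that for every Pareto optimal sequence $\sigma'$ of $I$ there is $\sigma\in\mathcal F_\varepsilon$ with $L_{\max}(\sigma)\le(1+\varepsilon)L_{\max}(\sigma')$ and $C_{\max}(\sigma)\le C_{\max}(\sigma')$.
   Context: An instance consists of $n$ jobs to be processed non-preemptively on a single machine that processes at most one job at a time; job $j$ has processing time $p_j\ge0$, release time $r_j\ge0$ and tail $q_j\ge 0$. A sequence (permutation) of the jobs is turned into a schedule by starting each job, in order, as early as possible (not before its release time nor before the previous job completes). For completion times $C_j$, $L_{\max}=\max_j(C_j+q_j)$ and $C_{\max}=\max_jC_j$. A sequence $\sigma$ dominates $\sigma'$ if $L_{\max}(\sigma)\le L_{\max}(\sigma')$ and $C_{\max}(\sigma)\le C_{\max}(\sigma')$ with at least one inequality strict; $\sigma$ is Pareto optimal if no sequence dominates it. *)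

theory Defs
  imports Complex_Main
begin

text \<open>An instance with n jobs 0..n-1: processing times p, release times r, tails q.\<close>

definition valid_instance :: "nat \<Rightarrow> (nat \<Rightarrow> real) \<Rightarrow> (nat \<Rightarrow> real) \<Rightarrow> (nat \<Rightarrow> real) \<Rightarrow> bool" where
  "valid_instance n p r q \<longleftrightarrow> (\<forall>j<n. p j \<ge> 0 \<and> r j \<ge> 0 \<and> q j \<ge> 0)"

definition is_seq :: "nat \<Rightarrow> nat list \<Rightarrow> bool" where
  "is_seq n \<sigma> \<longleftrightarrow> distinct \<sigma> \<and> set \<sigma> = {..<n}"

fun compl :: "(nat \<Rightarrow> real) \<Rightarrow> (nat \<Rightarrow> real) \<Rightarrow> real \<Rightarrow> nat list \<Rightarrow> (nat \<times> real) list" where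
  "compl p r t [] = []"
| "compl p r t (j # js) = (let c = max t (r j) + p j in (j, c) # compl p r c js)"

definition Cmax :: "(nat \<Rightarrow> real) \<Rightarrow> (nat \<Rightarrow> real) \<Rightarrow> nat list \<Rightarrow> real" where
  "Cmax p r \<sigma> = (if \<sigma> = [] then 0 else Max (set (map snd (compl p r 0 \<sigma>))))"

definition Lmax :: "(nat \<Rightarrow> real) \<Rightarrow> (nat \<Rightarrow> real) \<Rightarrow> (nat \<Rightarrow> real) \<Rightarrow> nat list \<Rightarrow> real" where
  "Lmax p r q \<sigma> = (if \<sigma> = [] then 0 else Max (set (map (\<lambda>(j, c). c + q j) (compl p r 0 \<sigma>))))"

definition dominates :: "(nat \<Rightarrow> real) \<Rightarrow> (nat \<Rightarrow> real) \<Rightarrow> (nat \<Rightarrow> real) \<Rightarrow> nat list \<Rightarrow> nat list \<Rightarrow> bool" where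
  "dominates p r q \<sigma> \<sigma>' \<longleftrightarrow>
     Lmax p r q \<sigma> \<le> Lmax p r q \<sigma>' \<and> Cmax p r \<sigma> \<le> Cmax p r \<sigma>' \<and>
     (Lmax p r q \<sigma> < Lmax p r q \<sigma>' \<or> Cmax p r \<sigma> < Cmax p r \<sigma>')"

definition pareto_optimal :: "nat \<Rightarrow> (nat \<Rightarrow> real) \<Rightarrow> (nat \<Rightarrow> real) \<Rightarrow> (nat \<Rightarrow> real) \<Rightarrow> nat list \<Rightarrow> bool" where
  "pareto_optimal n p r q \<sigma>' \<longleftrightarrow> is_seq n \<sigma>' \<and> \<not> (\<exists>\<sigma>. is_seq n \<sigma> \<and> dominates p r q \<sigma> \<sigma>')"

datatype instr =
    Const nat int
  | Add nat nat nat
  | Sub nat nat nat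
  | Mul nat nat nat
  | Dv nat nat nat
  | Load nat nat
  | Store nat nat
  | Jle nat nat nat
  | Halt

type_synonym config = "nat \<times> (nat \<Rightarrow> real)"

definition addr :: "real \<Rightarrow> nat" where
  "addr x = nat \<lfloor>x\<rfloor>"

definition halted :: "instr list \<Rightarrow> config \<Rightarrow> bool" where
  "halted P s \<longleftrightarrow> fst s \<ge> length P \<or> P ! fst s = Halt"

fun step :: "instr list \<Rightarrow> config \<Rightarrow> config" where
  "step P (pc, m) =
    (if length P \<le> pc then (pc, m) else
     (case P ! pc of
        Const k c \<Rightarrow> (Suc pc, m(k := of_int c))
      | Add i j k \<Rightarrow> (Suc pc, m(k := m i + m j))
      | Sub i j k \<Rightarrow> (Suc pc, m(k := m i - m j))
      | Mul i j k \<Rightarrow> (Suc pc, m(k := m i * m j))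
      | Dv i j k \<Rightarrow> (Suc pc, m(k := m i / m j))
      | Load i k \<Rightarrow> (Suc pc, m(k := m (addr (m i))))
      | Store i k \<Rightarrow> (Suc pc, m(addr (m k) := m i))
      | Jle i j t \<Rightarrow> (if m i \<le> m j then t else Suc pc, m)
      | Halt \<Rightarrow> (pc, m)))"

definition steps :: "instr list \<Rightarrow> nat \<Rightarrow> config \<Rightarrow> config" where
  "steps P k s = (step P ^^ k) s"

text \<open>Input encoding: m[0] = n, m[1+3j] = p_j, m[2+3j] = r_j, m[3+3j] = q_j, all else 0.\<close>
definition init :: "nat \<Rightarrow> (nat \<Rightarrow> real) \<Rightarrow> (nat \<Rightarrow> real) \<Rightarrow> (nat \<Rightarrow> real) \<Rightarrow> config" where
  "init n p r q = (0, \<lambda>a. if a = 0 then real n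
      else if a \<le> 3 * n then
        (let j = (a - 1) div 3 in
          if (a - 1) mod 3 = 0 then p j else if (a - 1) mod 3 = 1 then r j else q j)
      else 0)"

text \<open>Output encoding at halting: m[0] = number N of sequences (a natural number);
  sequence k (k < N) is m[1+k*n], ..., m[1+k*n+n-1], each entry a job index < n.\<close>
definition out_count :: "(nat \<Rightarrow> real) \<Rightarrow> nat" where
  "out_count m = nat \<lfloor>m 0\<rfloor>"

definition out_seq :: "nat \<Rightarrow> (nat \<Rightarrow> real) \<Rightarrow> nat \<Rightarrow> nat list" where
  "out_seq n m k = map (\<lambda>i. nat \<lfloor>m (1 + k * n + i)\<rfloor>) [0..<n]"

definition valid_output :: "nat \<Rightarrow> (nat \<Rightarrow> real) \<Rightarrow> bool" where
  "valid_output n m \<longleftrightarrow> m 0 = real (out_count m) \<and>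
     (\<forall>k < out_count m. (\<forall>i<n. m (1 + k * n + i) = real (nat \<lfloor>m (1 + k * n + i)\<rfloor>))
        \<and> is_seq n (out_seq n m k))"

definition output_set :: "nat \<Rightarrow> (nat \<Rightarrow> real) \<Rightarrow> nat list set" where
  "output_set n m = out_seq n m ` {..<out_count m}"

end

theory Submission
  imports Defs
begin

text \<open>Let \<open>M\<close> be the value of \<open>Lmax\<close> for an arbitrary sequence \<open>\<sigma>'\<close>. Split the jobs with small
  processing time into \<open>K + 1\<close> classes by their tails, rounded down to multiples of \<open>M / K\<close>, and
  split the schedule of \<open>\<sigma>'\<close> into boundedly many blocks: every long job is a block of its own, and
  the short jobs are grouped by their start times. Within each class, redistribute the jobs over the
  blocks in the order of release times, filling fractionally the work that the class has in each
  block, and then sort each block by release times. The makespan is the maximum over all jobs \<open>j\<close> of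
  \<open>r j\<close> plus the work from \<open>j\<close> on; moving jobs towards the order of release times does not increase
  it, and the rounding of the fractional assignment only decreases the work that comes late.
  \<open>Lmax\<close> grows by at most the lengths of two blocks, a tail interval and boundedly many short jobs,
  that is, by at most \<open>4 * M / K\<close>. In the new sequence every block is a union of \<open>K + 1\<close> boxes in the
  coordinates processing time, tail and release rank, whose corners are given by jobs. Hence one of
  polynomially many candidate sequences, each described by a tuple of boundedly many job indices, is
  good enough, and the machine can list them all without ever computing \<open>M\<close>.\<close>

section \<open>Filling blocks class by class\<close>

text \<open>The obstacle is that \<open>Cmax\<close> may not grow at all. Rounding release times or
  postponing jobs would cost makespan, so jobs only move towards release order, and a job that
  straddles two blocks of the fractional filling goes to the earlier one. The price is paid in
  \<open>Lmax\<close> alone: each class of short jobs may exceed its old work in an interval of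
  blocks by one short job. With threshold \<open>M / (K * (K + 2))\<close> for short jobs,
  \<open>K + 2\<close> of them cost only \<open>M / K\<close>.

  The number of blocks is bounded without counting long jobs: a job longer than a time slot is the
  last to start in its slot, so two blocks per slot suffice. The thresholds, which depend on the
  unknown \<open>M\<close>, are replaced by comparisons with jobs. This costs five job indices per
  box, and the number of boxes depends on \<open>K\<close> only, so there are polynomially many
  tuples.\<close>

lemma sum_le_by_class:
  fixes p :: "'a \<Rightarrow> real"
  assumes "finite J" "X \<subseteq> J" "Y \<subseteq> J"
    and "\<And>a. a \<in> cl ` J \<Longrightarrow> sum p {i\<in>X. cl i = a} \<le> sum p {i\<in>Y. cl i = a} + \<xi> a"
  shows "sum p X \<le> sum p Y + sum \<xi> (cl ` J)"
proof -
  have fX: "finite X" "finite Y" using assms finite_subset by blast+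
  have "sum p X = (\<Sum>a\<in>cl ` J. sum p {i\<in>X. cl i = a})"
    using assms fX by (intro sum.group[symmetric]) auto
  also have "\<dots> \<le> (\<Sum>a\<in>cl ` J. sum p {i\<in>Y. cl i = a} + \<xi> a)"
    using assms(4) by (intro sum_mono) auto
  also have "\<dots> = (\<Sum>a\<in>cl ` J. sum p {i\<in>Y. cl i = a}) + sum \<xi> (cl ` J)"
    by (simp add: sum.distrib)
  also have "(\<Sum>a\<in>cl ` J. sum p {i\<in>Y. cl i = a}) = sum p Y"
    using assms fX by (intro sum.group) auto
  finally show ?thesis .
qed

text \<open>Moving jobs inside their class into the time blocks used by that class. \<open>V\<close> is the work of
  the class that precedes a job in the order \<open>e\<close>, \<open>W\<close> the work of the class in the old blocks before
  a given one; \<open>\<gamma>\<close> is the block in which a job starts when the blocks are filled fractionally in the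
  order \<open>e\<close>. Taking the maximum over occupied blocks keeps jobs of length 0 from drifting into blocks
  that the class does not use.\<close>

locale block_filling =
  fixes J :: "nat set" and p :: "nat \<Rightarrow> real" and e cl \<beta> :: "nat \<Rightarrow> nat"
  assumes fin: "finite J" and p_nonneg: "\<And>j. j \<in> J \<Longrightarrow> 0 \<le> p j" and inj_e: "inj_on e J"
begin

definition V :: "nat \<Rightarrow> real" where
  "V j = sum p {i\<in>J. cl i = cl j \<and> e i < e j}"

definition W :: "nat \<Rightarrow> nat \<Rightarrow> real" where
  "W a g = sum p {i\<in>J. cl i = a \<and> \<beta> i < g}"

definition \<gamma> :: "nat \<Rightarrow> nat" where
  "\<gamma> j = Max (\<beta> ` {k\<in>J. cl k = cl j \<and> W (cl j) (\<beta> k) \<le> V j})"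

lemma p_mono: "A \<subseteq> B \<Longrightarrow> B \<subseteq> J \<Longrightarrow> sum p A \<le> sum p B"
  using p_nonneg fin by (intro sum_mono2) (auto intro: finite_subset)

lemma W_mono: "g \<le> h \<Longrightarrow> W a g \<le> W a h"
  unfolding W_def by (rule p_mono) auto

lemma V_mono: "cl i = cl j \<Longrightarrow> e i \<le> e j \<Longrightarrow> V i \<le> V j"
  unfolding V_def by (rule p_mono) auto

text \<open>The earliest block used by the class has no class work before it, so it always qualifies
  and the \<open>Max\<close> in \<open>\<gamma>\<close> is over a nonempty set.\<close>

lemma \<gamma>_cand_nonempty:
  assumes "j \<in> J" shows "{k\<in>J. cl k = cl j \<and> W (cl j) (\<beta> k) \<le> V j} \<noteq> {}"
proof -
  let ?A = "{k\<in>J. cl k = cl j}"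
  have fA: "finite (\<beta> ` ?A)" "\<beta> ` ?A \<noteq> {}" using assms fin by auto
  obtain k where k: "k \<in> ?A" "\<beta> k = Min (\<beta> ` ?A)" using Min_in[OF fA] by auto
  have "{i\<in>J. cl i = cl j \<and> \<beta> i < \<beta> k} = {}"
    using fA k by (auto simp: not_less)
  hence "W (cl j) (\<beta> k) = 0" unfolding W_def by (metis (no_types, lifting) sum.empty)
  moreover have "0 \<le> V j" unfolding V_def using p_nonneg by (intro sum_nonneg) auto
  ultimately show ?thesis using k by auto
qed

lemma \<gamma>_witness:
  assumes "j \<in> J"
  obtains k where "k \<in> J" "cl k = cl j" "\<beta> k = \<gamma> j" "W (cl j) (\<gamma> j) \<le> V j"
proof -
  have "\<gamma> j \<in> \<beta> ` {k\<in>J. cl k = cl j \<and> W (cl j) (\<beta> k) \<le> V j}"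
    unfolding \<gamma>_def using \<gamma>_cand_nonempty[OF assms] fin by (intro Max_in) auto
  thus ?thesis using that by auto
qed

lemma \<gamma>_ge:
  assumes "k \<in> J" "cl k = cl j" "W (cl j) (\<beta> k) \<le> V j"
  shows "\<beta> k \<le> \<gamma> j"
  unfolding \<gamma>_def using assms fin by (intro Max_ge) auto

lemma \<gamma>_mono:
  assumes "i \<in> J" "j \<in> J" "cl i = cl j" "e i \<le> e j"
  shows "\<gamma> i \<le> \<gamma> j"
proof -
  obtain k where "k \<in> J" "cl k = cl i" "\<beta> k = \<gamma> i" "W (cl i) (\<gamma> i) \<le> V i"
    using \<gamma>_witness[OF assms(1)] .
  thus ?thesis using \<gamma>_ge[of k j] V_mono[of i j] assms by auto
qed

text \<open>For the first block of the class after \<open>g\<close>, no class work lies in between,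
  so its \<open>W\<close> is the work up to and including \<open>g\<close>. This turns the
  maximality in \<open>\<gamma>\<close> into statements about any \<open>g\<close>, even one that
  the class skips.\<close>

lemma next_block:
  assumes "l \<in> J" "cl l = a" "g < \<beta> l"
  obtains k where "k \<in> J" "cl k = a" "g < \<beta> k" "W a (\<beta> k) = sum p {i\<in>J. cl i = a \<and> \<beta> i \<le> g}"
proof -
  let ?A = "{k\<in>J. cl k = a \<and> g < \<beta> k}"
  have fA: "finite (\<beta> ` ?A)" "\<beta> ` ?A \<noteq> {}" using assms fin by auto
  obtain k where k: "k \<in> ?A" "\<beta> k = Min (\<beta> ` ?A)" using Min_in[OF fA] by auto
  have min: "\<beta> k \<le> \<beta> i" if "i \<in> ?A" for i using that fA k by auto
  have "{i\<in>J. cl i = a \<and> \<beta> i < \<beta> k} = {i\<in>J. cl i = a \<and> \<beta> i \<le> g}"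
    using k min by (force simp: not_le[symmetric])
  with k show ?thesis by (intro that[of k]) (auto simp: W_def)
qed

text \<open>If all class jobs in old blocks up to \<open>\<gamma> i\<close> preceded
  \<open>i\<close>, their work would be at most \<open>V i\<close>, and the next block of the class
  would qualify too, against the maximality of \<open>\<gamma> i\<close>. The job \<open>k\<close>
  replaces \<open>i\<close> in release-time bounds, since
  \<open>r i \<le> r k \<le> S k\<close>.\<close>

lemma later_job_in_earlier_block:
  assumes "i \<in> J"
  obtains k where "k \<in> J" "cl k = cl i" "\<beta> k \<le> \<gamma> i" "e i \<le> e k"
proof (rule ccontr)
  assume "\<not> thesis"
  hence no: "\<And>k. k \<in> J \<Longrightarrow> cl k = cl i \<Longrightarrow> \<beta> k \<le> \<gamma> i \<Longrightarrow> e k < e i"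
    using that by (meson not_less)
  hence "\<gamma> i < \<beta> i" using no[of i] assms by force
  then obtain k where k: "k \<in> J" "cl k = cl i" "\<gamma> i < \<beta> k"
    "W (cl i) (\<beta> k) = sum p {l\<in>J. cl l = cl i \<and> \<beta> l \<le> \<gamma> i}"
    using next_block[of i "cl i" "\<gamma> i"] assms by auto
  have "W (cl i) (\<beta> k) \<le> V i"
    unfolding k(4) V_def using no by (intro p_mono) auto
  thus False using \<gamma>_ge[of k i] k by auto
qed

text \<open>Let \<open>i\<close> be the first job of \<open>X\<close> in the order \<open>e\<close>.
  The work of \<open>X\<close> is at most the class total minus \<open>V i\<close>, and
  \<open>V i\<close> covers all work outside \<open>Y\<close>.\<close>

lemma suffix_work:
  assumes "X \<subseteq> {i\<in>J. cl i = a}" "Y \<subseteq> {i\<in>J. cl i = a}"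
    and "\<And>i. i \<in> X \<Longrightarrow> sum p ({i\<in>J. cl i = a} - Y) \<le> V i"
  shows "sum p X \<le> sum p Y"
proof (cases "X = {}")
  case True
  thus ?thesis using assms(2) p_nonneg by (auto intro!: sum_nonneg)
next
  case False
  let ?A = "{i\<in>J. cl i = a}"
  have fX: "finite X" using assms(1) fin by (auto intro: finite_subset)
  obtain i where i: "i \<in> X" "e i = Min (e ` X)" using Min_in[of "e ` X"] fX False by fastforce
  have min: "e i \<le> e k" if "k \<in> X" for k using that fX i by auto
  have ia: "cl i = a" using i assms by auto
  have "sum p X \<le> sum p (?A - {l\<in>J. cl l = cl i \<and> e l < e i})"
    using min assms(1) ia by (intro p_mono) (auto dest: leD)
  also have "\<dots> = sum p ?A - V i"
    unfolding V_def using ia fin by (intro sum_diff) auto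
  also have "\<dots> \<le> sum p ?A - sum p (?A - Y)" using assms(3) i by auto
  also have "\<dots> = sum p Y"
    using assms(2) fin by (subst sum_diff) auto
  finally show ?thesis .
qed

text \<open>A job placed in block \<open>g\<close> or later has at least \<open>W a g\<close> class
  work before it. Hence late work never grows, which is what protects the makespan.\<close>

lemma class_work_ge:
  "sum p {i\<in>{i\<in>J. g \<le> \<gamma> i}. cl i = a} \<le> sum p {i\<in>{i\<in>J. g \<le> \<beta> i}. cl i = a}"
proof (rule suffix_work)
  fix i assume i: "i \<in> {i\<in>{i\<in>J. g \<le> \<gamma> i}. cl i = a}"
  hence "sum p ({i\<in>J. cl i = a} - {i\<in>{i\<in>J. g \<le> \<beta> i}. cl i = a}) = W a g"
    unfolding W_def by (intro arg_cong[of _ _ "sum p"]) auto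
  also have "\<dots> \<le> W a (\<gamma> i)" using i by (intro W_mono) auto
  also have "\<dots> \<le> V i" using \<gamma>_witness[of i] i by auto
  finally show "sum p ({i\<in>J. cl i = a} - {i\<in>{i\<in>J. g \<le> \<beta> i}. cl i = a}) \<le> V i" .
qed auto

lemma work_ge: "sum p {i\<in>J. g \<le> \<gamma> i} \<le> sum p {i\<in>J. g \<le> \<beta> i}"
proof -
  have "sum p {i\<in>J. g \<le> \<gamma> i} \<le> sum p {i\<in>J. g \<le> \<beta> i} + (\<Sum>a\<in>cl ` J. 0)"
    by (rule sum_le_by_class[OF fin]) (use class_work_ge in auto)
  thus ?thesis by simp
qed

text \<open>The last job \<open>i\<close> placed up to \<open>g\<close> starts before the next block
  of the class begins, so \<open>V i\<close> is below the old work up to \<open>g\<close>; only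
  \<open>p i\<close> can stick out.\<close>

lemma class_work_le:
  assumes "\<And>i. i \<in> J \<Longrightarrow> cl i = a \<Longrightarrow> p i \<le> \<mu>" "0 \<le> \<mu>"
  shows "sum p {i\<in>J. \<gamma> i \<le> g \<and> cl i = a} \<le> sum p {i\<in>J. \<beta> i \<le> g \<and> cl i = a} + \<mu>"
proof -
  let ?X = "{i\<in>J. \<gamma> i \<le> g \<and> cl i = a}"
  consider "?X = {}" | "\<forall>l\<in>J. cl l = a \<longrightarrow> \<beta> l \<le> g" | l where "?X \<noteq> {}" "l \<in> J" "cl l = a" "g < \<beta> l"
    by (meson not_le)
  thus ?thesis
  proof cases
    case 1
    thus ?thesis using p_nonneg assms(2) by (auto intro!: sum_nonneg add_nonneg_nonneg simp del: Collect_empty_eq)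
  next
    case 2
    hence "sum p ?X \<le> sum p {i\<in>J. \<beta> i \<le> g \<and> cl i = a}" by (intro p_mono) auto
    thus ?thesis using assms(2) by auto
  next
    case 3
    obtain k where k: "k \<in> J" "cl k = a" "g < \<beta> k" "W a (\<beta> k) = sum p {i\<in>J. cl i = a \<and> \<beta> i \<le> g}"
      using next_block[OF 3(2-4)] .
    have fX: "finite ?X" using fin by auto
    obtain i where i: "i \<in> ?X" "e i = Max (e ` ?X)" using Max_in[of "e ` ?X"] fX 3(1) by fastforce
    have max: "e l \<le> e i" if "l \<in> ?X" for l using that fX i by auto
    have eq: "l = i" if "l \<in> J" "e l = e i" for l using that i(1) inj_e by (auto dest: inj_onD)
    have "V i < W a (\<beta> k)" using \<gamma>_ge[of k i] k i by (force simp: not_less[symmetric])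
    moreover have "sum p ?X \<le> sum p (insert i {l\<in>J. cl l = cl i \<and> e l < e i})"
      using max eq i by (intro p_mono) (auto simp: order_less_le)
    hence "sum p ?X \<le> p i + V i" unfolding V_def using fin by (subst (asm) sum.insert) auto
    moreover have "p i \<le> \<mu>" using i assms by auto
    ultimately show ?thesis using k(4) by (simp add: conj_commute conj_left_commute)
  qed
qed

text \<open>Work in blocks \<open>h\<close> to \<open>g\<close> is work up to \<open>g\<close> plus
  work from \<open>h\<close> on minus the class total. Only the first summand can grow, so the
  excess is one job and not two.\<close>

lemma class_work_between:
  assumes "\<And>i. i \<in> J \<Longrightarrow> cl i = a \<Longrightarrow> p i \<le> \<mu>" "0 \<le> \<mu>" "h \<le> g"
  shows "sum p {i\<in>{i\<in>J. h \<le> \<gamma> i \<and> \<gamma> i \<le> g}. cl i = a}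
    \<le> sum p {i\<in>{i\<in>J. h \<le> \<beta> i \<and> \<beta> i \<le> g}. cl i = a} + \<mu>"
proof -
  have split: "sum p {i\<in>{i\<in>J. h \<le> f i \<and> f i \<le> g}. cl i = a} =
    sum p {i\<in>J. f i \<le> g \<and> cl i = a} + sum p {i\<in>{i\<in>J. h \<le> f i}. cl i = a} - sum p {i\<in>J. cl i = a}" for f
  proof -
    let ?A = "{i\<in>J. f i \<le> g \<and> cl i = a}" and ?B = "{i\<in>{i\<in>J. h \<le> f i}. cl i = a}"
    have "?A \<union> ?B = {i\<in>J. cl i = a}" using assms(3) by auto
    moreover have "?A \<inter> ?B = {i\<in>{i\<in>J. h \<le> f i \<and> f i \<le> g}. cl i = a}" by auto
    ultimately show ?thesis using sum.union_inter[of ?A ?B p] fin by (auto simp del: Collect_conj_eq)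
  qed
  show ?thesis using split[of \<gamma>] split[of \<beta>] class_work_le[of a \<mu> g] assms(1,2) class_work_ge[of h a]
    by auto
qed

lemma \<gamma>_singleton:
  assumes "j \<in> J" "\<And>i. i \<in> J \<Longrightarrow> cl i = cl j \<Longrightarrow> i = j"
  shows "\<gamma> j = \<beta> j"
  using \<gamma>_witness[OF assms(1)] assms by metis

end

text \<open>The schedule that is rearranged: \<open>S\<close> are the start times and \<open>\<pi>\<close> the positions of the jobs.\<close>

locale block_schedule = block_filling +
  fixes r S :: "nat \<Rightarrow> real" and \<pi> :: "nat \<Rightarrow> nat"
  assumes r_le_S: "\<And>j. j \<in> J \<Longrightarrow> r j \<le> S j"
    and S_order: "\<And>i j. i \<in> J \<Longrightarrow> j \<in> J \<Longrightarrow> \<pi> i < \<pi> j \<Longrightarrow> S i + p i \<le> S j"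
    and inj_\<pi>: "inj_on \<pi> J"
    and \<beta>_mono: "\<And>i j. i \<in> J \<Longrightarrow> j \<in> J \<Longrightarrow> \<pi> i < \<pi> j \<Longrightarrow> \<beta> i \<le> \<beta> j"
    and r_mono: "\<And>i j. i \<in> J \<Longrightarrow> j \<in> J \<Longrightarrow> e i \<le> e j \<Longrightarrow> r i \<le> r j"
begin

text \<open>The jobs occupy disjoint parts of the interval; the induction removes the last one and
  shrinks \<open>t\<close> to its start.\<close>

lemma work_in_interval:
  assumes "X \<subseteq> J" "\<And>j. j \<in> X \<Longrightarrow> s \<le> S j" "\<And>j. j \<in> X \<Longrightarrow> S j + p j \<le> t" "s \<le> t"
  shows "sum p X \<le> t - s"
proof -
  have "finite X" using assms fin by (auto intro: finite_subset)
  thus ?thesis using assms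
  proof (induction "card X" arbitrary: X t)
    case 0
    thus ?case by auto
  next
    case (Suc m)
    then obtain j where j: "j \<in> X" "\<pi> j = Max (\<pi> ` X)" using Max_in[of "\<pi> ` X"] by fastforce
    have max: "\<pi> i < \<pi> j" if "i \<in> X - {j}" for i
    proof -
      have "\<pi> i \<le> \<pi> j" using that Suc.prems(1) j by auto
      moreover have "\<pi> i \<noteq> \<pi> j" using inj_onD[OF inj_\<pi>, of i j] that j(1) Suc.prems(2) by auto
      ultimately show ?thesis by auto
    qed
    have "sum p (X - {j}) \<le> S j - s"
    proof (rule Suc.hyps(1))
      show "m = card (X - {j})" using Suc.hyps(2) j Suc.prems(1) by auto
      show "S i + p i \<le> S j" if "i \<in> X - {j}" for i using S_order[OF _ _ max[OF that]] that j Suc.prems by auto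
    qed (use Suc.prems j in auto)
    moreover have "sum p X = p j + sum p (X - {j})" using Suc.prems j by (intro sum.remove) auto
    moreover have "S j + p j \<le> t" using Suc.prems j by auto
    ultimately show ?case by auto
  qed
qed

lemma S_mono:
  assumes "i \<in> J" "j \<in> J" "\<pi> i \<le> \<pi> j" shows "S i \<le> S j"
proof (cases "\<pi> i = \<pi> j")
  case True thus ?thesis using inj_\<pi> assms by (auto dest: inj_onD)
next
  case False thus ?thesis using S_order[of i j] p_nonneg[of i] assms by auto
qed

lemma S_mono_block:
  assumes "i \<in> J" "j \<in> J" "\<beta> i < \<beta> j" shows "S i \<le> S j"
  using \<beta>_mono[of j i] S_mono[of i j] assms by (meson not_le)

lemma suffix_bound:
  assumes "k \<in> J" "\<And>j. j \<in> J \<Longrightarrow> S j + p j \<le> C" "X \<subseteq> {i\<in>J. \<pi> k \<le> \<pi> i}"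
  shows "r k + sum p X \<le> C"
proof -
  have "sum p X \<le> C - S k"
  proof (rule work_in_interval)
    show "S k \<le> C" using assms(2)[of k] p_nonneg[of k] assms(1) by auto
  qed (use assms S_mono[of k] in auto)
  thus ?thesis using r_le_S[OF assms(1)] by auto
qed

section \<open>Makespan and completion times after the rearrangement\<close>

text \<open>The left side is the lower bound that \<open>j\<close> imposes on the new makespan. It
  is compared with the bound imposed on the old one by a job released no earlier than
  \<open>j\<close>.\<close>

lemma rearranged_makespan:
  assumes j: "j \<in> J" and C: "\<And>j. j \<in> J \<Longrightarrow> S j + p j \<le> C"
  shows "r j + sum p {i\<in>J. \<gamma> j < \<gamma> i \<or> \<gamma> i = \<gamma> j \<and> e j \<le> e i} \<le> C"
\<comment> \<open>If such a \<open>k\<close> exists, even all new work from block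
  \<open>\<gamma> j\<close> on is covered by old work after \<open>k\<close>.\<close>
proof (cases "\<exists>k\<in>J. \<beta> k < \<gamma> j \<and> e j \<le> e k")
  case True
  then obtain k where k: "k \<in> J" "\<beta> k < \<gamma> j" "e j \<le> e k" by auto
  have "sum p {i\<in>J. \<gamma> j < \<gamma> i \<or> \<gamma> i = \<gamma> j \<and> e j \<le> e i} \<le> sum p {i\<in>J. \<gamma> j \<le> \<gamma> i}"
    by (intro p_mono) auto
  also have "\<dots> \<le> sum p {i\<in>J. \<gamma> j \<le> \<beta> i}" by (rule work_ge)
  finally have "sum p {i\<in>J. \<gamma> j < \<gamma> i \<or> \<gamma> i = \<gamma> j \<and> e j \<le> e i} \<le> \<dots>" .
  moreover have "r k + sum p {i\<in>J. \<gamma> j \<le> \<beta> i} \<le> C"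
  proof (rule suffix_bound[OF k(1) C])
    show "{i\<in>J. \<gamma> j \<le> \<beta> i} \<subseteq> {i\<in>J. \<pi> k \<le> \<pi> i}"
      using \<beta>_mono[of _ k] k by auto (meson le_less_trans not_le)
  qed
  moreover have "r j \<le> r k" using r_mono j k by auto
  ultimately show ?thesis by auto
next
  case False
  define g where "g = \<gamma> j"
  \<comment> \<open>Now the earlier old blocks hold only predecessors of \<open>j\<close>, so the
    suffixes from \<open>j\<close> on in the lexicographic order by block and \<open>e\<close> can
    be compared class by class.\<close>
  have early: "e k < e j" if "k \<in> J" "\<beta> k < g" for k using that False g_def by (auto simp: not_le[symmetric])
  let ?X = "{i\<in>J. g < \<gamma> i \<or> \<gamma> i = g \<and> e j \<le> e i}" and ?Z = "{i\<in>J. g < \<beta> i \<or> \<beta> i = g \<and> e j \<le> e i}"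
  have "sum p {i\<in>?X. cl i = a} \<le> sum p {i\<in>?Z. cl i = a}" for a
  proof (rule suffix_work)
    fix i assume i: "i \<in> {i\<in>?X. cl i = a}"
    show "sum p ({i\<in>J. cl i = a} - {i\<in>?Z. cl i = a}) \<le> V i"
    proof (cases "e j \<le> e i")
      case True
      have "e x < e j" if "x \<in> {i\<in>J. cl i = a} - {i\<in>?Z. cl i = a}" for x
        using early[of x] that by (cases "\<beta> x < g") auto
      thus ?thesis unfolding V_def using True i by (intro p_mono) fastforce+
    next
      case False
      hence g: "g < \<gamma> i" using i by auto
      have "sum p ({i\<in>J. cl i = a} - {i\<in>?Z. cl i = a}) \<le> W a (\<gamma> i)"
        unfolding W_def using g by (intro p_mono) auto
      also have "\<dots> \<le> V i" using \<gamma>_witness[of i] i by auto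
      finally show ?thesis .
    qed
  qed auto
  hence "sum p ?X \<le> sum p ?Z"
    using sum_le_by_class[where \<xi>="\<lambda>_. 0" and X="?X" and Y="?Z" and cl=cl and p=p, OF fin] by auto
  moreover have "r j + sum p ?Z \<le> C"
  proof -
    \<comment> \<open>By \<open>early\<close>, this job lies exactly in block \<open>g\<close>. So
      block \<open>g\<close> contains old jobs not before \<open>j\<close> in \<open>e\<close>, and
      all of \<open>?Z\<close> follows the first scheduled of them.\<close>
    obtain k where "k \<in> J" "\<beta> k \<le> g" "e j \<le> e k"
      using later_job_in_earlier_block[OF j] g_def by metis
    hence "k \<in> {k\<in>J. \<beta> k = g \<and> e j \<le> e k}" using early[of k] by force
    hence ne: "{k\<in>J. \<beta> k = g \<and> e j \<le> e k} \<noteq> {}" by blast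
    let ?Y = "{k\<in>J. \<beta> k = g \<and> e j \<le> e k}"
    obtain l where l: "l \<in> ?Y" "\<pi> l = Min (\<pi> ` ?Y)" using Min_in[of "\<pi> ` ?Y"] fin ne by fastforce
    have min: "\<pi> l \<le> \<pi> i" if "i \<in> ?Y" for i using that fin l by auto
    have "r l + sum p ?Z \<le> C"
    proof (rule suffix_bound[OF _ C])
      show "?Z \<subseteq> {i\<in>J. \<pi> l \<le> \<pi> i}"
        using min \<beta>_mono[of _ l] l by (auto simp: not_less[symmetric])
    qed (use l in auto)
    thus ?thesis using r_mono[of j l] j l by auto
  qed
  ultimately show ?thesis unfolding g_def by auto
qed

text \<open>\<open>k\<close> is an old job of the class of \<open>j\<close> in the block that
  \<open>j\<close> moves to, so its tail can stand in for that of \<open>j\<close>. The error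
  consists of \<open>\<theta>\<close> at each end, because a block determines start times up to
  \<open>\<theta>\<close>, one \<open>\<mu>\<close> for a short job that ends after
  \<open>k\<close>, and one \<open>\<mu>\<close> for each of the \<open>K + 1\<close> short
  classes.\<close>

lemma rearranged_completion:
  assumes ij: "i \<in> J" "j \<in> J" "\<gamma> i \<le> \<gamma> j"
    and \<theta>: "\<And>k l. k \<in> J \<Longrightarrow> l \<in> J \<Longrightarrow> \<beta> k = \<beta> l \<Longrightarrow> S k \<le> S l + \<theta>" "0 \<le> \<theta>"
    and \<mu>: "\<And>k. k \<in> J \<Longrightarrow> cl k \<le> K \<Longrightarrow> p k \<le> \<mu>" "0 \<le> \<mu>"
    and single: "\<And>k l. k \<in> J \<Longrightarrow> l \<in> J \<Longrightarrow> K < cl k \<Longrightarrow> cl l = cl k \<Longrightarrow> l = k"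
    and alone: "\<And>k l. k \<in> J \<Longrightarrow> l \<in> J \<Longrightarrow> K < cl k \<Longrightarrow> \<beta> l = \<beta> k \<Longrightarrow> l = k"
  obtains k where "k \<in> J" "cl k = cl j"
    "r i + sum p {l\<in>J. \<gamma> i \<le> \<gamma> l \<and> \<gamma> l \<le> \<gamma> j} \<le> S k + p k + 2 * \<theta> + (real K + 2) * \<mu>"
proof -
  define h where "h = \<gamma> i"
  define g where "g = \<gamma> j"
  obtain k where k: "k \<in> J" "cl k = cl j" "\<beta> k = g" using \<gamma>_witness[OF ij(2)] g_def by metis
  obtain k' where k': "k' \<in> J" "\<beta> k' \<le> h" "e i \<le> e k'"
    using later_job_in_earlier_block[OF ij(1)] h_def by metis
  have "sum p {l\<in>J. h \<le> \<gamma> l \<and> \<gamma> l \<le> g}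
    \<le> sum p {l\<in>J. h \<le> \<beta> l \<and> \<beta> l \<le> g} + (\<Sum>a\<in>cl ` J. if a \<le> K then \<mu> else 0)"
  proof (rule sum_le_by_class[OF fin])
    fix a assume "a \<in> cl ` J"
    then obtain l where l: "l \<in> J" "a = cl l" by auto
    show "sum p {i\<in>{l\<in>J. h \<le> \<gamma> l \<and> \<gamma> l \<le> g}. cl i = a}
      \<le> sum p {i\<in>{l\<in>J. h \<le> \<beta> l \<and> \<beta> l \<le> g}. cl i = a} + (if a \<le> K then \<mu> else 0)"
    proof (cases "a \<le> K")
      case True
      thus ?thesis using class_work_between[of a \<mu> h g] \<mu> ij(3) g_def h_def by auto
    next
      case False
      hence "\<gamma> l = \<beta> l" using single[of l] l by (intro \<gamma>_singleton) auto
      hence "\<And>x. x \<in> J \<Longrightarrow> cl x = a \<Longrightarrow> \<gamma> x = \<beta> x" using single[of l] l False by auto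
      hence "{i\<in>{l\<in>J. h \<le> \<gamma> l \<and> \<gamma> l \<le> g}. cl i = a} = {i\<in>{l\<in>J. h \<le> \<beta> l \<and> \<beta> l \<le> g}. cl i = a}"
        by auto
      thus ?thesis using False by simp
    qed
  qed auto
  \<comment> \<open>Long jobs stay in place and add no error, so at most \<open>K + 1\<close> terms
    count however many classes there are.\<close>
  also have "(\<Sum>a\<in>cl ` J. if a \<le> K then \<mu> else 0) \<le> (\<Sum>a\<in>{..K}. \<mu>)"
  proof -
    have "card (cl ` J \<inter> {x. x \<le> K}) \<le> card {..K}" by (rule card_mono) auto
    thus ?thesis using fin \<mu>(2) by (subst sum.If_cases) (auto intro!: mult_right_mono)
  qed
  also have "\<dots> = (real K + 1) * \<mu>" by simp
  finally have 1: "sum p {l\<in>J. h \<le> \<gamma> l \<and> \<gamma> l \<le> g} \<le> sum p {l\<in>J. h \<le> \<beta> l \<and> \<beta> l \<le> g} + (real K + 1) * \<mu>"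
    by simp
  have low: "r i - \<theta> \<le> S l" if "l \<in> J" "h \<le> \<beta> l" for l
  proof -
    have "S k' \<le> S l + \<theta>" using S_mono_block[of k' l] \<theta>(1)[of k' l] \<theta>(2) k' that
      by (cases "\<beta> k' = \<beta> l") auto
    moreover have "r i \<le> r k'" using r_mono ij k' by auto
    ultimately show ?thesis using r_le_S[of k'] k' by auto
  qed
  \<comment> \<open>A job scheduled after \<open>k\<close> in these blocks shares the block of
    \<open>k\<close>; it is short, because a long job is alone in its block.\<close>
  have up: "S l + p l \<le> S k + p k + \<theta> + \<mu>" if "l \<in> J" "\<beta> l \<le> g" for l
  proof (cases "l = k")
    case True thus ?thesis using \<theta> \<mu> by auto
  next
    case ne: False
    show ?thesis
    proof (cases "\<pi> l < \<pi> k")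
      case True
      thus ?thesis using S_order[of l k] p_nonneg[of k] \<theta> \<mu> that k by auto
    next
      case False
      hence "\<pi> k < \<pi> l" using inj_\<pi> that k ne by (meson inj_onD linorder_neqE_nat)
      hence b: "\<beta> l = \<beta> k" using \<beta>_mono[of k l] that k by auto
      hence "cl l \<le> K" using alone[of l k] that k ne by (metis not_le)
      thus ?thesis using \<mu>(1)[of l] \<theta>(1)[of l k] b that k p_nonneg[of k] by auto
    qed
  qed
  have "sum p {l\<in>J. h \<le> \<beta> l \<and> \<beta> l \<le> g} \<le> (S k + p k + \<theta> + \<mu>) - (r i - \<theta>)"
  proof (rule work_in_interval)
    show "r i - \<theta> \<le> S k + p k + \<theta> + \<mu>"
      using low[of k] k ij(3) g_def h_def p_nonneg[of k] \<theta> \<mu> by auto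
  qed (use low up in auto)
  with 1 show ?thesis using k by (intro that[of k]) (auto simp: g_def h_def algebra_simps)
qed

end

section \<open>Schedules of ranked sequences\<close>

lemma length_compl [simp]: "length (compl p r t \<sigma>) = length \<sigma>"
  by (induction \<sigma> arbitrary: t) (auto simp: Let_def)

lemma fst_compl: "k < length \<sigma> \<Longrightarrow> fst (compl p r t \<sigma> ! k) = \<sigma> ! k"
  by (induction \<sigma> arbitrary: t k) (auto simp: Let_def nth_Cons split: nat.splits)

lemma compl_ge_start:
  assumes "k < length \<sigma>" "\<And>j. j \<in> set \<sigma> \<Longrightarrow> 0 \<le> p j"
  shows "t + p (\<sigma> ! k) \<le> snd (compl p r t \<sigma> ! k) \<and> r (\<sigma> ! k) + p (\<sigma> ! k) \<le> snd (compl p r t \<sigma> ! k)"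
  using assms
proof (induction \<sigma> arbitrary: t k)
  case (Cons j js)
  have "0 \<le> p j" using Cons.prems by auto
  show ?case
  proof (cases k)
    case 0
    thus ?thesis by (auto simp: Let_def)
  next
    case (Suc k')
    have "t \<le> max t (r j)" by simp
    moreover have "max t (r j) + p j + p (js ! k') \<le> snd (compl p r (max t (r j) + p j) js ! k') \<and>
      r (js ! k') + p (js ! k') \<le> snd (compl p r (max t (r j) + p j) js ! k')"
      using Cons Suc by auto
    ultimately have "t + p (js ! k') \<le> snd (compl p r (max t (r j) + p j) js ! k') \<and>
      r (js ! k') + p (js ! k') \<le> snd (compl p r (max t (r j) + p j) js ! k')"
      using \<open>0 \<le> p j\<close> by linarith
    thus ?thesis using Suc by (simp add: Let_def)
  qed
qed auto

lemma compl_order: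
  assumes "i < k" "k < length \<sigma>" "\<And>j. j \<in> set \<sigma> \<Longrightarrow> 0 \<le> p j"
  shows "snd (compl p r t \<sigma> ! i) + p (\<sigma> ! k) \<le> snd (compl p r t \<sigma> ! k)"
  using assms
proof (induction \<sigma> arbitrary: t i k)
  case (Cons j js)
  then obtain k' where k: "k = Suc k'" by (cases k) auto
  show ?case
  proof (cases i)
    case 0
    thus ?thesis using compl_ge_start[of k' js p "max t (r j) + p j" r] k Cons.prems by (auto simp: Let_def)
  next
    case (Suc i')
    thus ?thesis using Cons.IH[of i' k'] k Cons.prems by (auto simp: Let_def)
  qed
qed auto

text \<open>This unrolls the \<open>max\<close> in \<open>compl\<close>: the completion time is
  determined by the last job that starts at its release time, or by \<open>t\<close>, as the machine
  does not idle afterwards.\<close>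

lemma compl_le:
  assumes "k < length \<sigma>" "t + (\<Sum>l\<le>k. p (\<sigma> ! l)) \<le> X"
    and "\<And>i. i \<le> k \<Longrightarrow> r (\<sigma> ! i) + (\<Sum>l=i..k. p (\<sigma> ! l)) \<le> X"
  shows "snd (compl p r t \<sigma> ! k) \<le> X"
  using assms
proof (induction \<sigma> arbitrary: t k)
  case (Cons j js)
  show ?case
  proof (cases k)
    case 0
    thus ?thesis using Cons.prems(2) Cons.prems(3)[of 0] by (auto simp: Let_def)
  next
    case (Suc k')
    have "snd (compl p r (max t (r j) + p j) js ! k') \<le> X"
    proof (rule Cons.IH)
      have "t + (p j + (\<Sum>l\<le>k'. p (js ! l))) \<le> X"
        using Cons.prems(2) Suc by (simp add: sum.atMost_Suc_shift del: sum.atMost_Suc)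
      moreover have "r j + (p j + (\<Sum>l\<le>k'. p (js ! l))) \<le> X"
        using Cons.prems(3)[of 0] Suc by (simp add: sum.atMost_Suc_shift atLeast0AtMost del: sum.atMost_Suc)
      ultimately show "max t (r j) + p j + (\<Sum>l\<le>k'. p (js ! l)) \<le> X" by (auto simp: max_def)
      show "r (js ! i) + (\<Sum>l = i..k'. p (js ! l)) \<le> X" if "i \<le> k'" for i
        using Cons.prems(3)[of "Suc i"] Suc that by (simp add: sum.shift_bounds_cl_Suc_ivl del: sum.cl_ivl_Suc)
    qed (use Cons.prems Suc in auto)
    thus ?thesis using Suc by (simp add: Let_def)
  qed
qed auto

lemma is_seq_length: "is_seq n \<sigma> \<Longrightarrow> length \<sigma> = n"
  unfolding is_seq_def using distinct_card by fastforce

lemma is_seq_position: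
  assumes "is_seq n \<sigma>"
  obtains \<pi> where "\<And>j. j < n \<Longrightarrow> \<pi> j < n \<and> \<sigma> ! \<pi> j = j"
proof -
  have "\<forall>j. \<exists>i. j < n \<longrightarrow> i < n \<and> \<sigma> ! i = j"
    using assms is_seq_length[OF assms] unfolding is_seq_def by (metis in_set_conv_nth lessThan_iff)
  thus ?thesis using that by metis
qed

lemma Cmax_ge:
  assumes "k < length \<sigma>" shows "snd (compl p r 0 \<sigma> ! k) \<le> Cmax p r \<sigma>"
  proof -
  have "compl p r 0 \<sigma> ! k \<in> set (compl p r 0 \<sigma>)" using assms by auto
  thus ?thesis using assms by (auto simp: Cmax_def)
qed

lemma Lmax_ge:
  assumes "k < length \<sigma>" shows "snd (compl p r 0 \<sigma> ! k) + q (\<sigma> ! k) \<le> Lmax p r q \<sigma>"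
proof -
  have "compl p r 0 \<sigma> ! k \<in> set (compl p r 0 \<sigma>)" using assms by auto
  hence "snd (compl p r 0 \<sigma> ! k) + q (\<sigma> ! k) \<in> set (map (\<lambda>(j, c). c + q j) (compl p r 0 \<sigma>))"
    using fst_compl[OF assms, of p r 0] by (auto simp: image_iff case_prod_beta intro!: bexI[of _ "compl p r 0 \<sigma> ! k"])
  thus ?thesis using assms by (auto simp: Lmax_def)
qed

lemma Cmax_le:
  assumes "\<sigma> \<noteq> []" "\<And>k. k < length \<sigma> \<Longrightarrow> snd (compl p r 0 \<sigma> ! k) \<le> C"
  shows "Cmax p r \<sigma> \<le> C"
proof -
  have "compl p r 0 \<sigma> \<noteq> []" using assms(1) by (metis length_compl length_0_conv)
  thus ?thesis unfolding Cmax_def using assms by (force simp: in_set_conv_nth)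
qed

lemma Lmax_le:
  assumes "\<sigma> \<noteq> []" "\<And>k. k < length \<sigma> \<Longrightarrow> snd (compl p r 0 \<sigma> ! k) + q (\<sigma> ! k) \<le> L"
  shows "Lmax p r q \<sigma> \<le> L"
proof -
  have "compl p r 0 \<sigma> \<noteq> []" using assms(1) by (metis length_compl length_0_conv)
  moreover have "c + q j \<le> L" if "(j, c) \<in> set (compl p r 0 \<sigma>)" for j c
  proof -
    obtain k where "k < length \<sigma>" "compl p r 0 \<sigma> ! k = (j, c)" using \<open>(j, c) \<in> _\<close> by (auto simp: in_set_conv_nth)
    thus ?thesis using assms(2)[of k] fst_compl[of k \<sigma> p r 0] by auto
  qed
  ultimately show ?thesis unfolding Lmax_def using assms by auto
qed

text \<open>Ties are broken by job index, so ranks form a permutation whatever the keys are.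
  Counting predecessors, rather than sorting, makes ranks computable by a plain double loop.\<close>

definition rk :: "nat \<Rightarrow> (nat \<Rightarrow> real) \<Rightarrow> nat \<Rightarrow> nat" where
  "rk n f j = card {i. i < n \<and> (f i < f j \<or> f i = f j \<and> i < j)}"

lemma rk_less: "j < n \<Longrightarrow> rk n f j < n"
proof -
  assume "j < n"
  hence "{i. i < n \<and> (f i < f j \<or> f i = f j \<and> i < j)} \<subset> {..<n}" by auto
  from psubset_card_mono[OF finite_lessThan this] show ?thesis unfolding rk_def by simp
qed

lemma rk_strict_mono:
  assumes "i < n" "f i < f j \<or> f i = f j \<and> i < j"
  shows "rk n f i < rk n f j"
  unfolding rk_def using assms by (intro psubset_card_mono) auto

lemma rk_inj: "inj_on (rk n f) {..<n}"
proof (rule inj_onI)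
  fix i j assume "i \<in> {..<n}" "j \<in> {..<n}" "rk n f i = rk n f j"
  thus "i = j" using rk_strict_mono[of i n f j] rk_strict_mono[of j n f i] by force
qed

lemma rk_le_imp: "i < n \<Longrightarrow> j < n \<Longrightarrow> rk n f i \<le> rk n f j \<Longrightarrow> f i \<le> f j"
  using rk_strict_mono[of j n f i] by force

lemma rk_bij: "bij_betw (rk n f) {..<n} {..<n}"
proof -
  have "rk n f ` {..<n} \<subseteq> {..<n}" using rk_less by auto
  thus ?thesis using rk_inj endo_inj_surj[of "{..<n}" "rk n f"] by (auto simp: bij_betw_def)
qed

definition ranked :: "nat \<Rightarrow> (nat \<Rightarrow> real) \<Rightarrow> nat list" where
  "ranked n f = map (inv_into {..<n} (rk n f)) [0..<n]"

lemma ranked_nth: "j < n \<Longrightarrow> ranked n f ! rk n f j = j"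
  unfolding ranked_def using rk_less[of j n f] rk_inj[of n f] by (simp add: inv_into_f_f)

lemma length_ranked [simp]: "length (ranked n f) = n"
  by (simp add: ranked_def)

lemma is_seq_ranked: "is_seq n (ranked n f)"
proof -
  have "bij_betw (inv_into {..<n} (rk n f)) {..<n} {..<n}" using rk_bij by (rule bij_betw_inv_into)
  thus ?thesis by (auto simp: is_seq_def ranked_def distinct_map bij_betw_def atLeast0LessThan)
qed

text \<open>Translates \<open>compl_le\<close> from positions to keys, so that the analysis of a
  candidate only has to compare keys.\<close>

lemma ranked_compl_le:
  assumes p: "\<And>j. j < n \<Longrightarrow> 0 \<le> r j" and inj: "inj_on f {..<n}" and j: "j < n"
    and X: "\<And>i. i < n \<Longrightarrow> f i \<le> f j \<Longrightarrow> r i + sum p {l\<in>{..<n}. f i \<le> f l \<and> f l \<le> f j} \<le> X"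
  shows "snd (compl p r 0 (ranked n f) ! rk n f j) \<le> X"
proof -
  define \<sigma> where "\<sigma> = ranked n f"
  have iff: "rk n f i \<le> rk n f l \<longleftrightarrow> f i \<le> f l" if "i < n" "l < n" for i l
    using that rk_le_imp[of i n l f] rk_strict_mono[of i n f l] inj by (force dest: inj_onD)
  have *: "r (\<sigma> ! a) + (\<Sum>l=a..rk n f j. p (\<sigma> ! l)) \<le> X" if a: "a \<le> rk n f j" for a
  proof -
    have "a < n" using a rk_less[OF j, of f] by auto
    then obtain i where i: "i < n" "a = rk n f i" using rk_bij[of n f] by (auto simp: bij_betw_def image_iff set_eq_iff) 
    have "(\<Sum>l=a..rk n f j. p (\<sigma> ! l)) = sum p {l\<in>{..<n}. f i \<le> f l \<and> f l \<le> f j}"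
    proof (rule sum.reindex_bij_witness[where i="rk n f" and j="(!) \<sigma>"])
      fix b assume b: "b \<in> {a..rk n f j}"
      hence "b < n" using rk_less[OF j, of f] by auto
      then obtain l where l: "l < n" "b = rk n f l" using rk_bij[of n f] by (auto simp: bij_betw_def image_iff set_eq_iff)
      thus "rk n f (\<sigma> ! b) = b" "\<sigma> ! b \<in> {l\<in>{..<n}. f i \<le> f l \<and> f l \<le> f j}"
        using b i j iff by (auto simp: \<sigma>_def ranked_nth)
    qed (use i j iff in \<open>auto simp: \<sigma>_def ranked_nth\<close>)
    thus ?thesis using X[of i] i a iff j by (auto simp: \<sigma>_def ranked_nth)
  qed
  have "0 \<le> r (\<sigma> ! 0)" using p is_seq_ranked[of n f] j nth_mem[of 0 \<sigma>] by (auto simp: is_seq_def \<sigma>_def)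
  thus ?thesis using *[of 0] * rk_less[OF j, of f] unfolding \<sigma>_def
    by (intro compl_le) (auto simp: atLeast0AtMost)
qed

lemma ranked_Cmax_le:
  assumes "\<And>j. j < n \<Longrightarrow> 0 \<le> r j" "\<And>j. j < n \<Longrightarrow> 0 \<le> p j" "inj_on f {..<n}" "0 < n"
    and C: "\<And>i. i < n \<Longrightarrow> r i + sum p {l\<in>{..<n}. f i \<le> f l} \<le> C"
  shows "Cmax p r (ranked n f) \<le> C"
proof (rule Cmax_le)
  fix k assume "k < length (ranked n f)"
  then obtain j where j: "j < n" "k = rk n f j" using rk_bij[of n f] by (auto simp: bij_betw_def image_iff set_eq_iff)
  show "snd (compl p r 0 (ranked n f) ! k) \<le> C"
    unfolding j(2)
  proof (rule ranked_compl_le)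
    fix i assume i: "i < n"
    have "sum p {l\<in>{..<n}. f i \<le> f l \<and> f l \<le> f j} \<le> sum p {l\<in>{..<n}. f i \<le> f l}"
      using assms(2) by (intro sum_mono2) auto
    thus "r i + sum p {l\<in>{..<n}. f i \<le> f l \<and> f l \<le> f j} \<le> C" using C[OF i] by auto
  qed (use assms j in auto)
qed (use assms in \<open>auto simp: ranked_def\<close>)

lemma ranked_Lmax_le:
  assumes "\<And>j. j < n \<Longrightarrow> 0 \<le> r j" "inj_on f {..<n}" "0 < n"
    and L: "\<And>i j. i < n \<Longrightarrow> j < n \<Longrightarrow> f i \<le> f j \<Longrightarrow>
      r i + sum p {l\<in>{..<n}. f i \<le> f l \<and> f l \<le> f j} + q j \<le> L"
  shows "Lmax p r q (ranked n f) \<le> L"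
proof (rule Lmax_le)
  fix k assume "k < length (ranked n f)"
  then obtain j where j: "j < n" "k = rk n f j" using rk_bij[of n f] by (auto simp: bij_betw_def image_iff set_eq_iff)
  have "snd (compl p r 0 (ranked n f) ! k) \<le> L - q j"
    unfolding j(2) by (rule ranked_compl_le) (use assms j L[of _ j] in \<open>auto simp: algebra_simps\<close>)
  thus "snd (compl p r 0 (ranked n f) ! k) + q (ranked n f ! k) \<le> L"
    using j ranked_nth by auto
qed (use assms in \<open>auto simp: ranked_def\<close>)

lemma seq_start_times:
  assumes "is_seq n \<sigma>" "valid_instance n p r q"
  obtains S :: "nat \<Rightarrow> real" and \<pi> :: "nat \<Rightarrow> nat" where "inj_on \<pi> {..<n}"
    "\<And>j. j < n \<Longrightarrow> r j \<le> S j \<and> S j + p j \<le> Cmax p r \<sigma> \<and> S j + p j + q j \<le> Lmax p r q \<sigma>"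
    "\<And>i j. i < n \<Longrightarrow> j < n \<Longrightarrow> \<pi> i < \<pi> j \<Longrightarrow> S i + p i \<le> S j"
proof -
  obtain \<pi> where \<pi>: "\<And>j. j < n \<Longrightarrow> \<pi> j < n \<and> \<sigma> ! \<pi> j = j" using is_seq_position[OF assms(1)] by metis
  have len: "length \<sigma> = n" using is_seq_length[OF assms(1)] .
  have p: "0 \<le> p j" if "j \<in> set \<sigma>" for j using assms that by (auto simp: is_seq_def valid_instance_def)
  define S where "S j = snd (compl p r 0 \<sigma> ! \<pi> j) - p j" for j
  show ?thesis
  proof (rule that[of \<pi> S])
    show "inj_on \<pi> {..<n}" using \<pi> by (intro inj_onI) (metis lessThan_iff)
    show "r j \<le> S j \<and> S j + p j \<le> Cmax p r \<sigma> \<and> S j + p j + q j \<le> Lmax p r q \<sigma>" if "j < n" for j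
      using compl_ge_start[of "\<pi> j" \<sigma> p 0 r] Cmax_ge[of "\<pi> j" \<sigma> p r] Lmax_ge[of "\<pi> j" \<sigma> p r q]
        \<pi>[OF that] len p by (auto simp: S_def)
    show "S i + p i \<le> S j" if "i < n" "j < n" "\<pi> i < \<pi> j" for i j
      using compl_order[of "\<pi> i" "\<pi> j" \<sigma> p r 0] \<pi>[of i] \<pi>[of j] that len p by (auto simp: S_def)
  qed
qed

lemma floor_eq_imp_close:
  fixes x y :: real
  assumes "nat \<lfloor>x\<rfloor> = nat \<lfloor>y\<rfloor>" "0 \<le> x" "0 \<le> y"
  shows "x < y + 1"
proof -
  have "\<lfloor>x\<rfloor> = \<lfloor>y\<rfloor>" using assms by (simp add: eq_nat_nat_iff)
  thus ?thesis by linarith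
qed

text \<open>The last conclusion says that the jobs of one cell \<open>(\<gamma>, cell) = (s, a)\<close> span a box that
  contains no job of another segment, so that a segment is a union of \<open>K + 1\<close> boxes.\<close>

lemma segments_exist:
  fixes n K :: nat and p r q :: "nat \<Rightarrow> real" and e :: "nat \<Rightarrow> nat"
  assumes valid: "valid_instance n p r q" and seq: "is_seq n \<sigma>" and K: "1 \<le> K"
    and inj: "inj_on e {..<n}" and r_mono: "\<And>i j. i < n \<Longrightarrow> j < n \<Longrightarrow> e i \<le> e j \<Longrightarrow> r i \<le> r j"
  obtains \<gamma> cell :: "nat \<Rightarrow> nat" where
    "\<And>j. j < n \<Longrightarrow> \<gamma> j \<le> 2 * (K * (K + 2)) + 1 \<and> cell j \<le> K"
    "\<And>j. j < n \<Longrightarrow> r j + sum p {i\<in>{..<n}. \<gamma> j < \<gamma> i \<or> \<gamma> i = \<gamma> j \<and> e j \<le> e i} \<le> Cmax p r \<sigma>"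
    "\<And>i j. i < n \<Longrightarrow> j < n \<Longrightarrow> \<gamma> i \<le> \<gamma> j \<Longrightarrow>
      r i + sum p {l\<in>{..<n}. \<gamma> i \<le> \<gamma> l \<and> \<gamma> l \<le> \<gamma> j} + q j \<le> (1 + 4 / K) * Lmax p r q \<sigma>"
    "\<And>j z1 z2 z3 z4 z5 s a. j < n \<Longrightarrow> {z1, z2, z3, z4, z5} \<subseteq> {z\<in>{..<n}. \<gamma> z = s \<and> cell z = a} \<Longrightarrow>
      p j \<le> p z1 \<Longrightarrow> q z2 \<le> q j \<Longrightarrow> q j \<le> q z3 \<Longrightarrow> e z4 \<le> e j \<Longrightarrow> e j \<le> e z5 \<Longrightarrow> \<gamma> j = s"
proof -
  define M where "M = Lmax p r q \<sigma>"
  obtain S :: "nat \<Rightarrow> real" and \<pi> :: "nat \<Rightarrow> nat" where \<pi>: "inj_on \<pi> {..<n}" and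
    S: "\<And>j. j < n \<Longrightarrow> r j \<le> S j \<and> S j + p j \<le> Cmax p r \<sigma> \<and> S j + p j + q j \<le> M"
    and order: "\<And>i j. i < n \<Longrightarrow> j < n \<Longrightarrow> \<pi> i < \<pi> j \<Longrightarrow> S i + p i \<le> S j"
    by (rule seq_start_times[OF seq valid, folded M_def]) (rule that)
  have nn: "0 \<le> p j" "0 \<le> r j" "0 \<le> q j" if "j < n" for j using valid that by (auto simp: valid_instance_def)
  show ?thesis
  proof (cases "M > 0")
    \<comment> \<open>All job data vanish, so one segment with one cell will do. The other case may
      divide by \<open>M\<close>.\<close>
    case False
    hence z: "p j = 0" "r j = 0" "q j = 0" if "j < n" for j using S[OF that] nn[OF that] by linarith+
    have M0: "M = 0" if "j < n" for j using z[OF that] S[OF that] False by auto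
    have C: "0 \<le> Cmax p r \<sigma>" if "j < n" for j using z[OF that] S[OF that] by auto
    show ?thesis
      by (rule that[of "\<lambda>_. 0" "\<lambda>_. 0"]) (use z C M0 M_def in auto)
  next
    case M: True
    \<comment> \<open>\<open>M / H\<close> is both the slot length and the threshold for short jobs;
      the factor \<open>K + 2\<close> matches the number of \<open>\<mu>\<close> terms in
      \<open>rearranged_completion\<close>.\<close>
    define H where "H = K * (K + 2)"
    have "0 < H" using K by (auto simp: H_def)
    hence H: "0 < real H" by simp
    define small where "small j \<longleftrightarrow> p j \<le> M / H" for j
    \<comment> \<open>Tails at most \<open>M\<close> give classes \<open>0\<close> to
      \<open>K\<close> for short jobs; the offset \<open>K + 1\<close> gives each long job a class
      of its own.\<close>
    define cl where "cl j = (if small j then nat \<lfloor>q j * K / M\<rfloor> else K + 1 + j)" for j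
    \<comment> \<open>A segment with a long job will contain nothing else, so any cell serves for
      it; \<open>0\<close> keeps the number of cells at \<open>K + 1\<close>.\<close>
    define cell where "cell j = (if small j then cl j else 0)" for j
    define slot where "slot j = nat \<lfloor>S j * H / M\<rfloor>" for j
    \<comment> \<open>Each slot has an even block for its short jobs and an odd one for a long job.
      A long job outlasts the slot, so it is the last to start there and \<open>\<beta>\<close> is
      monotone along the schedule.\<close>
    define \<beta> where "\<beta> j = 2 * slot j + (if small j then 0 else 1)" for j
    have S0: "0 \<le> S j" if "j < n" for j using S[OF that] nn[OF that] by auto
    have q_le: "q j \<le> M" and S_le: "S j \<le> M" if "j < n" for j using S[OF that] nn[OF that] by auto
    have cl_small: "cl j \<le> K" if "j < n" "small j" for j
    proof -
      have "q j * K / M \<le> K" using mult_right_mono[OF q_le[OF that(1)], of "real K"] M by (simp add: field_simps)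
      hence "\<lfloor>q j * K / M\<rfloor> \<le> int K" by linarith
      thus ?thesis using that by (auto simp: cl_def)
    qed
    have slot_le: "slot j \<le> H" if "j < n" for j
    proof -
      have "S j * H / M \<le> H" using mult_right_mono[OF S_le[OF that], of "real H"] M by (simp add: field_simps)
      hence "\<lfloor>S j * H / M\<rfloor> \<le> int H" by linarith
      thus ?thesis by (auto simp: slot_def)
    qed
    have slot_close: "S k < S l + M / H" if "k < n" "l < n" "slot k = slot l" for k l
    proof -
      have "S k * H / M < S l * H / M + 1"
        using that S0[of k] S0[of l] M unfolding slot_def by (intro floor_eq_imp_close) auto
      hence "S k * H < S l * H + M" using M by (simp add: field_simps)
      thus ?thesis using H by (simp add: field_simps)
    qed
    have slot_mono: "slot k \<le> slot l" if "S k \<le> S l" for k l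
      unfolding slot_def using that M H by (intro nat_mono floor_mono) (auto simp: divide_right_mono mult_right_mono)
    have big_slot: "slot k \<noteq> slot l" if "k < n" "l < n" "\<not> small k" "\<pi> k < \<pi> l" for k l
    proof
      assume "slot k = slot l"
      thus False using slot_close[of l k] order[of k l] that by (auto simp: small_def)
    qed
    interpret block_schedule "{..<n}" p e cl \<beta> r S \<pi>
    proof
      show "\<beta> i \<le> \<beta> j" if "i \<in> {..<n}" "j \<in> {..<n}" "\<pi> i < \<pi> j" for i j
      proof -
        have "S i \<le> S j" using order[of i j] nn[of i] that by auto
        thus ?thesis using slot_mono[of i j] big_slot[of i j] that by (auto simp: \<beta>_def)
      qed
    qed (use nn inj r_mono \<pi> order S in auto)
    have single: "l = k" if "k \<in> {..<n}" "l \<in> {..<n}" "K < cl k" "cl l = cl k" for k l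
      using that cl_small[of k] cl_small[of l] by (auto simp: cl_def split: if_splits)
    have alone: "l = k" if "k \<in> {..<n}" "l \<in> {..<n}" "\<not> small k" "\<beta> l = \<beta> k" for k l
    proof (rule ccontr)
      assume "l \<noteq> k"
      hence "\<pi> l \<noteq> \<pi> k" using inj_\<pi> that by (auto dest: inj_onD)
      moreover have "slot l = slot k" "\<not> small l" using that unfolding \<beta>_def by (auto split: if_splits) presburger
      ultimately show False using big_slot[of l k] big_slot[of k l] that by (metis lessThan_iff linorder_neqE_nat)
    qed
    have big_iff: "K < cl k \<longleftrightarrow> \<not> small k" if "k < n" for k
      using cl_small[OF that] by (auto simp: cl_def)
    have \<beta>_slot: "slot k = slot l" if "\<beta> k = \<beta> l" for k l
      using that unfolding \<beta>_def by (auto split: if_splits)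
    show ?thesis
    proof (rule that[of \<gamma> cell])
      fix j assume j: "j < n"
      obtain k where k: "k < n" "\<beta> k = \<gamma> j" using \<gamma>_witness[of j] j by auto
      have "\<beta> k \<le> 2 * H + 1" using slot_le[OF k(1)] by (auto simp: \<beta>_def)
      thus "\<gamma> j \<le> 2 * (K * (K + 2)) + 1 \<and> cell j \<le> K" using k cl_small[of j] j by (auto simp: H_def cell_def)
      show "r j + sum p {i\<in>{..<n}. \<gamma> j < \<gamma> i \<or> \<gamma> i = \<gamma> j \<and> e j \<le> e i} \<le> Cmax p r \<sigma>"
        using rearranged_makespan[of j] j S by auto
    next
      fix i j assume ij: "i < n" "j < n" "\<gamma> i \<le> \<gamma> j"
      obtain k where k: "k < n" "cl k = cl j"
        "r i + sum p {l\<in>{..<n}. \<gamma> i \<le> \<gamma> l \<and> \<gamma> l \<le> \<gamma> j} \<le> S k + p k + 2 * (M / H) + (real K + 2) * (M / H)"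
      proof (rule rearranged_completion[of i j "M / H" K "M / H"])
        show "S k \<le> S l + M / H" if "k \<in> {..<n}" "l \<in> {..<n}" "\<beta> k = \<beta> l" for k l
          using slot_close[of k l] \<beta>_slot[of k l] that by auto
        show "0 \<le> M / H" using M H by simp
        thus "0 \<le> M / H" .
        show "p k \<le> M / H" if "k \<in> {..<n}" "cl k \<le> K" for k
          using that big_iff[of k] by (auto simp: small_def)
        show "l = k" if "k \<in> {..<n}" "l \<in> {..<n}" "K < cl k" "cl l = cl k" for k l
          using single that by blast
        show "l = k" if "k \<in> {..<n}" "l \<in> {..<n}" "K < cl k" "\<beta> l = \<beta> k" for k l
          using alone[of k l] big_iff[of k] that by blast
      qed (use ij that in auto)
      \<comment> \<open>Short jobs of one class have tails in the same interval of length
        \<open>M / K\<close>; a long job is its own class.\<close>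
      have "q j \<le> q k + M / K"
      proof (cases "small j")
        case True
        hence "small k" using k big_iff[of k] cl_small[of j] ij by auto
        hence "q j * K / M < q k * K / M + 1"
          using True k(2) nn ij k(1) M by (intro floor_eq_imp_close) (auto simp: cl_def)
        hence "q j * K < q k * K + M" using M by (simp add: field_simps)
        thus ?thesis using K by (simp add: field_simps)
      next
        case False
        hence "j = k" using single[of j k] big_iff[of j] ij k by auto
        thus ?thesis using M by auto
      qed
      moreover have "S k + p k + q k \<le> M" using S[OF k(1)] by auto
      \<comment> \<open>The excess is at most \<open>2 * (M / K)\<close> for the two slot lengths,
        \<open>M / K\<close> for the short jobs and \<open>M / K\<close> for the tail, which
        explains the \<open>4\<close>.\<close>
      moreover have "M + 2 * (M / H) + (real K + 2) * (M / H) + M / K \<le> (1 + 4 / K) * M"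
      proof -
        have "(real K + 2) * (M / H) = (M * (real K + 2)) / (real K * (real K + 2))"
          unfolding H_def of_nat_mult of_nat_add by (simp only: times_divide_eq_right mult.commute of_nat_numeral)
        also have "\<dots> = M / K" by (rule nonzero_mult_divide_mult_cancel_right) linarith
        finally have A: "(real K + 2) * (M / H) = M / K" .
        have "real K \<le> real H" unfolding H_def of_nat_le_iff by simp
        hence B: "M / H \<le> M / K" using K M H by (intro divide_left_mono mult_pos_pos) linarith+
        have C: "(1 + 4 / K) * M = M + 4 * (M / K)" by (simp add: algebra_simps)
        show ?thesis unfolding A C using B by linarith
      qed
      ultimately show "r i + sum p {l\<in>{..<n}. \<gamma> i \<le> \<gamma> l \<and> \<gamma> l \<le> \<gamma> j} + q j \<le> (1 + 4 / K) * Lmax p r q \<sigma>"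
        using k(3) unfolding M_def[symmetric] by linarith
    next
      fix j z1 z2 z3 z4 z5 s a
      assume j: "j < n" and z: "{z1, z2, z3, z4, z5} \<subseteq> {z\<in>{..<n}. \<gamma> z = s \<and> cell z = a}"
        and le: "p j \<le> p z1" "q z2 \<le> q j" "q j \<le> q z3" "e z4 \<le> e j" "e j \<le> e z5"
      show "\<gamma> j = s"
      \<comment> \<open>A segment containing a long job \<open>b\<close> consists of
        \<open>b\<close> alone: any job placed there has an old class mate in the block of
        \<open>b\<close>, which must be \<open>b\<close>. Then both rank corners are
        \<open>b\<close>, and so is \<open>j\<close>.\<close>
      proof (cases "\<exists>z\<in>{..<n}. \<gamma> z = s \<and> \<not> small z")
        case True
        then obtain b where b: "b < n" "\<gamma> b = s" "\<not> small b" by auto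
        have only_b: "z = b" if z: "z < n" "\<gamma> z = s" for z
        proof -
          have "\<gamma> b = \<beta> b" using single[of b] big_iff[of b] b by (intro \<gamma>_singleton) auto
          moreover obtain k where "k < n" "cl k = cl z" "\<beta> k = \<gamma> z" using \<gamma>_witness[of z] z by auto
          ultimately have "k = b" "cl z = cl b" using alone[of b k] b z by auto
          thus ?thesis using single[of b z] big_iff[of b] b z by auto
        qed
        have "z4 = b" "z5 = b" by (rule only_b; use z in simp)+
        hence "e j = e b" using le by auto
        thus ?thesis using inj b j by (auto dest: inj_onD)
      next
        case False
        hence sm: "small z \<and> cl z = a \<and> \<gamma> z = s \<and> z < n" if "z \<in> {z1, z2, z3, z4, z5}" for z
        proof -
          have "z < n" "\<gamma> z = s" "cell z = a" using z that by auto
          thus ?thesis using False by (auto simp: cell_def)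
        qed
        \<comment> \<open>The corner in \<open>p\<close> makes \<open>j\<close> short, the corners
          in \<open>q\<close> put it into class \<open>a\<close>, and monotonicity of
          \<open>\<gamma>\<close> within the class squeezes \<open>\<gamma> j\<close> between the
          segments of \<open>z4\<close> and \<open>z5\<close>, both \<open>s\<close>.\<close>
        have "small j" using le(1) sm[of z1] by (auto simp: small_def)
        moreover have "nat \<lfloor>q z2 * K / M\<rfloor> \<le> nat \<lfloor>q j * K / M\<rfloor>" "nat \<lfloor>q j * K / M\<rfloor> \<le> nat \<lfloor>q z3 * K / M\<rfloor>"
          using le M by (auto intro!: nat_mono floor_mono divide_right_mono mult_right_mono)
        ultimately have "cl j = a" using sm[of z2] sm[of z3] by (auto simp: cl_def)
        thus ?thesis using \<gamma>_mono[of z4 j] \<gamma>_mono[of j z5] sm[of z4] sm[of z5] j le by auto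
      qed
    qed
  qed
qed

section \<open>Segments described by boxes\<close>

text \<open>Being short is a one-sided condition, hence a single bound on \<open>p\<close>; tail
  class and release rank need bounds on both sides.\<close>

definition in_box :: "(nat \<Rightarrow> real) \<Rightarrow> (nat \<Rightarrow> real) \<Rightarrow> (nat \<Rightarrow> nat) \<Rightarrow> (nat \<Rightarrow> nat) \<Rightarrow> nat \<Rightarrow> nat \<Rightarrow> bool" where
  "in_box p q e x t j \<longleftrightarrow> p j \<le> p (x (5 * t)) \<and> q (x (5 * t + 1)) \<le> q j \<and> q j \<le> q (x (5 * t + 2)) \<and>
     e (x (5 * t + 3)) \<le> e j \<and> e j \<le> e (x (5 * t + 4))"

text \<open>With \<open>A\<close> boxes per segment, box \<open>t\<close> belongs to segment
  \<open>t div A\<close>. For arbitrary corners boxes may overlap; the last one wins, and jobs in no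
  box go to segment 0, so every tuple yields a sequence.\<close>

fun segment :: "nat \<Rightarrow> (nat \<Rightarrow> real) \<Rightarrow> (nat \<Rightarrow> real) \<Rightarrow> (nat \<Rightarrow> nat) \<Rightarrow> (nat \<Rightarrow> nat) \<Rightarrow> nat \<Rightarrow> nat \<Rightarrow> nat" where
  "segment A p q e x 0 j = 0"
| "segment A p q e x (Suc t) j = (if in_box p q e x t j then t div A else segment A p q e x t j)"

text \<open>Ranks are below \<open>n\<close>, so the numeric key encodes the lexicographic order by
  segment and then release rank.\<close>

definition candidate :: "nat \<Rightarrow> nat \<Rightarrow> nat \<Rightarrow> (nat \<Rightarrow> real) \<Rightarrow> (nat \<Rightarrow> real) \<Rightarrow> (nat \<Rightarrow> real) \<Rightarrow> (nat \<Rightarrow> nat) \<Rightarrow> nat list" where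
  "candidate A T n p r q x =
     ranked n (\<lambda>j. real (segment A p q (rk n r) x T j * n + rk n r j))"

lemma segment_eq:
  assumes "\<And>t. t < T \<Longrightarrow> in_box p q e x t j \<Longrightarrow> t div A = g" "\<exists>t<T. in_box p q e x t j"
  shows "segment A p q e x T j = g"
  using assms
proof (induction T)
  case (Suc T)
  show ?case
  proof (cases "in_box p q e x T j")
    case False
    hence "\<exists>t<T. in_box p q e x t j" using Suc.prems(2) less_Suc_eq by auto
    thus ?thesis using Suc False by auto
  qed (use Suc in auto)
qed auto

lemma lex_key:
  fixes g e :: "nat \<Rightarrow> nat"
  assumes "e i < n" "e j < n"
  shows "real (g i * n + e i) \<le> real (g j * n + e j) \<longleftrightarrow> g i < g j \<or> g i = g j \<and> e i \<le> e j"
proof -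
  have "g a * n + e a < g b * n + e b" if "g a < g b" "e a < n" for a b
  proof -
    have "(g a + 1) * n \<le> g b * n" using that by (intro mult_right_mono) auto
    thus ?thesis using that by simp
  qed
  from this[of i j] this[of j i] show ?thesis using assms unfolding of_nat_le_iff
    by (cases "g i" "g j" rule: linorder_cases) auto
qed

lemma box_exists:
  fixes p q :: "nat \<Rightarrow> real" and e :: "nat \<Rightarrow> nat"
  assumes n: "2 \<le> n" and inj: "inj_on e {..<n}" and Z: "Z \<subseteq> {..<n}"
    and sep: "\<And>j z1 z2 z3 z4 z5. j < n \<Longrightarrow> {z1, z2, z3, z4, z5} \<subseteq> Z \<Longrightarrow>
      p j \<le> p z1 \<Longrightarrow> q z2 \<le> q j \<Longrightarrow> q j \<le> q z3 \<Longrightarrow> e z4 \<le> e j \<Longrightarrow> e j \<le> e z5 \<Longrightarrow> R j"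
  shows "\<exists>z :: nat \<Rightarrow> nat. (\<forall>i<5. z i < n) \<and> (\<forall>j\<in>Z. in_box p q e z 0 j) \<and> (\<forall>j<n. in_box p q e z 0 j \<longrightarrow> R j)"
proof (cases "Z = {}")
  case True
  \<comment> \<open>An empty cell needs a box that no job satisfies: the lower rank corner
    \<open>d\<close> is put above the upper one \<open>f\<close>. This takes two jobs.\<close>
  have "e 0 \<noteq> e 1" using inj n by (auto dest: inj_onD)
  then obtain d f where df: "d < n" "f < n" "e f < e d"
    using n by (meson linorder_neqE_nat less_le_trans one_less_numeral_iff pos2 semiring_norm(76))
  show ?thesis
    by (rule exI[of _ "\<lambda>i. if i = 3 then d else f"]) (use df True in \<open>auto simp: in_box_def\<close>)
next
  case False
  have fin: "finite Z" using Z finite_subset by blast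
  have mx: "\<exists>z\<in>Z. \<forall>j\<in>Z. h j \<le> h z" for h :: "nat \<Rightarrow> real"
    using Max_in[of "h ` Z"] Max_ge[of "h ` Z"] fin False by fastforce
  obtain z1 z2 z3 z4 z5 where z: "z1 \<in> Z" "\<forall>j\<in>Z. p j \<le> p z1" "z2 \<in> Z" "\<forall>j\<in>Z. q z2 \<le> q j"
    "z3 \<in> Z" "\<forall>j\<in>Z. q j \<le> q z3" "z4 \<in> Z" "\<forall>j\<in>Z. e z4 \<le> e j" "z5 \<in> Z" "\<forall>j\<in>Z. e j \<le> e z5"
    using mx[of p] mx[of "\<lambda>j. - q j"] mx[of q] mx[of "\<lambda>j. - real (e j)"] mx[of "\<lambda>j. real (e j)"] by auto
  let ?z = "\<lambda>i. if i = 0 then z1 else if i = 1 then z2 else if i = 2 then z3 else if i = 3 then z4 else z5"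
  have "in_box p q e ?z 0 j \<longleftrightarrow> p j \<le> p z1 \<and> q z2 \<le> q j \<and> q j \<le> q z3 \<and> e z4 \<le> e j \<and> e j \<le> e z5" for j
    by (auto simp: in_box_def)
  thus ?thesis using z Z sep[of _ z1 z2 z3 z4 z5] by (intro exI[of _ ?z]) auto
qed

lemma is_seq_1: "is_seq (Suc 0) \<sigma> \<Longrightarrow> \<sigma> = [0]"
  using is_seq_length[of "Suc 0" \<sigma>] unfolding is_seq_def by (cases \<sigma>) auto

lemma candidate_approximates:
  fixes n K :: nat and p r q :: "nat \<Rightarrow> real"
  assumes valid: "valid_instance n p r q" and seq: "is_seq n \<sigma>" and n: "0 < n" and K: "1 \<le> K"
    and T: "T = (2 * (K * (K + 2)) + 2) * (K + 1)"
  obtains x where "\<And>i. i < 5 * T \<Longrightarrow> x i < n"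
    "Lmax p r q (candidate (K + 1) T n p r q x) \<le> (1 + 4 / K) * Lmax p r q \<sigma>"
    "Cmax p r (candidate (K + 1) T n p r q x) \<le> Cmax p r \<sigma>"
proof (cases "n = 1")
  \<comment> \<open>A single job cannot describe an empty box, but it has only one sequence.\<close>
  case True
  have "is_seq n (candidate (K + 1) T n p r q (\<lambda>_. 0))"
    unfolding candidate_def by (rule is_seq_ranked)
  hence eq: "candidate (K + 1) T n p r q (\<lambda>_. 0) = \<sigma>"
    using is_seq_1 seq True by (metis One_nat_def)
  have "0 \<le> Lmax p r q \<sigma>"
    using seq_start_times[OF seq valid] True valid unfolding valid_instance_def by (smt (verit) less_one)
  hence "Lmax p r q \<sigma> \<le> (1 + 4 / K) * Lmax p r q \<sigma>" by (simp add: algebra_simps)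
  thus ?thesis using eq True by (intro that[of "\<lambda>_. 0"]) auto
next
  case False
  hence n2: "2 \<le> n" using n by auto
  define e where "e = rk n r"
  have inj: "inj_on e {..<n}" unfolding e_def by (rule rk_inj)
  have e_less: "e j < n" if "j < n" for j using rk_less[OF that] by (simp add: e_def)
  have r_mono: "r i \<le> r j" if "i < n" "j < n" "e i \<le> e j" for i j
    using rk_le_imp that by (simp add: e_def)
  obtain \<gamma> cell :: "nat \<Rightarrow> nat" where
    bnd: "\<And>j. j < n \<Longrightarrow> \<gamma> j \<le> 2 * (K * (K + 2)) + 1 \<and> cell j \<le> K" and
    C: "\<And>j. j < n \<Longrightarrow> r j + sum p {i\<in>{..<n}. \<gamma> j < \<gamma> i \<or> \<gamma> i = \<gamma> j \<and> e j \<le> e i} \<le> Cmax p r \<sigma>" and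
    L: "\<And>i j. i < n \<Longrightarrow> j < n \<Longrightarrow> \<gamma> i \<le> \<gamma> j \<Longrightarrow>
      r i + sum p {l\<in>{..<n}. \<gamma> i \<le> \<gamma> l \<and> \<gamma> l \<le> \<gamma> j} + q j \<le> (1 + 4 / K) * Lmax p r q \<sigma>" and
    sep: "\<And>j z1 z2 z3 z4 z5 s a. j < n \<Longrightarrow> {z1, z2, z3, z4, z5} \<subseteq> {z\<in>{..<n}. \<gamma> z = s \<and> cell z = a} \<Longrightarrow>
      p j \<le> p z1 \<Longrightarrow> q z2 \<le> q j \<Longrightarrow> q j \<le> q z3 \<Longrightarrow> e z4 \<le> e j \<Longrightarrow> e j \<le> e z5 \<Longrightarrow> \<gamma> j = s"
    by (rule segments_exist[OF valid seq K inj r_mono]) (assumption | rule that)+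
  \<comment> \<open>Box \<open>t\<close> stands for segment \<open>t div (K + 1)\<close> and cell
    \<open>t mod (K + 1)\<close>. Segments go up to \<open>2 * (K * (K + 2)) + 1\<close> and cells
    up to \<open>K\<close>, whence the value of \<open>T\<close>.\<close>
  have "\<forall>t. \<exists>z :: nat \<Rightarrow> nat. (\<forall>i<5. z i < n) \<and>
    (\<forall>j\<in>{z\<in>{..<n}. \<gamma> z = t div (K + 1) \<and> cell z = t mod (K + 1)}. in_box p q e z 0 j) \<and>
    (\<forall>j<n. in_box p q e z 0 j \<longrightarrow> \<gamma> j = t div (K + 1))"
  proof
    fix t
    let ?Z = "{z\<in>{..<n}. \<gamma> z = t div (K + 1) \<and> cell z = t mod (K + 1)}"
    show "\<exists>z :: nat \<Rightarrow> nat. (\<forall>i<5. z i < n) \<and> (\<forall>j\<in>?Z. in_box p q e z 0 j) \<and>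
      (\<forall>j<n. in_box p q e z 0 j \<longrightarrow> \<gamma> j = t div (K + 1))"
      by (rule box_exists[OF n2 inj]) (blast, rule sep)
  qed
  from choice[OF this] obtain z :: "nat \<Rightarrow> nat \<Rightarrow> nat" where all: "\<forall>t. (\<forall>i<5. z t i < n) \<and>
    (\<forall>j\<in>{z\<in>{..<n}. \<gamma> z = t div (K + 1) \<and> cell z = t mod (K + 1)}. in_box p q e (z t) 0 j) \<and>
    (\<forall>j<n. in_box p q e (z t) 0 j \<longrightarrow> \<gamma> j = t div (K + 1))" ..
  have z: "z t i < n" if "i < 5" for t i
    using spec[OF all, of t] that by simp
  have z_cell: "in_box p q e (z t) 0 j" if "j < n" "\<gamma> j = t div (K + 1)" "cell j = t mod (K + 1)" for t j
    using spec[OF all, of t] that by simp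
  have z_box: "\<gamma> j = t div (K + 1)" if "j < n" "in_box p q e (z t) 0 j" for t j
    using spec[OF all, of t] that by simp
  define x where "x i = z (i div 5) (i mod 5)" for i
  have box: "in_box p q e x t j = in_box p q e (z t) 0 j" for t j
  proof -
    have "x (5 * t + i) = z t i" if "i < 5" for i using that by (simp add: x_def)
    from this[of 0] this[of 1] this[of 2] this[of 3] this[of 4] show ?thesis by (simp add: in_box_def numeral_2_eq_2)
  qed
  have seg: "segment (K + 1) p q e x T j = \<gamma> j" if j: "j < n" for j
  proof (rule segment_eq)
    let ?t = "\<gamma> j * (K + 1) + cell j"
    have "?t < (\<gamma> j + 1) * (K + 1)" using bnd[OF j] by auto
    also have "\<dots> \<le> T" unfolding T using bnd[OF j] by (intro mult_right_mono) auto
    finally have "?t < T" .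
    have dm: "(g * m + c) div m = g" "(g * m + c) mod m = c" if "c < m" for g m c :: nat
      using that by auto
    have "cell j < K + 1" using bnd[OF j] by simp
    note dm[OF this, of "\<gamma> j"]
    hence "in_box p q e x ?t j" using z_cell[OF j, of ?t] box by auto
    with \<open>?t < T\<close> show "\<exists>t<T. in_box p q e x t j" by blast
  qed (use z_box j box in auto)
  define f where "f j = real (segment (K + 1) p q e x T j * n + e j)" for j
  have f: "f i \<le> f l \<longleftrightarrow> \<gamma> i < \<gamma> l \<or> \<gamma> i = \<gamma> l \<and> e i \<le> e l" if "i < n" "l < n" for i l
    unfolding f_def seg[OF that(1)] seg[OF that(2)] using that e_less by (intro lex_key)
  have inj_f: "inj_on f {..<n}"
  proof (rule inj_onI)
    fix i j assume ij: "i \<in> {..<n}" "j \<in> {..<n}" "f i = f j"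
    hence "e i = e j" using f[of i j] f[of j i] by auto
    thus "i = j" using inj ij by (auto dest: inj_onD)
  qed
  have cand: "candidate (K + 1) T n p r q x = ranked n f"
    unfolding candidate_def f_def e_def ..
  have nn: "0 \<le> p j" "0 \<le> r j" if "j < n" for j using valid that by (auto simp: valid_instance_def)
  have "Cmax p r (ranked n f) \<le> Cmax p r \<sigma>"
  proof (rule ranked_Cmax_le)
    fix i assume i: "i < n"
    have "{l\<in>{..<n}. f i \<le> f l} = {l\<in>{..<n}. \<gamma> i < \<gamma> l \<or> \<gamma> l = \<gamma> i \<and> e i \<le> e l}"
      using f i by auto
    thus "r i + sum p {l\<in>{..<n}. f i \<le> f l} \<le> Cmax p r \<sigma>" using C[OF i] by simp
  qed (use nn inj_f n in auto)
  moreover have "Lmax p r q (ranked n f) \<le> (1 + 4 / K) * Lmax p r q \<sigma>"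
  proof (rule ranked_Lmax_le)
    fix i j assume ij: "i < n" "j < n" "f i \<le> f j"
    have "sum p {l\<in>{..<n}. f i \<le> f l \<and> f l \<le> f j} \<le> sum p {l\<in>{..<n}. \<gamma> i \<le> \<gamma> l \<and> \<gamma> l \<le> \<gamma> j}"
    proof (rule sum_mono2)
      show "{l\<in>{..<n}. f i \<le> f l \<and> f l \<le> f j} \<subseteq> {l\<in>{..<n}. \<gamma> i \<le> \<gamma> l \<and> \<gamma> l \<le> \<gamma> j}"
      proof
        fix l assume "l \<in> {l\<in>{..<n}. f i \<le> f l \<and> f l \<le> f j}"
        thus "l \<in> {l\<in>{..<n}. \<gamma> i \<le> \<gamma> l \<and> \<gamma> l \<le> \<gamma> j}" using f[of i l] f[of l j] ij by simp linarith
      qed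
    qed (use nn in auto)
    thus "r i + sum p {l\<in>{..<n}. f i \<le> f l \<and> f l \<le> f j} + q j \<le> (1 + 4 / K) * Lmax p r q \<sigma>"
      using L[of i j] f[of i j] ij by auto
  qed (use nn inj_f n in auto)
  ultimately show ?thesis using z by (intro that[of x]) (unfold cand, auto simp: x_def)
qed

lemma in_box_cong:
  assumes "\<And>i. i < 5 * T \<Longrightarrow> x i = y i" "t < T"
  shows "in_box p q e x t j = in_box p q e y t j"
  using assms(1)[of "5 * t"] assms(1)[of "5 * t + 1"] assms(1)[of "5 * t + 2"] assms(1)[of "5 * t + 3"]
    assms(1)[of "5 * t + 4"] assms(2) by (simp add: in_box_def)

lemma segment_cong:
  "(\<And>i. i < 5 * T \<Longrightarrow> x i = y i) \<Longrightarrow> segment A p q e x T j = segment A p q e y T j"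
proof (induction T)
  case (Suc T)
  thus ?case using in_box_cong[of "Suc T" x y T p q e j] by simp
qed simp

text \<open>Allows a tuple to be normalised to \<open>0\<close> beyond the first
  \<open>5 * T\<close> entries, as in the enumeration.\<close>

lemma candidate_cong:
  assumes "\<And>i. i < 5 * T \<Longrightarrow> x i = y i"
  shows "candidate A T n p r q x = candidate A T n p r q y"
proof -
  have "segment A p q (rk n r) x T = segment A p q (rk n r) y T"
    by (rule ext, rule segment_cong, rule assms)
  thus ?thesis unfolding candidate_def by simp
qed

section \<open>A structured language for the machine\<close>

type_synonym mem = "nat \<Rightarrow> real"

text \<open>A loop \<open>For x l c\<close> increments its counter \<open>x\<close> by the content of address 1, which has to be 1.\<close>

datatype com =
    Blk "instr list"
  | Seq com com
  | IfLe nat nat com com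
  | For nat nat com

fun eff :: "instr \<Rightarrow> mem \<Rightarrow> mem" where
  "eff (Const k c) m = m(k := of_int c)"
| "eff (Add i j k) m = m(k := m i + m j)"
| "eff (Sub i j k) m = m(k := m i - m j)"
| "eff (Mul i j k) m = m(k := m i * m j)"
| "eff (Dv i j k) m = m(k := m i / m j)"
| "eff (Load i k) m = m(k := m (addr (m i)))"
| "eff (Store i k) m = m(addr (m k) := m i)"
| "eff (Jle i j t) m = m"
| "eff Halt m = m"

fun is_jump :: "instr \<Rightarrow> bool" where
  "is_jump (Jle i j t) = True"
| "is_jump Halt = True"
| "is_jump _ = False"

fun csize :: "com \<Rightarrow> nat" where
  "csize (Blk is) = length is"
| "csize (Seq c1 c2) = csize c1 + csize c2"
| "csize (IfLe i j c1 c2) = csize c1 + csize c2 + 2"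
| "csize (For x l c) = csize c + 4"

text \<open>Jump targets are absolute, so compilation takes the start address.
  \<open>Jle i i\<close> serves as an unconditional jump; the else branch comes first because a
  failed test falls through.\<close>

fun code :: "nat \<Rightarrow> com \<Rightarrow> instr list" where
  "code a (Blk is) = is"
| "code a (Seq c1 c2) = code a c1 @ code (a + csize c1) c2"
| "code a (IfLe i j c1 c2) = Jle i j (a + 2 + csize c2) #
     code (a + 1) c2 @ Jle i i (a + 2 + csize c2 + csize c1) # code (a + 2 + csize c2) c1"
| "code a (For x l c) = Const x 0 # Jle l x (a + 4 + csize c) #
     code (a + 2) c @ [Add x 1 x, Jle x x (a + 1)]"

lemma length_code [simp]: "length (code a c) = csize c"
  by (induction c arbitrary: a) auto

definition code_at :: "instr list \<Rightarrow> nat \<Rightarrow> instr list \<Rightarrow> bool" where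
  "code_at P a is \<longleftrightarrow> (\<exists>xs ys. P = xs @ is @ ys \<and> length xs = a)"

lemma code_at_append: "code_at P a (is @ js) \<Longrightarrow> code_at P a is \<and> code_at P (a + length is) js"
  unfolding code_at_def by (metis append.assoc length_append)

lemma code_at_Cons: "code_at P a (i # is) \<Longrightarrow> a < length P \<and> P ! a = i \<and> code_at P (Suc a) is"
proof -
  assume "code_at P a (i # is)"
  hence 1: "code_at P a [i]" "code_at P (Suc a) is" using code_at_append[of P a "[i]" "is"] by auto
  from 1(1) have "a < length P \<and> P ! a = i" unfolding code_at_def by auto
  with 1(2) show ?thesis by simp
qed

lemma steps_add: "steps P (k + l) s = steps P l (steps P k s)"
  unfolding steps_def by (simp add: add.commute[of k] funpow_add)

lemma steps_1 [simp]: "steps P (Suc 0) s = step P s"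
  by (simp add: steps_def)

lemma steps_trans:
  assumes "\<exists>k\<le>t1. steps P k s = s1" "\<exists>k\<le>t2. steps P k s1 = s2"
  shows "\<exists>k\<le>t1 + t2. steps P k s = s2"
proof -
  obtain k l where "k \<le> t1" "steps P k s = s1" "l \<le> t2" "steps P l s1 = s2" using assms by auto
  thus ?thesis by (intro exI[of _ "k + l"]) (auto simp: steps_add)
qed

lemma steps_one: "step P s = s1 \<Longrightarrow> \<exists>k\<le>1. steps P k s = s1"
  by (intro exI[of _ 1]) simp

section \<open>Weakest preconditions with a time bound\<close>

text \<open>Quantifying over every program that contains the compiled code at any address is what
  makes the rules compositional.\<close>

definition runs :: "com \<Rightarrow> mem \<Rightarrow> nat \<Rightarrow> mem \<Rightarrow> bool" where
  "runs c m t m' \<longleftrightarrow> (\<forall>P a. code_at P a (code a c) \<longrightarrow>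
     (\<exists>k\<le>t. steps P k (a, m) = (a + csize c, m')))"

lemma runsD:
  "runs c m t m' \<Longrightarrow> code_at P a (code a c) \<Longrightarrow> \<exists>k\<le>t. steps P k (a, m) = (a + csize c, m')"
  unfolding runs_def by blast

definition wp :: "com \<Rightarrow> nat \<Rightarrow> (mem \<Rightarrow> bool) \<Rightarrow> mem \<Rightarrow> bool" where
  "wp c t Q m \<longleftrightarrow> (\<exists>m'. runs c m t m' \<and> Q m')"

lemma wp_mono: "wp c t Q m \<Longrightarrow> t \<le> t' \<Longrightarrow> (\<And>m'. Q m' \<Longrightarrow> Q' m') \<Longrightarrow> wp c t' Q' m"
  unfolding wp_def runs_def by (meson le_trans)

lemma runs_Blk:
  assumes "\<forall>i\<in>set is. \<not> is_jump i"
  shows "runs (Blk is) m (length is) (fold eff is m)"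
  unfolding runs_def
proof (intro allI impI)
  fix P a assume "code_at P a (code a (Blk is))"
  hence "code_at P a is" by simp
  thus "\<exists>k\<le>length is. steps P k (a, m) = (a + csize (Blk is), fold eff is m)"
    using assms
  proof (induction "is" arbitrary: a m)
    case Nil
    thus ?case by (auto simp: steps_def)
  next
    case (Cons i "is")
    have 1: "step P (a, m) = (Suc a, eff i m)"
      using code_at_Cons[OF Cons.prems(1)] Cons.prems(2) by (cases i) auto
    have 2: "\<exists>k\<le>length is. steps P k (Suc a, eff i m) = (Suc a + csize (Blk is), fold eff is (eff i m))"
      using code_at_Cons[OF Cons.prems(1)] Cons.prems(2) by (intro Cons.IH) auto
    from steps_trans[OF steps_one[OF 1] 2] show ?case by simp
  qed
qed

lemma wp_Blk:
  assumes "\<forall>i\<in>set is. \<not> is_jump i" "Q (fold eff is m)"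
  shows "wp (Blk is) (length is) Q m"
  unfolding wp_def using runs_Blk assms by blast

lemma wp_Seq:
  assumes "wp c1 t1 (wp c2 t2 Q) m"
  shows "wp (Seq c1 c2) (t1 + t2) Q m"
proof -
  obtain m1 m2 where m: "runs c1 m t1 m1" "runs c2 m1 t2 m2" "Q m2" using assms unfolding wp_def by auto
  have "runs (Seq c1 c2) m (t1 + t2) m2"
    unfolding runs_def
  proof (intro allI impI)
    fix P a assume "code_at P a (code a (Seq c1 c2))"
    hence "code_at P a (code a c1)" "code_at P (a + csize c1) (code (a + csize c1) c2)"
      using code_at_append by fastforce+
    hence "\<exists>k\<le>t1. steps P k (a, m) = (a + csize c1, m1)"
      "\<exists>k\<le>t2. steps P k (a + csize c1, m1) = (a + csize c1 + csize c2, m2)"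
      using m unfolding runs_def by blast+
    from steps_trans[OF this] show "\<exists>k\<le>t1 + t2. steps P k (a, m) = (a + csize (Seq c1 c2), m2)"
      by (simp add: add.assoc)
  qed
  thus ?thesis using m unfolding wp_def by auto
qed

lemma wp_IfLe:
  assumes "if m i \<le> m j then wp c1 t Q m else wp c2 t Q m"
  shows "wp (IfLe i j c1 c2) (t + 2) Q m"
proof -
  obtain m' where m': "Q m'" "if m i \<le> m j then runs c1 m t m' else runs c2 m t m'"
    using assms unfolding wp_def by (auto split: if_splits)
  have "runs (IfLe i j c1 c2) m (t + 2) m'"
    unfolding runs_def
  proof (intro allI impI)
    fix P a assume c: "code_at P a (code a (IfLe i j c1 c2))"
    let ?b = "a + 2 + csize c2"
    have c0: "a < length P" "P ! a = Jle i j ?b" and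
      c2: "code_at P (a + 1) (code (a + 1) c2)" and
      cj: "code_at P (a + 1 + csize c2) (Jle i i (?b + csize c1) # code ?b c1)"
      using code_at_Cons[OF c[unfolded code.simps]] code_at_append[of P "Suc a" "code (a + 1) c2"] by auto
    have c1: "code_at P ?b (code ?b c1)"
      and j: "a + 1 + csize c2 < length P" "P ! (a + 1 + csize c2) = Jle i i (?b + csize c1)"
      using code_at_Cons[OF cj] by auto
    show "\<exists>k\<le>t + 2. steps P k (a, m) = (a + csize (IfLe i j c1 c2), m')"
    proof (cases "m i \<le> m j")
      case True
      have "\<exists>k\<le>1. steps P k (a, m) = (?b, m)" using c0 True by (intro steps_one) auto
      moreover have "\<exists>k\<le>t. steps P k (?b, m) = (?b + csize c1, m')"
        by (rule runsD[OF _ c1]) (use m' True in simp)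
      ultimately have "\<exists>k\<le>1 + t. steps P k (a, m) = (?b + csize c1, m')" by (rule steps_trans)
      moreover have "?b + csize c1 = a + csize (IfLe i j c1 c2)" by simp
      ultimately show ?thesis by (metis add.commute le_trans one_le_numeral add_le_cancel_left)
    next
      case False
      have "\<exists>k\<le>1. steps P k (a, m) = (a + 1, m)" using c0 False by (intro steps_one) auto
      moreover have "\<exists>k\<le>t. steps P k (a + 1, m) = (a + 1 + csize c2, m')"
        by (rule runsD[OF _ c2]) (use m' False in simp)
      ultimately have 1: "\<exists>k\<le>1 + t. steps P k (a, m) = (a + 1 + csize c2, m')" by (rule steps_trans)
      have 2: "\<exists>k\<le>1. steps P k (a + 1 + csize c2, m') = (?b + csize c1, m')" using j by (intro steps_one) auto
      have "\<exists>k\<le>(1 + t) + 1. steps P k (a, m) = (?b + csize c1, m')" by (rule steps_trans[OF 1 2])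
      moreover have "?b + csize c1 = a + csize (IfLe i j c1 c2)" "1 + t + 1 = t + 2" by simp_all
      ultimately show ?thesis by metis
    qed
  qed
  thus ?thesis using m' unfolding wp_def by auto
qed

text \<open>\<open>Inv (Suc i)\<close> is required of the memory after the counter has been
  increased. Each round costs \<open>t\<close> plus test, increment and jump back; the final
  \<open>2\<close> pays for initialisation and the failing round's test.\<close>

lemma wp_For:
  assumes l: "\<And>i m. Inv i m \<Longrightarrow> m l = real N \<and> m 1 = 1" and x: "x \<noteq> 1"
    and init: "Inv 0 (m(x := 0))"
    and body: "\<And>i m. i < N \<Longrightarrow> Inv i m \<Longrightarrow> m x = real i \<Longrightarrow>
      wp c t (\<lambda>m'. m' x = real i \<and> Inv (Suc i) (m'(x := real (Suc i)))) m"
    and Q: "\<And>m'. Inv N m' \<Longrightarrow> m' x = real N \<Longrightarrow> Q m'"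
  shows "wp (For x l c) (N * (t + 3) + 2) Q m"
proof -
  have "\<exists>m'. Inv N m' \<and> m' x = real N \<and> (\<forall>P a. code_at P a (code a (For x l c)) \<longrightarrow>
    (\<exists>k\<le>(N - i) * (t + 3) + 1. steps P k (a + 1, m) = (a + csize (For x l c), m')))"
    if "i \<le> N" "Inv i m" "m x = real i" for i m
    using that
  proof (induction "N - i" arbitrary: i m)
    case 0
    hence i: "i = N" by auto
    have "\<exists>k\<le>1. steps P k (a + 1, m) = (a + csize (For x l c), m)"
      if "code_at P a (code a (For x l c))" for P a
    proof (rule steps_one)
      have "a + 1 < length P \<and> P ! (a + 1) = Jle l x (a + 4 + csize c)"
        using code_at_Cons[OF that[unfolded code.simps]] code_at_Cons[of P "Suc a"] by auto
      thus "step P (a + 1, m) = (a + csize (For x l c), m)" using l[OF 0(3)] 0 i by auto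
    qed
    thus ?case using 0 i by (intro exI[of _ m]) auto
  next
    case (Suc d)
    have iN: "i < N" using Suc by auto
    obtain m1 where m1: "runs c m t m1" "m1 x = real i" "Inv (Suc i) (m1(x := real (Suc i)))"
      using body[OF iN Suc.prems(2,3)] unfolding wp_def by auto
    have one: "m1 1 = 1" using l[OF m1(3)] x by auto
    have d: "d = N - Suc i" "Suc i \<le> N" using Suc.hyps(2) iN by auto
    have x1: "(m1(x := real (Suc i))) x = real (Suc i)" by simp
    obtain m' where m': "Inv N m'" "m' x = real N" and
      rest: "\<And>P a. code_at P a (code a (For x l c)) \<Longrightarrow>
        \<exists>k\<le>(N - Suc i) * (t + 3) + 1. steps P k (a + 1, m1(x := real (Suc i))) = (a + csize (For x l c), m')"
      using Suc.hyps(1)[OF d m1(3) x1] by blast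
    have "\<exists>k\<le>(N - i) * (t + 3) + 1. steps P k (a + 1, m) = (a + csize (For x l c), m')"
      if cd: "code_at P a (code a (For x l c))" for P a
    proof -
      have j1: "a + 1 < length P" "P ! (a + 1) = Jle l x (a + 4 + csize c)"
        and cr: "code_at P (a + 2) (code (a + 2) c @ [Add x 1 x, Jle x x (a + 1)])"
        using code_at_Cons[OF cd[unfolded code.simps]] code_at_Cons[of P "Suc a"] by auto
      have cc: "code_at P (a + 2) (code (a + 2) c)"
        and ca: "code_at P (a + 2 + csize c) [Add x 1 x, Jle x x (a + 1)]"
        using code_at_append[OF cr] by auto
      have i1: "a + 2 + csize c < length P" "P ! (a + 2 + csize c) = Add x 1 x"
        and i2: "a + 3 + csize c < length P" "P ! (a + 3 + csize c) = Jle x x (a + 1)"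
        using code_at_Cons[OF ca] code_at_Cons[of P "Suc (a + 2 + csize c)"] by (auto simp: numeral_3_eq_3)
      have 1: "\<exists>k\<le>1. steps P k (a + 1, m) = (a + 2, m)"
        using j1 l[OF Suc.prems(2)] Suc.prems(3) iN by (intro steps_one) auto
      have 2: "\<exists>k\<le>t. steps P k (a + 2, m) = (a + 2 + csize c, m1)"
        by (rule runsD[OF m1(1) cc])
      have 3: "\<exists>k\<le>1. steps P k (a + 2 + csize c, m1) = (a + 3 + csize c, m1(x := real (Suc i)))"
        using i1 one m1(2) by (intro steps_one) (auto simp: add.commute)
      have 4: "\<exists>k\<le>1. steps P k (a + 3 + csize c, m1(x := real (Suc i))) = (a + 1, m1(x := real (Suc i)))"
        using i2 by (intro steps_one) auto
      have "\<exists>k\<le>1 + (t + (1 + (1 + ((N - Suc i) * (t + 3) + 1)))). steps P k (a + 1, m) = (a + csize (For x l c), m')"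
        by (intro steps_trans[OF 1] steps_trans[OF 2] steps_trans[OF 3] steps_trans[OF 4] rest[OF cd])
      moreover have "N - i = Suc (N - Suc i)" using iN by auto
      hence "1 + (t + (1 + (1 + ((N - Suc i) * (t + 3) + 1)))) = (N - i) * (t + 3) + 1" by simp
      ultimately show ?thesis by metis
    qed
    thus ?case using m' by blast
  qed
  from this[of 0 "m(x := 0)"] init obtain m' where m': "Inv N m'" "m' x = real N" and
    rest: "\<And>P a. code_at P a (code a (For x l c)) \<Longrightarrow>
      \<exists>k\<le>N * (t + 3) + 1. steps P k (a + 1, m(x := 0)) = (a + csize (For x l c), m')"
    by auto
  have "runs (For x l c) m (N * (t + 3) + 2) m'"
    unfolding runs_def
  proof (intro allI impI)
    fix P a assume cd: "code_at P a (code a (For x l c))"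
    have "\<exists>k\<le>1. steps P k (a, m) = (a + 1, m(x := 0))"
      using code_at_Cons[OF cd[unfolded code.simps]] by (intro steps_one) auto
    from steps_trans[OF this rest[OF cd]]
    show "\<exists>k\<le>N * (t + 3) + 2. steps P k (a, m) = (a + csize (For x l c), m')" by simp
  qed
  thus ?thesis using Q[OF m'] unfolding wp_def by auto
qed

lemma halts:
  assumes "wp c t Q m"
  shows "\<exists>k\<le>t. halted (code 0 c @ [Halt]) (steps (code 0 c @ [Halt]) k (0, m)) \<and>
    Q (snd (steps (code 0 c @ [Halt]) k (0, m)))"
proof -
  let ?P = "code 0 c @ [Halt]"
  obtain m' where m': "runs c m t m'" "Q m'" using assms unfolding wp_def by auto
  have "code_at ?P 0 (code 0 c)" unfolding code_at_def by auto
  then obtain k where "k \<le> t" "steps ?P k (0, m) = (csize c, m')" using m' unfolding runs_def by fastforce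
  moreover have "?P ! csize c = Halt" by (metis length_code nth_append_length)
  ultimately show ?thesis using m' by (intro exI[of _ k]) (auto simp: halted_def)
qed

section \<open>Ranking and box tests\<close>

lemma addr_real [simp]: "addr (real k) = k"
  by (simp add: addr_def)

lemma addr_add [simp]: "addr (real i + real b) = b + i"
  unfolding of_nat_add[symmetric] addr_real by simp

lemma addr_triple [simp]: "addr (3 * real i + real b) = b + 3 * i"
  using addr_real[of "b + 3 * i"] by (simp add: add.commute)

lemma wp_Blk_le:
  assumes "\<forall>i\<in>set is. \<not> is_jump i" "length is \<le> t" "Q (fold eff is m)"
  shows "wp (Blk is) t Q m"
  using wp_mono[OF wp_Blk[of "is" Q m, OF assms(1,3)] assms(2)] by blast

lemma wp_IfLe_le:
  assumes "2 \<le> t" "m i \<le> m j \<Longrightarrow> wp c1 (t - 2) Q m" "\<not> m i \<le> m j \<Longrightarrow> wp c2 (t - 2) Q m"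
  shows "wp (IfLe i j c1 c2) t Q m"
  using wp_IfLe[of m i j c1 "t - 2" Q c2] assms by (auto simp: le_add_diff_inverse2 simp del: add_2_eq_Suc')

lemma wp_IfLe_iff:
  assumes "m i \<le> m j \<longleftrightarrow> B" "B \<Longrightarrow> wp c1 t Q m" "\<not> B \<Longrightarrow> wp c2 t Q m"
  shows "wp (IfLe i j c1 c2) (t + 2) Q m"
  using assms by (intro wp_IfLe) auto

lemma card_Suc_filter:
  "card {x. x < Suc i \<and> P x} = card {x. x < i \<and> P x} + (if P i then 1 else 0)"
proof -
  have "{x. x < Suc i \<and> P x} = (if P i then insert i {x. x < i \<and> P x} else {x. x < i \<and> P x})"
    by (auto simp: less_Suc_eq)
  thus ?thesis by simp
qed

text \<open>Register 12 holds the job \<open>j\<close>, register 2 its key and register 14 the count; register \<open>s\<close> is the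
  base address of the keys, which occupy every third cell.\<close>

definition count_code :: "nat \<Rightarrow> com" where
  "count_code s = For 13 4 (Seq (Blk [Add 13 13 0, Add 0 13 0, Add 0 s 0, Load 0 3])
     (IfLe 2 3 (IfLe 3 2 (IfLe 12 13 (Blk []) (Blk [Add 14 1 14])) (Blk [])) (Blk [Add 14 1 14])))"

lemma count_code_wp:
  assumes m: "m 1 = 1" "m 4 = real n" "m s = real sb" "m 12 = real j" "m 14 = 0" "m 2 = f j"
    and s: "s \<notin> {0, 3, 13, 14}" and sb: "20 \<le> sb" and f: "\<And>i. i < n \<Longrightarrow> m (sb + 3 * i) = f i"
  shows "wp (count_code s) (n * 14 + 2) (\<lambda>m'. (\<forall>a. a \<notin> {0, 3, 13, 14} \<longrightarrow> m' a = m a) \<and>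
    m' 14 = real (rk n f j)) m"
proof -
  define P where "P i \<longleftrightarrow> f i < f j \<or> f i = f j \<and> i < j" for i
  define Inv where "Inv i m' \<longleftrightarrow> (\<forall>a. a \<notin> {0, 3, 13, 14} \<longrightarrow> m' a = m a) \<and>
    m' 14 = real (card {x. x < i \<and> P x})" for i and m' :: mem
  have "wp (count_code s) (n * (11 + 3) + 2) (\<lambda>m'. (\<forall>a. a \<notin> {0, 3, 13, 14} \<longrightarrow> m' a = m a) \<and>
    m' 14 = real (rk n f j)) m"
    unfolding count_code_def
  proof (rule wp_For[where Inv=Inv])
    show "m' 4 = real n \<and> m' 1 = 1" if "Inv i m'" for i m' using that m by (simp add: Inv_def)
    show "Inv 0 (m(13 := 0))" using m by (simp add: Inv_def)
  next
    fix i m' assume i: "i < n" and inv: "Inv i m'" and x: "m' 13 = real i"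
    have fr: "m' a = m a" if "a \<notin> {0, 3, 13, 14}" for a using inv that by (simp add: Inv_def)
    have reg: "m' 1 = 1" "m' s = real sb" "m' 12 = real j" "m' 2 = f j" "m' (sb + 3 * i) = f i"
      using fr m s f[OF i] sb by auto
    have c: "m' 14 = real (card {x. x < i \<and> P x})" using inv by (simp add: Inv_def)
    let ?m = "m'(0 := real i + real i + real i + real sb, 3 := f i)"
    have ev: "fold eff [Add 13 13 0, Add 0 13 0, Add 0 s 0, Load 0 3] m' = ?m"
      using x reg s sb by (simp add: fun_upd_def fun_eq_iff)
    show "wp (Seq (Blk [Add 13 13 0, Add 0 13 0, Add 0 s 0, Load 0 3])
     (IfLe 2 3 (IfLe 3 2 (IfLe 12 13 (Blk []) (Blk [Add 14 1 14])) (Blk [])) (Blk [Add 14 1 14]))) 11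
     (\<lambda>m'. m' 13 = real i \<and> Inv (Suc i) (m'(13 := real (Suc i)))) m'" (is "wp _ _ ?Q _")
    proof -
      have yes: "?Q (fold eff [Add 14 1 14] ?m)" if "P i"
        using that x c fr reg unfolding Inv_def card_Suc_filter by simp
      have no: "?Q (fold eff [] ?m)" if "\<not> P i"
        using that x c fr reg unfolding Inv_def card_Suc_filter by simp
      \<comment> \<open>The nested tests reproduce the tie-breaking of \<open>rk\<close>:
        \<open>i\<close> counts if its key is smaller, or equal with \<open>i < j\<close>.\<close>
      have "wp (IfLe 2 3 (IfLe 3 2 (IfLe 12 13 (Blk []) (Blk [Add 14 1 14])) (Blk [])) (Blk [Add 14 1 14])) 7 ?Q ?m"
        using reg x yes no
        by (intro wp_IfLe_le wp_Blk_le) (auto simp: P_def)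
      thus ?thesis unfolding ev[symmetric] by (intro wp_mono[OF wp_Seq[OF wp_Blk]]) auto
    qed
  next
    show "(\<forall>a. a \<notin> {0, 3, 13, 14} \<longrightarrow> m' a = m a) \<and> m' 14 = real (rk n f j)" if "Inv n m'" for m'
      using that by (simp add: Inv_def rk_def P_def)
  qed simp
  thus ?thesis by simp
qed

text \<open>Besides tabulating ranks, it writes each job at the address in register 11 plus its
  rank. The same routine thus computes release ranks and writes out a ranked sequence.\<close>

definition rank_code :: "nat \<Rightarrow> nat \<Rightarrow> com" where
  "rank_code s b = For 12 4
     (Seq (Blk [Const 14 0, Add 12 12 0, Add 0 12 0, Add 0 s 0, Load 0 2])
     (Seq (count_code s)
       (Blk [Add 12 12 0, Add 0 12 0, Add 0 b 0, Store 14 0, Add 14 11 0, Store 12 0])))"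

lemma rank_code_wp:
  assumes m: "m 1 = 1" "m 4 = real n" "m s = real sb" "m b = real bb" "m 11 = real ob"
    and sb: "s \<notin> {0, 2, 3, 12, 13, 14}" "b \<notin> {0, 2, 3, 12, 13, 14}" "20 \<le> sb" "20 \<le> bb" "20 \<le> ob"
      "s < 20" "b < 20"
    and disj: "\<And>i j. i < n \<Longrightarrow> j < n \<Longrightarrow> sb + 3 * i \<noteq> bb + 3 * j \<and> sb + 3 * i \<noteq> ob + j \<and> bb + 3 * i \<noteq> ob + j"
    and f: "\<And>i. i < n \<Longrightarrow> m (sb + 3 * i) = f i"
  shows "wp (rank_code s b) (n * (n * 14 + 16) + 2) (\<lambda>m'.
    (\<forall>a. a \<notin> {0, 2, 3, 12, 13, 14} \<and> (\<forall>i<n. a \<noteq> bb + 3 * i \<and> a \<noteq> ob + i) \<longrightarrow> m' a = m a) \<and>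
    (\<forall>j<n. m' (bb + 3 * j) = real (rk n f j) \<and> m' (ob + rk n f j) = real j)) m"
proof -
  define Inv where "Inv k m' \<longleftrightarrow>
    (\<forall>a. a \<notin> {0, 2, 3, 12, 13, 14} \<and> (\<forall>i<n. a \<noteq> bb + 3 * i \<and> a \<noteq> ob + i) \<longrightarrow> m' a = m a) \<and>
    (\<forall>j<k. m' (bb + 3 * j) = real (rk n f j) \<and> m' (ob + rk n f j) = real j)" for k and m' :: mem
  have inv_reg: "m' a = m a" if "Inv k m'" "a \<notin> {0, 2, 3, 12, 13, 14}" "a < 20" for k m' a
  proof -
    have "\<forall>i<n. a \<noteq> bb + 3 * i \<and> a \<noteq> ob + i" using that(3) sb by auto
    thus ?thesis using that(1,2) unfolding Inv_def by blast
  qed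
  have "wp (rank_code s b) (n * ((5 + (n * 14 + 2 + 6)) + 3) + 2) (Inv n) m"
    unfolding rank_code_def
  proof (rule wp_For[where Inv=Inv])
    show "m' 4 = real n \<and> m' 1 = 1" if "Inv i m'" for i m'
      using inv_reg[OF that, of 4] inv_reg[OF that, of 1] m by simp
    show "Inv 0 (m(12 := 0))" by (simp add: Inv_def)
  next
    fix j m' assume j: "j < n" and inv: "Inv j m'" and x: "m' 12 = real j"
    have reg: "m' 1 = 1" "m' 4 = real n" "m' s = real sb" "m' b = real bb" "m' 11 = real ob"
      using inv_reg[OF inv] m sb by auto
    have src: "m' (sb + 3 * i) = f i" if "i < n" for i
      using inv disj[OF that] f[OF that] sb unfolding Inv_def by auto
    let ?m = "m'(14 := 0, 0 := real j + real j + real j + real sb, 2 := f j)"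
    have ev: "fold eff [Const 14 0, Add 12 12 0, Add 0 12 0, Add 0 s 0, Load 0 2] m' = ?m"
      using x reg sb src[OF j] by (simp add: fun_upd_def fun_eq_iff)
    have rk: "rk n f j < n" using j by (rule rk_less)
    have "wp (count_code s) (n * 14 + 2) (wp (Blk [Add 12 12 0, Add 0 12 0, Add 0 b 0, Store 14 0, Add 14 11 0, Store 12 0])
      6 (\<lambda>m'. m' 12 = real j \<and> Inv (Suc j) (m'(12 := real (Suc j))))) ?m"
    proof (rule wp_mono[OF count_code_wp[of ?m n s sb j f]])
      fix m2 :: mem
      assume m2: "(\<forall>a. a \<notin> {0, 3, 13, 14} \<longrightarrow> m2 a = ?m a) \<and> m2 14 = real (rk n f j)"
      have fr: "m2 a = m' a" if "a \<notin> {0, 2, 3, 12, 13, 14}" for a using m2 that by simp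
      have r2: "m2 12 = real j" "m2 14 = real (rk n f j)" "m2 b = real bb" "m2 11 = real ob"
        using m2 x reg sb by auto
      let ?m3 = "m2(0 := real (rk n f j) + real ob, bb + 3 * j := real (rk n f j), ob + rk n f j := real j)"
      have ev2: "fold eff [Add 12 12 0, Add 0 12 0, Add 0 b 0, Store 14 0, Add 14 11 0, Store 12 0] m2 = ?m3"
        using r2 sb by (simp add: fun_upd_def fun_eq_iff)
      have "Inv (Suc j) (?m3(12 := real (Suc j)))"
        unfolding Inv_def
      proof (intro conjI allI impI)
        fix a assume a: "a \<notin> {0, 2, 3, 12, 13, 14} \<and> (\<forall>i<n. a \<noteq> bb + 3 * i \<and> a \<noteq> ob + i)"
        thus "(?m3(12 := real (Suc j))) a = m a" using fr[of a] inv j rk unfolding Inv_def by auto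
      next
        fix i assume i: "i < Suc j"
        hence "i < n" using j by simp
        have ne: "bb + 3 * i \<noteq> ob + rk n f j" "bb + 3 * j \<noteq> ob + rk n f i"
          using disj[OF \<open>i < n\<close> rk] disj[OF j rk_less[OF \<open>i < n\<close>]] by auto
        have old: "m' (bb + 3 * i) = real (rk n f i)" "m' (ob + rk n f i) = real i" if "i \<noteq> j"
        proof -
          have "i < j" using i that by simp
          thus "m' (bb + 3 * i) = real (rk n f i)" "m' (ob + rk n f i) = real i"
            using inv unfolding Inv_def by blast+
        qed
        show "(?m3(12 := real (Suc j))) (bb + 3 * i) = real (rk n f i)"
          using fr[of "bb + 3 * i"] old(1) ne sb by (cases "i = j") auto
        show "(?m3(12 := real (Suc j))) (ob + rk n f i) = real i"
        proof (cases "i = j")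
          case False
          hence "rk n f i \<noteq> rk n f j" using rk_inj[of n f] \<open>i < n\<close> j by (auto dest: inj_onD)
          thus ?thesis using fr[of "ob + rk n f i"] old(2) False ne sb by auto
        qed (use sb in auto)
      qed
      moreover have "?m3 12 = real j" using r2 sb by auto
      ultimately show "wp (Blk [Add 12 12 0, Add 0 12 0, Add 0 b 0, Store 14 0, Add 14 11 0, Store 12 0])
        6 (\<lambda>m'. m' 12 = real j \<and> Inv (Suc j) (m'(12 := real (Suc j)))) m2"
        by (intro wp_Blk_le) (unfold ev2, auto)
    qed (use reg x sb src in auto)
    thus "wp (Seq (Blk [Const 14 0, Add 12 12 0, Add 0 12 0, Add 0 s 0, Load 0 2])
     (Seq (count_code s)
       (Blk [Add 12 12 0, Add 0 12 0, Add 0 b 0, Store 14 0, Add 14 11 0, Store 12 0])))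
       (5 + (n * 14 + 2 + 6)) (\<lambda>m'. m' 12 = real j \<and> Inv (Suc j) (m'(12 := real (Suc j)))) m'"
      by (intro wp_Seq wp_Blk_le wp_Seq) (unfold ev, auto)
  qed auto
  thus ?thesis by (rule wp_mono) (auto simp: Inv_def algebra_simps)
qed

text \<open>An atom \<open>(f, le, k)\<close> compares the current job with the job whose index is parameter \<open>k\<close> in the
  array with base register \<open>f\<close>.\<close>

definition holds :: "mem \<Rightarrow> nat \<times> bool \<times> nat \<Rightarrow> bool" where
  "holds m cmp \<longleftrightarrow> (case cmp of (f, le, k) \<Rightarrow>
     let u = m (addr (m f) + 3 * addr (m 12)); v = m (addr (m f) + 3 * addr (m (20 + k)))
     in if le then u \<le> v else v \<le> u)"

definition atom_ok :: "mem \<Rightarrow> nat \<times> bool \<times> nat \<Rightarrow> bool" where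
  "atom_ok m cmp \<longleftrightarrow> (case cmp of (f, le, k) \<Rightarrow>
     f \<in> {4..10} \<and> (\<exists>b y. m f = real b \<and> m (20 + k) = real y \<and> 20 \<le> b))"

fun box_code :: "(nat \<times> bool \<times> nat) list \<Rightarrow> int \<Rightarrow> com" where
  "box_code [] v = Blk [Const 15 v]"
| "box_code ((f, le, k) # as) v =
     Seq (Blk [Add 12 12 0, Add 0 12 0, Add 0 f 0, Load 0 2,
               Add (20 + k) (20 + k) 0, Add 0 (20 + k) 0, Add 0 f 0, Load 0 3])
         (if le then IfLe 2 3 (box_code as v) (Blk []) else IfLe 3 2 (box_code as v) (Blk []))"

text \<open>A failing atom leaves register 15 untouched, so consecutive box tests overwrite each
  other only on success. Each atom costs 8 instructions plus 2 for the test.\<close>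

lemma box_code_wp:
  assumes "\<forall>cmp \<in> set as. atom_ok m cmp"
    and "m 12 = real j"
  shows "wp (box_code as v) (10 * length as + 1) (\<lambda>m'. (\<forall>a. a \<notin> {0, 2, 3, 15} \<longrightarrow> m' a = m a) \<and>
    m' 15 = (if \<forall>cmp\<in>set as. holds m cmp then of_int v else m 15)) m"
  using assms
proof (induction "as" arbitrary: m)
  case Nil
  thus ?case by (auto intro!: wp_Blk_le)
next
  case (Cons cmp "as")
  obtain f le k where cmp: "cmp = (f, le, k)" by (cases cmp) auto
  obtain b y where f: "f \<in> {4..10}" "m f = real b" "m (20 + k) = real y" "20 \<le> b"
    using Cons.prems(1) cmp by (auto simp: atom_ok_def)
  define u where "u = m (b + 3 * j)"
  define w where "w = m (b + 3 * y)"
  let ?m = "m(0 := real y + real y + real y + real b, 2 := u, 3 := w)"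
  have ev: "fold eff [Add 12 12 0, Add 0 12 0, Add 0 f 0, Load 0 2,
      Add (20 + k) (20 + k) 0, Add 0 (20 + k) 0, Add 0 f 0, Load 0 3] m = ?m"
    using f Cons.prems(2) by (simp add: fun_upd_def fun_eq_iff u_def w_def)
  have holds_m: "holds m cmp \<longleftrightarrow> (if le then u \<le> w else w \<le> u)"
    using f Cons.prems(2) by (simp add: cmp holds_def u_def w_def)
  \<comment> \<open>By \<open>atom_ok\<close>, atoms read only registers 4 to 10 and 12, parameters
    and table cells from address 20 on, never the scratch registers 0, 2 and 3.\<close>
  have same: "holds ?m cmp' = holds m cmp'" if mem: "cmp' \<in> set as" for cmp'
  proof -
    obtain f' le' k' where cmp': "cmp' = (f', le', k')" by (cases cmp') auto
    obtain b' y' where "f' \<in> {4..10}" "m f' = real b'" "m (20 + k') = real y'" "20 \<le> b'"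
      using bspec[OF Cons.prems(1), of cmp', OF list.set_intros(2)[OF mem]] by (auto simp: atom_ok_def cmp')
    thus ?thesis using Cons.prems(2) by (simp add: cmp' holds_def)
  qed
  let ?Q = "\<lambda>m'. (\<forall>a. a \<notin> {0, 2, 3, 15} \<longrightarrow> m' a = m a) \<and>
    m' 15 = (if \<forall>cmp\<in>set (cmp # as). holds m cmp then of_int v else m 15)"
  have yes: "wp (box_code as v) (10 * length as + 1) ?Q ?m" if "holds m cmp"
  proof (rule wp_mono[OF Cons.IH])
    show "\<forall>cmp\<in>set as. atom_ok ?m cmp"
      using Cons.prems(1) by (force simp: atom_ok_def)
    fix m' :: mem
    have all_iff: "(\<forall>cmp\<in>set as. holds ?m cmp) \<longleftrightarrow> (\<forall>cmp\<in>set as. holds m cmp)"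
      using same by (intro ball_cong) auto
    assume "(\<forall>a. a \<notin> {0, 2, 3, 15} \<longrightarrow> m' a = ?m a) \<and>
      m' 15 = (if \<forall>cmp\<in>set as. holds ?m cmp then of_int v else ?m 15)"
    thus "?Q m'" unfolding all_iff using that by simp
  qed (use Cons.prems in auto)
  have no: "wp (Blk []) (10 * length as + 1) ?Q ?m" if "\<not> holds m cmp"
    using that by (intro wp_Blk_le) auto
  have "wp (if le then IfLe 2 3 (box_code as v) (Blk []) else IfLe 3 2 (box_code as v) (Blk []))
    (10 * length as + 1 + 2) ?Q ?m"
  proof (cases le)
    case True
    hence "?m 2 \<le> ?m 3 \<longleftrightarrow> holds m cmp" using holds_m by simp
    from wp_IfLe_iff[OF this yes no] show ?thesis unfolding if_P[OF True] .
  next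
    case False
    hence "?m 3 \<le> ?m 2 \<longleftrightarrow> holds m cmp" using holds_m by simp
    from wp_IfLe_iff[OF this yes no] show ?thesis unfolding if_not_P[OF False] .
  qed
  hence "wp (box_code (cmp # as) v) (8 + (10 * length as + 1 + 2)) ?Q m"
    unfolding cmp box_code.simps by (intro wp_Seq wp_Blk_le) (unfold ev cmp[symmetric], simp_all)
  thus ?case by simp
qed

section \<open>Listing all candidates\<close>

text \<open>Registers 5, 7 and 8 hold the bases of the arrays for \<open>p\<close>, \<open>q\<close>
  and release rank; the order follows \<open>in_box\<close>.\<close>

definition atoms :: "nat \<Rightarrow> (nat \<times> bool \<times> nat) list" where
  "atoms t = [(5, True, 5 * t), (7, False, 5 * t + 1), (7, True, 5 * t + 2),
     (8, False, 5 * t + 3), (8, True, 5 * t + 4)]"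

text \<open>Boxes are tested in increasing order and overwrite the result, which agrees with
  \<open>segment\<close>, where the largest index is decisive.\<close>

fun segment_code :: "nat \<Rightarrow> nat \<Rightarrow> com" where
  "segment_code A 0 = Blk [Const 15 0]"
| "segment_code A (Suc t) = Seq (segment_code A t) (box_code (atoms t) (int (t div A)))"

definition key_code :: "nat \<Rightarrow> nat \<Rightarrow> com" where
  "key_code A T = For 12 4 (Seq (segment_code A T)
     (Blk [Mul 15 4 15, Add 12 12 0, Add 0 12 0, Add 0 8 2, Load 2 2, Add 15 2 15, Add 0 9 0, Store 15 0]))"

text \<open>The loop counters in registers \<open>20 + d\<close> are themselves the box parameters.
  The nesting depth is fixed when the program is built; the innermost code writes one candidate and
  advances the output pointer by \<open>n\<close>.\<close>

fun nest_code :: "nat \<Rightarrow> nat \<Rightarrow> nat \<Rightarrow> com" where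
  "nest_code A T 0 = Seq (key_code A T) (Seq (rank_code 9 16) (Blk [Add 11 4 11]))"
| "nest_code A T (Suc d) = For (20 + d) 4 (nest_code A T d)"

fun nest_time :: "nat \<Rightarrow> nat \<Rightarrow> nat \<Rightarrow> nat" where
  "nest_time T n 0 = (n * (51 * T + 12) + 2) + ((n * (n * 14 + 16) + 2) + 1)"
| "nest_time T n (Suc d) = n * (nest_time T n d + 3) + 2"

text \<open>Memory map: input copy at \<open>Bs\<close>, release ranks at \<open>2 * Bs\<close>,
  keys at \<open>3 * Bs\<close>, key ranks at \<open>4 * Bs\<close>, all with stride 3, and output
  at \<open>Ob\<close>. The bounds keep the tables disjoint and clear of the registers.\<close>

locale layout =
  fixes n A T Bs Ob :: nat and p r q :: "nat \<Rightarrow> real"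
  assumes n: "0 < n" and Bs: "(5 * T + 24) * n \<le> Bs" and Ob: "5 * Bs \<le> Ob"
begin

definition stat :: "mem \<Rightarrow> bool" where
  "stat m \<longleftrightarrow> m 1 = 1 \<and> m 4 = real n \<and> m 5 = real Bs \<and> m 6 = real (Bs + 1) \<and> m 7 = real (Bs + 2) \<and>
     m 8 = real (2 * Bs) \<and> m 9 = real (3 * Bs) \<and> m 16 = real (4 * Bs) \<and> m 10 = real Ob \<and>
     (\<forall>j<n. m (Bs + 3 * j) = p j \<and> m (Bs + 1 + 3 * j) = r j \<and> m (Bs + 2 + 3 * j) = q j \<and>
        m (2 * Bs + 3 * j) = real (rk n r j))"

definition outs :: "mem \<Rightarrow> nat list \<Rightarrow> bool" where
  "outs m F \<longleftrightarrow> m 11 = real (Ob + length F) \<and> (\<forall>i<length F. m (Ob + i) = real (F ! i))"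

text \<open>Inside the nest of depth \<open>d\<close>, only the counters of the enclosing loops,
  those with index at least \<open>d\<close>, are fixed.\<close>

definition params :: "mem \<Rightarrow> nat \<Rightarrow> (nat \<Rightarrow> nat) \<Rightarrow> bool" where
  "params m d x \<longleftrightarrow> (\<forall>i. d \<le> i \<and> i < 5 * T \<longrightarrow> m (20 + i) = real (x i) \<and> x i < n)"

lemma Bs_ge: "5 * T + 24 \<le> Bs" "3 * n < Bs"
proof -
  have "(5 * T + 24) * 1 \<le> (5 * T + 24) * n" using n by (intro mult_left_mono) auto
  from le_trans[OF this Bs] show "5 * T + 24 \<le> Bs" by simp
  have "3 * n < (5 * T + 24) * n" using n by (simp add: algebra_simps)
  thus "3 * n < Bs" using Bs by linarith
qed

lemma stat_cong:
  assumes "stat m" "\<And>a. a \<in> {1, 4, 5, 6, 7, 8, 9, 10, 16} \<or> Bs \<le> a \<and> a < 3 * Bs \<Longrightarrow> m' a = m a"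
  shows "stat m'"
proof -
  have "Bs \<le> Bs + 3 * j \<and> Bs + 3 * j < 3 * Bs" "Bs \<le> Bs + 1 + 3 * j \<and> Bs + 1 + 3 * j < 3 * Bs"
    "Bs \<le> Bs + 2 + 3 * j \<and> Bs + 2 + 3 * j < 3 * Bs" "Bs \<le> 2 * Bs + 3 * j \<and> 2 * Bs + 3 * j < 3 * Bs"
    if "j < n" for j using that Bs_ge by auto
  thus ?thesis using assms unfolding stat_def by simp
qed

lemma outs_cong:
  assumes "outs m F" "\<And>a. a = 11 \<or> Ob \<le> a \<and> a < Ob + length F \<Longrightarrow> m' a = m a"
  shows "outs m' F"
  using assms unfolding outs_def by simp

lemma params_cong:
  assumes "params m d x" "\<And>a. 20 + d \<le> a \<Longrightarrow> a < 20 + 5 * T \<Longrightarrow> m' a = m a"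
  shows "params m' d x"
  using assms unfolding params_def by simp

lemma atoms_box:
  assumes "stat m" "m 12 = real j" "j < n" "params m 0 x" "t < T"
  shows "(\<forall>cmp\<in>set (atoms t). holds m cmp) \<longleftrightarrow> in_box p q (rk n r) x t j"
    and "\<forall>cmp\<in>set (atoms t). atom_ok m cmp"
proof -
  have x: "m (20 + (5 * t + i)) = real (x (5 * t + i))" "x (5 * t + i) < n" if "i < 5" for i
    using assms(4,5) that unfolding params_def by auto
  note x5 = x[of 0] x[of 1] x[of 2] x[of 3] x[of 4]
  have arr: "m 5 = real Bs" "m 7 = real (Bs + 2)" "m 8 = real (2 * Bs)"
    "\<And>j. j < n \<Longrightarrow> m (Bs + 3 * j) = p j" "\<And>j. j < n \<Longrightarrow> m (Bs + 2 + 3 * j) = q j"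
    "\<And>j. j < n \<Longrightarrow> m (2 * Bs + 3 * j) = real (rk n r j)"
    using assms(1) unfolding stat_def by auto
  have h: "holds m (f, le, 5 * t + i) \<longleftrightarrow>
      (if le then m (b + 3 * j) \<le> m (b + 3 * x (5 * t + i)) else m (b + 3 * x (5 * t + i)) \<le> m (b + 3 * j))"
    if "m f = real b" "i < 5" for f le i b
    unfolding holds_def prod.case Let_def that(1) x(1)[OF that(2)] assms(2) addr_real ..
  have h0: "holds m (5, True, 5 * t) \<longleftrightarrow> p j \<le> p (x (5 * t))"
    using h[OF arr(1), of 0 True] arr(4)[OF assms(3)] arr(4)[OF x(2)[of 0]] by simp
  have h1: "holds m (7, False, 5 * t + 1) \<longleftrightarrow> q (x (5 * t + 1)) \<le> q j"
    using h[OF arr(2), of 1 False] arr(5)[OF assms(3)] arr(5)[OF x(2)[of 1]] by simp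
  have h2: "holds m (7, True, 5 * t + 2) \<longleftrightarrow> q j \<le> q (x (5 * t + 2))"
    using h[OF arr(2), of 2 True] arr(5)[OF assms(3)] arr(5)[OF x(2)[of 2]] by simp
  have h3: "holds m (8, False, 5 * t + 3) \<longleftrightarrow> rk n r (x (5 * t + 3)) \<le> rk n r j"
    using h[OF arr(3), of 3 False] arr(6)[OF assms(3)] arr(6)[OF x(2)[of 3]] by simp
  have h4: "holds m (8, True, 5 * t + 4) \<longleftrightarrow> rk n r j \<le> rk n r (x (5 * t + 4))"
    using h[OF arr(3), of 4 True] arr(6)[OF assms(3)] arr(6)[OF x(2)[of 4]] by simp
  show "(\<forall>cmp\<in>set (atoms t). holds m cmp) \<longleftrightarrow> in_box p q (rk n r) x t j"
    unfolding atoms_def in_box_def list.set ball_simps h0 h1 h2 h3 h4 by simp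
  have "20 \<le> Bs" using Bs_ge by simp
  hence ok: "atom_ok m (f, le, 5 * t + i)" if "f \<in> {4..10}" "m f = real b" "Bs \<le> b" "i < 5" for f le i b
    using that x(1)[OF that(4)] unfolding atom_ok_def by fastforce
  have "atom_ok m (5, True, 5 * t + 0)" "atom_ok m (7, False, 5 * t + 1)" "atom_ok m (7, True, 5 * t + 2)"
    "atom_ok m (8, False, 5 * t + 3)" "atom_ok m (8, True, 5 * t + 4)"
    by (rule ok[OF _ arr(1)] ok[OF _ arr(2)] ok[OF _ arr(3)]; simp)+
  thus "\<forall>cmp\<in>set (atoms t). atom_ok m cmp"
    unfolding atoms_def list.set ball_simps by simp
qed

lemma segment_code_wp:
  assumes "stat m" "m 12 = real j" "j < n" "params m 0 x" "t \<le> T"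
  shows "wp (segment_code A t) (51 * t + 1) (\<lambda>m'. (\<forall>a. a \<notin> {0, 2, 3, 15} \<longrightarrow> m' a = m a) \<and>
    m' 15 = real (segment A p q (rk n r) x t j)) m"
  using assms(5)
proof (induction t)
  case 0
  show ?case by (auto intro!: wp_Blk_le)
next
  case (Suc t)
  let ?Q = "\<lambda>t m'. (\<forall>a. a \<notin> {0, 2, 3, 15} \<longrightarrow> m' a = m a) \<and>
    m' 15 = real (segment A p q (rk n r) x t j)"
  have "wp (segment_code A t) (51 * t + 1) (wp (box_code (atoms t) (int (t div A))) 51 (?Q (Suc t))) m"
  proof (rule wp_mono[OF Suc.IH])
    fix m' assume m': "?Q t m'"
    have fr: "m' a = m a" if "a \<notin> {0, 2, 3, 15}" for a using m' that by simp
    have st: "stat m'" by (rule stat_cong[OF assms(1)]) (use fr Bs_ge in auto)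
    have pa: "params m' 0 x" by (rule params_cong[OF assms(4)]) (use fr in auto)
    have 12: "m' 12 = real j" using fr[of 12] assms(2) by simp
    have t: "t < T" using Suc.prems by simp
    note box = atoms_box[OF st 12 assms(3) pa t]
    have "wp (box_code (atoms t) (int (t div A))) (10 * length (atoms t) + 1) (?Q (Suc t)) m'"
    proof (rule wp_mono[OF box_code_wp[OF box(2) 12]])
      fix m2 assume "(\<forall>a. a \<notin> {0, 2, 3, 15} \<longrightarrow> m2 a = m' a) \<and>
        m2 15 = (if \<forall>cmp\<in>set (atoms t). holds m' cmp then real_of_int (int (t div A)) else m' 15)"
      thus "?Q (Suc t) m2" using m' unfolding box(1) by simp
    qed auto
    thus "wp (box_code (atoms t) (int (t div A))) 51 (?Q (Suc t)) m'" by (simp add: atoms_def)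
  qed (use Suc.prems in auto)
  from wp_Seq[OF this] show ?case by (simp add: add.commute)
qed

definition key :: "(nat \<Rightarrow> nat) \<Rightarrow> nat \<Rightarrow> real" where
  "key x j = real (segment A p q (rk n r) x T j * n + rk n r j)"

lemma key_code_wp:
  assumes "stat m" "params m 0 x"
  shows "wp (key_code A T) (n * (51 * T + 12) + 2) (\<lambda>m'.
    (\<forall>a. a \<notin> {0, 2, 3, 12, 15} \<and> \<not> (3 * Bs \<le> a \<and> a < 4 * Bs) \<longrightarrow> m' a = m a) \<and>
    (\<forall>j<n. m' (3 * Bs + 3 * j) = key x j)) m"
proof -
  define Inv where "Inv k m' \<longleftrightarrow>
    (\<forall>a. a \<notin> {0, 2, 3, 12, 15} \<and> \<not> (3 * Bs \<le> a \<and> a < 4 * Bs) \<longrightarrow> m' a = m a) \<and>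
    (\<forall>j<k. m' (3 * Bs + 3 * j) = key x j)" for k and m' :: mem
  have inv_fr: "m' a = m a" if "Inv k m'" "a \<notin> {0, 2, 3, 12, 15}" "a < 3 * Bs" for k m' a
    using that unfolding Inv_def by auto
  have inv_stat: "stat m'" if "Inv k m'" for k m'
    by (rule stat_cong[OF assms(1)]) (use inv_fr[OF that] Bs_ge in auto)
  have "wp (key_code A T) (n * ((51 * T + 1 + 8) + 3) + 2) (Inv n) m"
    unfolding key_code_def
  proof (rule wp_For[where Inv=Inv])
    show "m' 4 = real n \<and> m' 1 = 1" if "Inv i m'" for i m'
      using inv_stat[OF that] unfolding stat_def by simp
    show "Inv 0 (m(12 := 0))" by (simp add: Inv_def)
  next
    fix j m' assume j: "j < n" and inv: "Inv j m'" and x: "m' 12 = real j"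
    have st: "stat m'" by (rule inv_stat[OF inv])
    have pa: "params m' 0 x" by (rule params_cong[OF assms(2)]) (use inv_fr[OF inv] Bs_ge in auto)
    show "wp (Seq (segment_code A T)
     (Blk [Mul 15 4 15, Add 12 12 0, Add 0 12 0, Add 0 8 2, Load 2 2, Add 15 2 15, Add 0 9 0, Store 15 0]))
     (51 * T + 1 + 8) (\<lambda>m'. m' 12 = real j \<and> Inv (Suc j) (m'(12 := real (Suc j)))) m'"
    proof (rule wp_Seq, rule wp_mono[OF segment_code_wp[OF st x j pa order_refl]])
      fix m2 :: mem
      assume m2: "(\<forall>a. a \<notin> {0, 2, 3, 15} \<longrightarrow> m2 a = m' a) \<and>
        m2 15 = real (segment A p q (rk n r) x T j)"
      have fr: "m2 a = m' a" if "a \<notin> {0, 2, 3, 15}" for a using m2 that by simp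
      have reg: "m2 4 = real n" "m2 8 = real (2 * Bs)" "m2 9 = real (3 * Bs)" "m2 12 = real j"
        "m2 (2 * Bs + 3 * j) = real (rk n r j)"
        using fr st x j Bs_ge unfolding stat_def by auto
      let ?m3 = "m2(0 := 3 * real j + real (3 * Bs), 2 := real (rk n r j), 15 := key x j, 3 * Bs + 3 * j := key x j)"
      have a8: "addr (3 * real j + 2 * real Bs) = 2 * Bs + 3 * j" using addr_triple[of j "2 * Bs"] by simp
      have a9: "addr (3 * real j + 3 * real Bs) = 3 * Bs + 3 * j" using addr_triple[of j "3 * Bs"] by simp
      have ev: "fold eff [Mul 15 4 15, Add 12 12 0, Add 0 12 0, Add 0 8 2, Load 2 2, Add 15 2 15, Add 0 9 0, Store 15 0] m2 = ?m3"
        using reg m2 Bs_ge by (simp add: fun_upd_def fun_eq_iff key_def a8 a9)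
      have lt: "3 * Bs + 3 * j < 4 * Bs" using j Bs_ge by simp
      have "Inv (Suc j) (?m3(12 := real (Suc j)))"
        unfolding Inv_def
      proof (intro conjI allI impI)
        fix a assume "a \<notin> {0, 2, 3, 12, 15} \<and> \<not> (3 * Bs \<le> a \<and> a < 4 * Bs)"
        thus "(?m3(12 := real (Suc j))) a = m a"
          using fr[of a] inv lt unfolding Inv_def by auto
      next
        fix i assume i: "i < Suc j"
        have "m' (3 * Bs + 3 * i) = key x i" if "i \<noteq> j" using inv i that unfolding Inv_def by simp
        thus "(?m3(12 := real (Suc j))) (3 * Bs + 3 * i) = key x i"
          using fr[of "3 * Bs + 3 * i"] Bs_ge by (cases "i = j") auto
      qed
      moreover have "?m3 12 = real j" using reg Bs_ge by simp
      ultimately show "wp (Blk [Mul 15 4 15, Add 12 12 0, Add 0 12 0, Add 0 8 2, Load 2 2, Add 15 2 15, Add 0 9 0, Store 15 0])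
        8 (\<lambda>m'. m' 12 = real j \<and> Inv (Suc j) (m'(12 := real (Suc j)))) m2"
        by (intro wp_Blk_le) (unfold ev, simp_all)
    qed simp
  qed auto
  thus ?thesis by (rule wp_mono) (auto simp: Inv_def)
qed

fun flat_candidates :: "nat \<Rightarrow> (nat \<Rightarrow> nat) \<Rightarrow> nat list" where
  "flat_candidates 0 x = candidate A T n p r q x"
| "flat_candidates (Suc d) x = concat (map (\<lambda>y. flat_candidates d (x(d := y))) [0..<n])"

lemma nest_code_wp:
  assumes "stat m" "outs m F" "params m d x" "d \<le> 5 * T"
  shows "wp (nest_code A T d) (nest_time T n d) (\<lambda>m'. stat m' \<and> outs m' (F @ flat_candidates d x) \<and>
    params m' d x) m"
  using assms
proof (induction d arbitrary: m F x)
  case 0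
  let ?L = "candidate A T n p r q x"
  have cand: "?L = ranked n (key x)" unfolding candidate_def key_def ..
  show ?case
    unfolding nest_code.simps nest_time.simps
  proof (rule wp_Seq, rule wp_mono[OF key_code_wp[OF 0(1,3)]])
    fix m1 :: mem
    assume m1: "(\<forall>a. a \<notin> {0, 2, 3, 12, 15} \<and> \<not> (3 * Bs \<le> a \<and> a < 4 * Bs) \<longrightarrow> m1 a = m a) \<and>
      (\<forall>j<n. m1 (3 * Bs + 3 * j) = key x j)"
    have fr1: "m1 a = m a" if "a \<notin> {0, 2, 3, 12, 15}" "a < 3 * Bs \<or> 4 * Bs \<le> a" for a
      using m1 that by auto
    have reg: "m1 1 = 1" "m1 4 = real n" "m1 9 = real (3 * Bs)" "m1 16 = real (4 * Bs)" "m1 11 = real (Ob + length F)"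
      using 0(1,2) fr1 Bs_ge unfolding stat_def outs_def by auto
    show "wp (Seq (rank_code 9 16) (Blk [Add 11 4 11])) (n * (n * 14 + 16) + 2 + 1) (\<lambda>m'. stat m' \<and>
      outs m' (F @ flat_candidates 0 x) \<and> params m' 0 x) m1"
    proof (rule wp_Seq, rule wp_mono[OF rank_code_wp[OF reg, of "key x"]])
      show "3 * Bs + 3 * i \<noteq> 4 * Bs + 3 * j \<and> 3 * Bs + 3 * i \<noteq> Ob + length F + j \<and>
        4 * Bs + 3 * i \<noteq> Ob + length F + j" if "i < n" "j < n" for i j
        using that Bs_ge Ob by linarith
    next
      fix m2 :: mem
      assume m2: "(\<forall>a. a \<notin> {0, 2, 3, 12, 13, 14} \<and> (\<forall>i<n. a \<noteq> 4 * Bs + 3 * i \<and> a \<noteq> Ob + length F + i) \<longrightarrow>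
           m2 a = m1 a) \<and>
        (\<forall>j<n. m2 (4 * Bs + 3 * j) = real (rk n (key x) j) \<and> m2 (Ob + length F + rk n (key x) j) = real j)"
      have fr2: "m2 a = m1 a" if "a \<notin> {0, 2, 3, 12, 13, 14}" "a < 4 * Bs \<or> 5 * Bs \<le> a \<and> a < Ob + length F" for a
      proof -
        have "\<forall>i<n. a \<noteq> 4 * Bs + 3 * i \<and> a \<noteq> Ob + length F + i" using that(2) Bs_ge Ob by auto
        thus ?thesis using m2 that(1) by blast
      qed
      let ?m3 = "m2(11 := real (Ob + length F + n))"
      have ev: "fold eff [Add 11 4 11] m2 = ?m3"
        using fr2[of 11] fr2[of 4] reg Bs_ge by simp
      have fr: "?m3 a = m a" if "a \<notin> {0, 2, 3, 11, 12, 13, 14, 15}" "a < 3 * Bs \<or> 5 * Bs \<le> a \<and> a < Ob + length F" for a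
        using fr2[of a] fr1[of a] that by auto
      have "stat ?m3" by (rule stat_cong[OF 0(1)]) (rule fr; use Bs_ge in auto)
      moreover have "params ?m3 0 x" by (rule params_cong[OF 0(3)]) (rule fr; use Bs_ge in auto)
      moreover have "outs ?m3 (F @ ?L)"
        unfolding outs_def
      proof (intro conjI allI impI)
        show "?m3 11 = real (Ob + length (F @ ?L))" by (simp add: cand)
        fix i assume i: "i < length (F @ ?L)"
        show "?m3 (Ob + i) = real ((F @ ?L) ! i)"
        proof (cases "i < length F")
          case True
          thus ?thesis using fr[of "Ob + i"] 0(2) Ob Bs_ge unfolding outs_def by (simp add: nth_append)
        next
          case False
          then obtain l where l: "i = length F + l" "l < n" using i by (auto simp: cand le_iff_add not_less)
          then obtain j where j: "j < n" "l = rk n (key x) j"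
            using rk_bij[of n "key x"] by (auto simp: bij_betw_def image_iff set_eq_iff)
          have "?m3 (Ob + i) = m2 (Ob + length F + rk n (key x) j)"
            using l j Ob Bs_ge by (simp add: add.assoc)
          also have "\<dots> = real j" using m2 j by blast
          also have "j = (F @ ?L) ! i" using l j ranked_nth[OF j(1), of "key x"] by (simp add: cand nth_append)
          finally show ?thesis .
        qed
      qed
      ultimately show "wp (Blk [Add 11 4 11]) 1 (\<lambda>m'. stat m' \<and>
        outs m' (F @ flat_candidates 0 x) \<and> params m' 0 x) m2"
        by (intro wp_Blk_le) (unfold ev flat_candidates.simps, simp_all)
    qed (use m1 Bs_ge Ob in auto)
  qed simp
next
  case (Suc d)
  let ?G = "\<lambda>i. concat (map (\<lambda>y. flat_candidates d (x(d := y))) [0..<i])"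
  define Inv where "Inv i m' \<longleftrightarrow> stat m' \<and> outs m' (F @ ?G i) \<and> params m' (Suc d) x" for i m'
  \<comment> \<open>The invariant ignores the loop's own counter, so it survives initialisation and
    increment.\<close>
  have upd: "Inv i (m'(20 + d := v))" if "Inv i m'" for i m' v
  proof -
    have "20 + d < Bs" using Suc.prems(4) Bs_ge by simp
    hence ne: "(m'(20 + d := v)) a = m' a" if "a < 20 \<or> Bs \<le> a \<or> 20 + Suc d \<le> a" for a using that by auto
    have "stat (m'(20 + d := v))" by (rule stat_cong[of m']) (use \<open>Inv i m'\<close> in \<open>simp add: Inv_def\<close>, rule ne, auto)
    moreover have "outs (m'(20 + d := v)) (F @ ?G i)"
      by (rule outs_cong[of m']) (use \<open>Inv i m'\<close> in \<open>simp add: Inv_def\<close>, rule ne, use Ob in auto)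
    moreover have "params (m'(20 + d := v)) (Suc d) x"
      by (rule params_cong[of m']) (use \<open>Inv i m'\<close> in \<open>simp add: Inv_def\<close>, rule ne, auto)
    ultimately show ?thesis by (simp add: Inv_def)
  qed
  show ?case
    unfolding nest_code.simps nest_time.simps
  proof (rule wp_For[where Inv=Inv])
    show "m' 4 = real n \<and> m' 1 = 1" if "Inv i m'" for i m'
      using that unfolding Inv_def stat_def by simp
    have "Inv 0 m" using Suc.prems by (simp add: Inv_def)
    thus "Inv 0 (m(20 + d := 0))" by (rule upd)
  next
    fix i m' assume i: "i < n" and inv: "Inv i m'" and x: "m' (20 + d) = real i"
    have pa: "params m' d (x(d := i))"
      using inv x i unfolding Inv_def params_def by (auto simp: Suc_le_eq)
    have "wp (nest_code A T d) (nest_time T n d) (\<lambda>m'. stat m' \<and>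
      outs m' ((F @ ?G i) @ flat_candidates d (x(d := i))) \<and> params m' d (x(d := i))) m'"
      by (rule Suc.IH[OF _ _ pa]) (use inv Suc.prems(4) in \<open>simp_all add: Inv_def\<close>)
    thus "wp (nest_code A T d) (nest_time T n d)
      (\<lambda>m'. m' (20 + d) = real i \<and> Inv (Suc i) (m'(20 + d := real (Suc i)))) m'"
    proof (rule wp_mono)
      fix m2 assume m2: "stat m2 \<and> outs m2 ((F @ ?G i) @ flat_candidates d (x(d := i))) \<and> params m2 d (x(d := i))"
      have "params m2 (Suc d) x" unfolding params_def
      proof (intro allI impI)
        fix k assume "Suc d \<le> k \<and> k < 5 * T"
        thus "m2 (20 + k) = real (x k) \<and> x k < n"
          using m2 unfolding params_def by (metis Suc_leD Suc_n_not_le_n fun_upd_other)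
      qed
      hence "Inv (Suc i) m2" using m2 by (simp add: Inv_def)
      moreover have "m2 (20 + d) = real i"
        using m2 Suc.prems(4) unfolding params_def by (metis Suc_le_eq fun_upd_same order_refl)
      ultimately show "m2 (20 + d) = real i \<and> Inv (Suc i) (m2(20 + d := real (Suc i)))" using upd by blast
    qed simp
  next
    show "stat m' \<and> outs m' (F @ flat_candidates (Suc d) x) \<and> params m' (Suc d) x" if "Inv n m'" for m'
      using that by (simp add: Inv_def)
  qed simp
qed

end

section \<open>The complete program\<close>

definition copy_code :: com where
  "copy_code = For 12 17 (Blk [Add 12 18 0, Load 0 2, Add 12 19 0, Store 2 0])"

lemma copy_code_wp:
  assumes m: "m 1 = 1" "m 17 = real N" "m 18 = real sb" "m 19 = real db"
    and db: "20 \<le> db" "20 \<le> sb" and disj: "sb + N \<le> db \<or> db + N \<le> sb"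
  shows "wp copy_code (N * 7 + 2) (\<lambda>m'.
    (\<forall>a. a \<notin> {0, 2, 12} \<and> \<not> (db \<le> a \<and> a < db + N) \<longrightarrow> m' a = m a) \<and>
    (\<forall>i<N. m' (db + i) = m (sb + i))) m"
proof -
  define Inv where "Inv k m' \<longleftrightarrow>
    (\<forall>a. a \<notin> {0, 2, 12} \<and> \<not> (db \<le> a \<and> a < db + N) \<longrightarrow> m' a = m a) \<and>
    (\<forall>i<k. m' (db + i) = m (sb + i))" for k and m' :: mem
  have "wp copy_code (N * (4 + 3) + 2) (Inv N) m"
    unfolding copy_code_def
  proof (rule wp_For[where Inv=Inv])
    show "m' 17 = real N \<and> m' 1 = 1" if "Inv i m'" for i m'
      using that m db unfolding Inv_def by simp
    show "Inv 0 (m(12 := 0))" by (simp add: Inv_def)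
  next
    fix i m' assume i: "i < N" and inv: "Inv i m'" and x: "m' 12 = real i"
    have fr: "m' a = m a" if "a \<notin> {0, 2, 12}" "\<not> (db \<le> a \<and> a < db + N)" for a
      using inv that unfolding Inv_def by blast
    have reg: "m' 18 = real sb" "m' 19 = real db" "m' (sb + i) = m (sb + i)"
      using fr m db disj i by auto
    let ?m = "m'(0 := real i + real db, 2 := m (sb + i), db + i := m (sb + i))"
    have ev: "fold eff [Add 12 18 0, Load 0 2, Add 12 19 0, Store 2 0] m' = ?m"
      using x reg db by (simp add: fun_upd_def fun_eq_iff)
    have "Inv (Suc i) (?m(12 := real (Suc i)))"
      unfolding Inv_def
    proof (intro conjI allI impI)
      fix a assume "a \<notin> {0, 2, 12} \<and> \<not> (db \<le> a \<and> a < db + N)"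
      thus "(?m(12 := real (Suc i))) a = m a" using fr[of a] i by auto
    next
      fix l assume l: "l < Suc i"
      have "m' (db + l) = m (sb + l)" if "l \<noteq> i" using inv l that unfolding Inv_def by simp
      thus "(?m(12 := real (Suc i))) (db + l) = m (sb + l)" using db by (cases "l = i") auto
    qed
    moreover have "?m 12 = real i" using x db by simp
    ultimately show "wp (Blk [Add 12 18 0, Load 0 2, Add 12 19 0, Store 2 0]) 4
      (\<lambda>m'. m' 12 = real i \<and> Inv (Suc i) (m'(12 := real (Suc i)))) m'"
      by (intro wp_Blk_le) (unfold ev, simp_all)
  qed auto
  thus ?thesis by (rule wp_mono) (auto simp: Inv_def)
qed

lemma funpow_double: "(eff (Add 0 0 0) ^^ t) m = m(0 := 2 ^ t * m 0)"
  by (induction t) (auto simp: fun_eq_iff)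

lemma funpow_mult: "k \<noteq> l \<Longrightarrow> (eff (Mul k l k) ^^ t) m = m(k := m k * m l ^ t)"
  by (induction t) (auto simp: fun_eq_iff)

text \<open>Unrolled, because no address is free for a loop counter: address 0 is the moving pointer
  and address 1 the constant 1. Address \<open>a\<close> goes to \<open>B + a - 1\<close>,
  continuing the input word already saved at \<open>B\<close>.\<close>

definition save_code :: "nat \<Rightarrow> instr list" where
  "save_code k = concat (map (\<lambda>k. [Add 0 1 0, Store k 0]) [2..<k])"

lemma fold_save:
  assumes "2 \<le> k" "m 0 = real B" "m 1 = 1" "k \<le> B"
  shows "fold eff (save_code k) m 0 = real (B + k - 2) \<and>
    (\<forall>a. 2 \<le> a \<and> a < k \<longrightarrow> fold eff (save_code k) m (B + a - 1) = m a) \<and>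
    (\<forall>a. a \<noteq> 0 \<and> \<not> (B + 1 \<le> a \<and> a < B + k - 1) \<longrightarrow> fold eff (save_code k) m a = m a)"
  using assms(1,4)
proof (induction k rule: dec_induct)
  case base
  thus ?case using assms by (simp add: save_code_def)
next
  case (step k)
  let ?m = "fold eff (save_code k) m"
  have IH: "?m 0 = real (B + k - 2)" "\<And>a. 2 \<le> a \<Longrightarrow> a < k \<Longrightarrow> ?m (B + a - 1) = m a"
    "\<And>a. a \<noteq> 0 \<Longrightarrow> \<not> (B + 1 \<le> a \<and> a < B + k - 1) \<Longrightarrow> ?m a = m a"
    using step.IH step.prems by auto
  have "?m 1 = 1" "?m k = m k" using IH(3)[of 1] IH(3)[of k] assms(3) step by auto
  moreover have "addr (real (B + k - 2) + 1) = B + k - 1"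
  proof -
    have "real (B + k - 2) + 1 = real (B + k - 1)" using step by simp
    thus ?thesis by (metis addr_real)
  qed
  moreover have "k \<noteq> 0" "B + k - 1 \<noteq> 0" using step by auto
  ultimately have ev: "fold eff (save_code (Suc k)) m = ?m(0 := real (B + k - 1), B + k - 1 := m k)"
    using step IH(1) by (simp add: save_code_def fun_eq_iff)
  show ?case unfolding ev
  proof (intro conjI allI impI)
    show "(?m(0 := real (B + k - 1), B + k - 1 := m k)) 0 = real (B + Suc k - 2)"
      using step by simp
  next
    fix a assume a: "2 \<le> a \<and> a < Suc k"
    show "(?m(0 := real (B + k - 1), B + k - 1 := m k)) (B + a - 1) = m a"
    proof (cases "a = k")
      case False
      hence "B + a - 1 \<noteq> B + k - 1" "B + a - 1 \<noteq> 0" using a step by auto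
      thus ?thesis using IH(2)[of a] a False by simp
    qed simp
  next
    fix a assume "a \<noteq> 0 \<and> \<not> (B + 1 \<le> a \<and> a < B + Suc k - 1)"
    thus "(?m(0 := real (B + k - 1), B + k - 1 := m k)) a = m a"
      using IH(3)[of a] step by auto
  qed
qed

text \<open>Inverse of \<open>save_code\<close> with the pointer running downwards, again using only
  addresses 0 and 1.\<close>

definition restore_code :: "nat \<Rightarrow> instr list" where
  "restore_code k = concat (map (\<lambda>k. [Load 0 k, Sub 0 1 0]) (rev [2..<k]))"

lemma fold_restore:
  assumes "2 \<le> k" "m 0 = real (B + k - 2)" "m 1 = 1" "k \<le> B"
  shows "fold eff (restore_code k) m 0 = real B \<and>
    (\<forall>a. 2 \<le> a \<and> a < k \<longrightarrow> fold eff (restore_code k) m a = m (B + a - 1)) \<and>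
    (\<forall>a. a \<noteq> 0 \<and> \<not> (2 \<le> a \<and> a < k) \<longrightarrow> fold eff (restore_code k) m a = m a)"
  using assms
proof (induction k arbitrary: m rule: dec_induct)
  case base
  thus ?case by (simp add: restore_code_def)
next
  case (step k)
  define m' where "m' = m(0 := real (B + k - 2), k := m (B + k - 1))"
  have m': "m' 0 = real (B + k - 2)" "m' 1 = 1" "m' k = m (B + k - 1)"
    "\<And>a. a \<noteq> 0 \<Longrightarrow> a \<noteq> k \<Longrightarrow> m' a = m a"
    using step.hyps step.prems(2) by (simp_all add: m'_def)
  have m0: "m 0 = real (B + k - 1)" using step.prems(1) by simp
  have "real (B + k - 1) - 1 = real (B + k - 2)" using step by simp
  moreover have "addr (m 0) = B + k - 1" unfolding m0 by simp
  ultimately have "fold eff [Load 0 k, Sub 0 1 0] m = m'"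
    using step.hyps step.prems(2) m0 by (simp add: m'_def fun_eq_iff del: of_nat_add of_nat_diff)
  hence ev: "fold eff (restore_code (Suc k)) m = fold eff (restore_code k) m'"
    using step by (simp add: restore_code_def)
  have IH: "fold eff (restore_code k) m' 0 = real B"
    "\<And>a. 2 \<le> a \<Longrightarrow> a < k \<Longrightarrow> fold eff (restore_code k) m' a = m' (B + a - 1)"
    "\<And>a. a \<noteq> 0 \<Longrightarrow> \<not> (2 \<le> a \<and> a < k) \<Longrightarrow> fold eff (restore_code k) m' a = m' a"
    using step.IH[OF m'(1,2)] step.prems(3) by auto
  show ?case unfolding ev
  proof (intro conjI allI impI)
    fix a assume a: "2 \<le> a \<and> a < Suc k"
    show "fold eff (restore_code k) m' a = m (B + a - 1)"
    proof (cases "a = k")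
      case True
      thus ?thesis using IH(3)[of k] m'(3) step.hyps by simp
    next
      case False
      moreover have "B + a - 1 \<noteq> k" using a step.prems(3) by linarith
      ultimately show ?thesis using IH(2)[of a] m'(4)[of "B + a - 1"] a by simp
    qed
  next
    fix a assume "a \<noteq> 0 \<and> \<not> (2 \<le> a \<and> a < Suc k)"
    thus "fold eff (restore_code k) m' a = m a" using IH(3)[of a] m'(4)[of a] step.hyps by auto
  qed (rule IH(1))
qed

text \<open>All addresses named in the program may hold input. Doubling \<open>n\<close> in address 0 loses nothing and
  yields a pointer beyond the input, where the contents of the low addresses are saved. Conversely,
  at the very end only address 0, with the start \<open>Ob\<close> of the candidates, can be used, so the number
  of candidates is kept at address \<open>2 * Ob\<close>.\<close>

definition prologue1 :: "nat \<Rightarrow> instr list" where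
  "prologue1 T = replicate (5 * T + 24) (Add 0 0 0) @ [Store 1 0, Const 1 0]"

definition prologue2 :: "nat \<Rightarrow> instr list" where
  "prologue2 T = Const 1 1 # save_code (5 * T + 21)"

text \<open>Saving leaves \<open>B + 5 * T + 19\<close> in address 0, which gives back
  \<open>B\<close>, and division by the power of two gives back \<open>n\<close>. Adding register 2
  while it is 0 copies. The products put \<open>B ^ (5 * T + 3)\<close> into register 10, far enough
  out for the whole output to be moved down without overlap.\<close>

definition prologue3 :: "nat \<Rightarrow> instr list" where
  "prologue3 T = [Const 2 (int (5 * T + 19)), Sub 0 2 5, Const 2 (2 ^ (5 * T + 24)), Dv 5 2 4,
     Add 5 1 6, Add 6 1 7, Add 5 5 8, Add 8 5 9, Add 9 5 16, Add 4 4 17, Add 17 4 17,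
     Const 18 (int (5 * T + 21)), Const 2 (int (5 * T + 20)), Add 5 2 19, Const 2 0, Add 5 2 10] @
     replicate (5 * T + 2) (Mul 10 5 10) @ [Add 10 2 11]"

definition epilogue1 :: "nat \<Rightarrow> instr list" where
  "epilogue1 T = [Sub 11 10 17, Dv 17 4 3, Add 10 10 0, Store 3 0,
     Const 2 (int (5 * T + 20)), Add 10 2 18, Const 19 (int (5 * T + 21))]"

text \<open>The first output entries belong in the registers themselves, so they are restored last:
  addresses 2 and up, then address 1, finally the count from \<open>2 * Ob\<close> into address
  0.\<close>

definition epilogue2 :: "nat \<Rightarrow> instr list" where
  "epilogue2 T = [Const 2 (int (5 * T + 19)), Add 10 2 0] @ restore_code (5 * T + 21) @
     [Load 0 1, Add 0 0 0, Load 0 0]"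

definition main_code :: "nat \<Rightarrow> nat \<Rightarrow> com" where
  "main_code A T = Seq (Blk (prologue2 T)) (Seq (Blk (prologue3 T)) (Seq copy_code (Seq (rank_code 6 8)
     (Seq (nest_code A T (5 * T)) (Seq (Blk (epilogue1 T)) (Seq copy_code (Blk (epilogue2 T))))))))"

text \<open>After the first prologue address 0 holds a multiple of \<open>n\<close> and address 1
  holds 0, so the test detects \<open>n = 0\<close>. Then the output is the empty sequence, counted
  once.\<close>

definition program :: "nat \<Rightarrow> nat \<Rightarrow> com" where
  "program A T = Seq (Blk (prologue1 T)) (IfLe 0 1 (Blk [Const 0 1]) (main_code A T))"

definition main_time :: "nat \<Rightarrow> nat \<Rightarrow> nat" where
  "main_time T n = length (prologue2 T) + (length (prologue3 T) + ((3 * n * 7 + 2) + ((n * (n * 14 + 16) + 2) +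
     (nest_time T n (5 * T) + (length (epilogue1 T) + ((n ^ (5 * T) * n * 7 + 2) + length (epilogue2 T)))))))"

definition program_time :: "nat \<Rightarrow> nat \<Rightarrow> nat" where
  "program_time T n = length (prologue1 T) + (main_time T n + 2)"

section \<open>The list of candidates and the output format\<close>

context layout
begin

fun candidates :: "nat \<Rightarrow> (nat \<Rightarrow> nat) \<Rightarrow> nat list list" where
  "candidates 0 x = [candidate A T n p r q x]"
| "candidates (Suc d) x = concat (map (\<lambda>y. candidates d (x(d := y))) [0..<n])"

lemma flat_candidates_eq: "flat_candidates d x = concat (candidates d x)"
proof (induction d arbitrary: x)
  case (Suc d)
  have flat: "concat (concat (map f ys)) = concat (map (\<lambda>y. concat (f y)) ys)" for f :: "nat \<Rightarrow> nat list list" and ys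
    by (induction ys) auto
  show ?case unfolding flat_candidates.simps candidates.simps Suc by (rule flat[symmetric])
qed simp

lemma length_candidates: "length (candidates d x) = n ^ d"
proof (induction d arbitrary: x)
  case (Suc d)
  thus ?case by (simp add: length_concat o_def sum_list_triv)
qed simp

lemma is_seq_candidates: "\<sigma> \<in> set (candidates d x) \<Longrightarrow> is_seq n \<sigma>"
  by (induction d arbitrary: x) (auto simp: candidate_def is_seq_ranked)

lemma in_candidates:
  "(\<And>i. i < d \<Longrightarrow> w i < n) \<Longrightarrow> (\<And>i. d \<le> i \<Longrightarrow> w i = x i) \<Longrightarrow> candidate A T n p r q w \<in> set (candidates d x)"
proof (induction d arbitrary: x)
  case 0
  hence "w = x" by auto
  thus ?case by simp
next
  case (Suc d)
  have "candidate A T n p r q w \<in> set (candidates d (x(d := w d)))"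
    using Suc.prems by (intro Suc.IH) auto
  thus ?case using Suc.prems(1)[of d] by auto
qed

end

lemma concat_uniform_nth:
  assumes "\<And>xs. xs \<in> set L \<Longrightarrow> length xs = n" "k < length L" "i < n"
  shows "k * n + i < length (concat L) \<and> concat L ! (k * n + i) = L ! k ! i"
  using assms
proof (induction L arbitrary: k)
  case (Cons ys L)
  have ys: "length ys = n" using Cons.prems by auto
  show ?case
  proof (cases k)
    case 0
    thus ?thesis using ys Cons.prems by (simp add: nth_append)
  next
    case (Suc k')
    have "k' * n + i < length (concat L) \<and> concat L ! (k' * n + i) = L ! k' ! i"
      using Cons.prems Suc by (intro Cons.IH) auto
    thus ?thesis using ys Suc by (simp add: nth_append)
  qed
qed simp

definition good_output :: "nat \<Rightarrow> mem \<Rightarrow> nat list list \<Rightarrow> bool" where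
  "good_output n m L \<longleftrightarrow> m 0 = real (length L) \<and> (\<forall>i<length (concat L). m (1 + i) = real (concat L ! i))"

lemma good_output_valid:
  assumes g: "good_output n m L" and L: "\<And>\<sigma>. \<sigma> \<in> set L \<Longrightarrow> is_seq n \<sigma>"
  shows "valid_output n m" "output_set n m = set L"
proof -
  have len: "length xs = n" if "xs \<in> set L" for xs using is_seq_length L that by blast
  have cnt: "out_count m = length L" using g by (simp add: good_output_def out_count_def)
  have cell: "m (1 + k * n + i) = real (L ! k ! i)" if "k < length L" "i < n" for k i
    using concat_uniform_nth[OF len that] g by (simp add: good_output_def)
  have seq: "out_seq n m k = L ! k" if "k < length L" for k
  proof (rule nth_equalityI)
    show "length (out_seq n m k) = length (L ! k)" using len[of "L ! k"] that by (simp add: out_seq_def)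
    show "out_seq n m k ! i = L ! k ! i" if "i < length (out_seq n m k)" for i
      using cell[OF \<open>k < length L\<close>, of i] that by (simp add: out_seq_def)
  qed
  show "valid_output n m"
    using cell seq L g cnt by (auto simp: valid_output_def good_output_def)
  show "output_set n m = set L"
    using seq cnt by (auto simp: output_set_def set_conv_nth image_iff)
qed

lemma main_code_wp:
  assumes n: "0 < n" and m0: "m0 = snd (init n p r q)" and B: "B = 2 ^ (5 * T + 24) * n"
    and m: "m = m0(0 := real B, B := m0 1, 1 := 0)"
  shows "wp (main_code A T) (main_time T n) (\<lambda>m'. good_output n m' (layout.candidates n A T p r q (5 * T) (\<lambda>_. 0))) m"
proof -
  define R where "R = 5 * T + 20"
  define N where "N = 5 * T"
  define Ob where "Ob = B ^ (N + 3)"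
  have SR: "5 * T + 21 = Suc R" by (simp add: R_def)
  have "5 * T + 24 \<le> 2 ^ (5 * T + 24)" by (rule less_imp_le) (rule less_exp)
  hence B1: "(5 * T + 24) * n \<le> B" unfolding B by (rule mult_right_mono) simp
  have "(5 * T + 24) * 1 \<le> (5 * T + 24) * n" using n by (intro mult_left_mono) auto
  from le_trans[OF this B1] have B2: "5 * T + 24 \<le> B" by simp
  hence RB: "R + 4 \<le> B" and R20: "20 \<le> R" by (simp_all add: R_def)
  have "(5 * T + 24) * n = R * n + 4 * n" by (simp add: R_def algebra_simps)
  moreover have "R * 1 \<le> R * n" using n by (intro mult_left_mono) auto
  ultimately have B3: "3 * n + R < B" using B1 n by linarith
  have nB: "n \<le> B" using B3 by simp
  have pow: "B ^ (N + 3) = B * B * B ^ (N + 1)" by (simp add: power_add numeral_3_eq_3)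
  have Ble: "B \<le> B ^ (N + 1)" using RB by (simp add: Suc_le_eq)
  have Ob5: "5 * B \<le> Ob"
  proof -
    have "5 * B \<le> B * B" using RB by (intro mult_right_mono) (auto simp: R_def)
    also have "\<dots> \<le> B * B * B ^ (N + 1)" using RB by simp
    finally show ?thesis by (simp add: Ob_def pow)
  qed
  \<comment> \<open>The output, even shifted by the \<open>R\<close> registers, ends before
    \<open>2 * Ob\<close> and does not reach \<open>Ob\<close> when moved down.\<close>
  have len_le: "n ^ N * n + R + 1 \<le> Ob"
  proof -
    have "n ^ N * n \<le> B ^ (N + 1)" using power_mono[OF nB, of "N + 1"] by (simp add: mult.commute)
    moreover have "R + 1 \<le> B ^ (N + 1)" using RB Ble by linarith
    ultimately have "n ^ N * n + R + 1 \<le> 2 * B ^ (N + 1)" by linarith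
    also have "\<dots> \<le> (B * B) * B ^ (N + 1)"
    proof (rule mult_right_mono)
      have "2 * 1 \<le> B * B" using RB by (intro mult_mono) auto
      thus "2 \<le> B * B" by simp
    qed simp
    finally show ?thesis by (simp add: Ob_def pow)
  qed
  interpret layout n A T B Ob p r q
    by unfold_locales (use n B1 Ob5 in auto)
  have input: "m0 (1 + 3 * j) = p j" "m0 (2 + 3 * j) = r j" "m0 (3 + 3 * j) = q j" if "j < n" for j
  proof -
    have "Suc (3 * j) div 3 = j" "Suc (3 * j) mod 3 = 1" "Suc (Suc (3 * j)) div 3 = j" "Suc (Suc (3 * j)) mod 3 = 2"
      by presburger+
    thus "m0 (1 + 3 * j) = p j" "m0 (2 + 3 * j) = r j" "m0 (3 + 3 * j) = q j"
      using that unfolding m0 init_def by (auto simp: Let_def)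
  qed
  define m1 where "m1 = fold eff (prologue2 T) m"
  have m1_0: "m1 0 = real (B + R - 1)" and m1_save: "\<And>a. 1 \<le> a \<Longrightarrow> a \<le> R \<Longrightarrow> m1 (B + a - 1) = m0 a"
    and m1_1: "m1 1 = 1" and m1_other: "\<And>a. 2 \<le> a \<Longrightarrow> a < B \<Longrightarrow> m1 a = m0 a"
  proof -
    have eq: "m1 = fold eff (save_code (Suc R)) (m(1 := 1))" by (simp add: m1_def prologue2_def SR)
    have mB: "m 0 = real B" "m B = m0 1" using m RB by auto
    note s = fold_save[of "Suc R" "m(1 := 1)" B, folded eq]
    have s': "m1 0 = real (B + Suc R - 2)" "\<And>a. 2 \<le> a \<Longrightarrow> a < Suc R \<Longrightarrow> m1 (B + a - 1) = (m(1 := 1)) a"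
      "\<And>a. a \<noteq> 0 \<Longrightarrow> \<not> (B + 1 \<le> a \<and> a < B + Suc R - 1) \<Longrightarrow> m1 a = (m(1 := 1)) a"
      using s mB RB by (simp_all add: R_def)
    show "m1 0 = real (B + R - 1)" using s'(1) by simp
    show "m1 1 = 1" using s'(3)[of 1] RB by simp
    show "m1 (B + a - 1) = m0 a" if "1 \<le> a" "a \<le> R" for a
    proof (cases "a = 1")
      case True
      thus ?thesis using s'(3)[of B] mB RB by simp
    next
      case False
      thus ?thesis using s'(2)[of a] that m RB by simp
    qed
    show "m1 a = m0 a" if "2 \<le> a" "a < B" for a using s'(3)[of a] that m by simp
  qed
  define m2 where "m2 = fold eff (prologue3 T) m1"
  have m2: "m2 1 = 1" "m2 4 = real n" "m2 5 = real B" "m2 6 = real (B + 1)" "m2 7 = real (B + 2)"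
    "m2 8 = real (2 * B)" "m2 9 = real (3 * B)" "m2 16 = real (4 * B)" "m2 17 = real (3 * n)"
    "m2 18 = real (R + 1)" "m2 19 = real (B + R)" "m2 10 = real Ob" "m2 11 = real Ob"
    and m2_other: "\<And>a. 20 \<le> a \<Longrightarrow> m2 a = m1 a"
  proof -
    have a: "m1 0 - real (5 * T + 19) = real B" unfolding m1_0 using RB by (simp add: R_def of_nat_diff)
    have b: "real B / 2 ^ (5 * T + 24) = real n" by (simp add: B)
    obtain l where l: "5 * T + 2 = l" by simp
    have c: "real B * real B ^ l = real Ob"
      by (simp add: l[symmetric] Ob_def N_def numeral_3_eq_3)
    show "m2 1 = 1" "m2 4 = real n" "m2 5 = real B" "m2 6 = real (B + 1)" "m2 7 = real (B + 2)"
      "m2 8 = real (2 * B)" "m2 9 = real (3 * B)" "m2 16 = real (4 * B)" "m2 17 = real (3 * n)"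
      "m2 18 = real (R + 1)" "m2 19 = real (B + R)" "m2 10 = real Ob" "m2 11 = real Ob"
      "\<And>a. 20 \<le> a \<Longrightarrow> m2 a = m1 a"
      unfolding m2_def prologue3_def l using a b c m1_1
      by (simp_all add: funpow_mult R_def)
  qed
  define Q where "Q m' \<longleftrightarrow> good_output n m' (candidates N (\<lambda>_. 0))" for m'
  have "wp (Seq copy_code (Seq (rank_code 6 8)
     (Seq (nest_code A T N) (Seq (Blk (epilogue1 T)) (Seq copy_code (Blk (epilogue2 T)))))))
     ((3 * n * 7 + 2) + ((n * (n * 14 + 16) + 2) +
     (nest_time T n N + (length (epilogue1 T) + ((n ^ N * n * 7 + 2) + length (epilogue2 T)))))) Q m2"
  proof (rule wp_Seq, rule wp_mono[OF copy_code_wp[OF m2(1) m2(9-11)]])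
    show "20 \<le> B + R" "20 \<le> R + 1" "R + 1 + 3 * n \<le> B + R \<or> B + R + 3 * n \<le> R + 1"
      using B3 by (auto simp: R_def)
  next
    fix m3 :: mem
    assume "(\<forall>a. a \<notin> {0, 2, 12} \<and> \<not> (B + R \<le> a \<and> a < B + R + 3 * n) \<longrightarrow> m3 a = m2 a) \<and>
      (\<forall>i<3 * n. m3 (B + R + i) = m2 (R + 1 + i))"
    hence m3_other: "\<And>a. a \<notin> {0, 2, 12} \<Longrightarrow> a < B + R \<Longrightarrow> m3 a = m2 a"
      and m3_copy: "\<And>i. i < 3 * n \<Longrightarrow> m3 (B + R + i) = m2 (R + 1 + i)" by auto
    \<comment> \<open>The saved low addresses and the copied remainder join into one contiguous
      input copy at \<open>B\<close>.\<close>
    have m3_in: "m3 (B + i) = m0 (1 + i)" if "i < 3 * n" for i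
    proof (cases "i < R")
      case True
      thus ?thesis using m3_other[of "B + i"] m2_other[of "B + i"] m1_save[of "Suc i"] RB by (simp add: R_def)
    next
      case False
      then obtain l where l: "i = R + l" by (auto simp: le_iff_add not_less)
      thus ?thesis using m3_copy[of l] m2_other[of "R + 1 + l"] m1_other[of "R + 1 + l"] that B3
        by (simp add: R_def add.assoc)
    qed
    have reg3: "m3 a = m2 a" if "a \<in> {1, 4, 5, 6, 7, 8, 9, 10, 11, 16}" for a
      by (rule m3_other) (use that RB R20 in auto)
    have arr3: "m3 (B + 3 * j) = p j" "m3 (B + 1 + 3 * j) = r j" "m3 (B + 2 + 3 * j) = q j" if "j < n" for j
      using m3_in[of "3 * j"] m3_in[of "1 + 3 * j"] m3_in[of "2 + 3 * j"] input[OF that] that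
      by (simp_all add: add.assoc numeral_3_eq_3)
    show "wp (Seq (rank_code 6 8) (Seq (nest_code A T N) (Seq (Blk (epilogue1 T)) (Seq copy_code (Blk (epilogue2 T))))))
     ((n * (n * 14 + 16) + 2) +
     (nest_time T n N + (length (epilogue1 T) + ((n ^ N * n * 7 + 2) + length (epilogue2 T))))) Q m3"
    proof (rule wp_Seq, rule wp_mono[OF rank_code_wp[of m3 n 6 "B + 1" 8 "2 * B" Ob r]])
      show "m3 1 = 1" "m3 4 = real n" "m3 6 = real (B + 1)" "m3 8 = real (2 * B)" "m3 11 = real Ob"
        using reg3 m2 by simp_all
      show "B + 1 + 3 * i \<noteq> 2 * B + 3 * j \<and> B + 1 + 3 * i \<noteq> Ob + j \<and> 2 * B + 3 * i \<noteq> Ob + j"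
        if "i < n" "j < n" for i j using that B3 Ob5 by linarith
      show "20 \<le> B + 1" "20 \<le> 2 * B" "20 \<le> Ob" using RB Ob5 by (auto simp: R_def)
      show "m3 (B + 1 + 3 * i) = r i" if "i < n" for i by (rule arr3(2)[OF that])
    next
      fix m4 :: mem
      assume m4: "(\<forall>a. a \<notin> {0, 2, 3, 12, 13, 14} \<and> (\<forall>i<n. a \<noteq> 2 * B + 3 * i \<and> a \<noteq> Ob + i) \<longrightarrow> m4 a = m3 a) \<and>
        (\<forall>j<n. m4 (2 * B + 3 * j) = real (rk n r j) \<and> m4 (Ob + rk n r j) = real j)"
      have fr4: "m4 a = m3 a" if "a \<notin> {0, 2, 3, 12, 13, 14}" "a < 2 * B" for a
      proof -
        have "\<forall>i<n. a \<noteq> 2 * B + 3 * i \<and> a \<noteq> Ob + i" using that(2) Ob5 by auto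
        thus ?thesis using m4 that(1) by blast
      qed
      have reg4: "m4 a = m2 a" if "a \<in> {1, 4, 5, 6, 7, 8, 9, 10, 11, 16}" for a
        using fr4[of a] reg3[OF that] that RB R20 by auto
      have "stat m4"
        unfolding stat_def
      proof (intro conjI allI impI)
        fix j assume j: "j < n"
        show "m4 (B + 3 * j) = p j" "m4 (B + 1 + 3 * j) = r j" "m4 (B + 2 + 3 * j) = q j"
          using arr3[OF j] fr4[of "B + 3 * j"] fr4[of "B + 1 + 3 * j"] fr4[of "B + 2 + 3 * j"] j B3 RB R20 by auto
        show "m4 (2 * B + 3 * j) = real (rk n r j)" using m4 j by blast
      qed (use reg4 m2 in auto)
      moreover have "outs m4 []" using reg4[of 11] m2 by (simp add: outs_def)
      moreover have "params m4 N (\<lambda>_. 0)" by (simp add: params_def N_def)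
      moreover have "N \<le> 5 * T" by (simp add: N_def)
      ultimately have nest: "wp (nest_code A T N) (nest_time T n N)
        (\<lambda>m'. stat m' \<and> outs m' ([] @ flat_candidates N (\<lambda>_. 0)) \<and> params m' N (\<lambda>_. 0)) m4"
        by (rule nest_code_wp)
      show "wp (Seq (nest_code A T N) (Seq (Blk (epilogue1 T)) (Seq copy_code (Blk (epilogue2 T)))))
        (nest_time T n N + (length (epilogue1 T) + ((n ^ N * n * 7 + 2) + length (epilogue2 T)))) Q m4"
      proof (rule wp_Seq, rule wp_mono[OF nest])
        fix m5 :: mem
        define F where "F = concat (candidates N (\<lambda>_. 0))"
        assume m5: "stat m5 \<and> outs m5 ([] @ flat_candidates N (\<lambda>_. 0)) \<and> params m5 N (\<lambda>_. 0)"
        have "length xs = n" if "xs \<in> set (candidates N (\<lambda>_. 0))" for xs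
          using is_seq_candidates[OF that] by (rule is_seq_length)
        hence "map length (candidates N (\<lambda>_. 0)) = map (\<lambda>_. n) (candidates N (\<lambda>_. 0))" by simp
        hence lenF: "length F = n ^ N * n"
          unfolding F_def length_concat by (simp only: sum_list_triv length_candidates of_nat_id)
        have reg5: "m5 1 = 1" "m5 4 = real n" "m5 10 = real Ob" "m5 11 = real (Ob + length F)"
          and m5_F: "\<And>i. i < length F \<Longrightarrow> m5 (Ob + i) = real (F ! i)"
          using m5 unfolding stat_def outs_def flat_candidates_eq F_def by auto
        define m6 where "m6 = fold eff (epilogue1 T) m5"
        have m6: "m6 1 = 1" "m6 10 = real Ob" "m6 17 = real (length F)" "m6 18 = real (Ob + R)" "m6 19 = real (R + 1)"
          "m6 (2 * Ob) = real (n ^ N)" and m6_other: "\<And>a. 20 \<le> a \<Longrightarrow> a \<noteq> 2 * Ob \<Longrightarrow> m6 a = m5 a"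
        proof -
          have a: "addr (2 * real Ob) = 2 * Ob" using addr_real[of "2 * Ob"] by simp
          have b: "real (length F) / real n = real (n ^ N)" using n by (simp add: lenF)
          have c: "20 \<le> Ob" using Ob5 RB by (simp add: R_def)
          show "m6 1 = 1" "m6 10 = real Ob" "m6 17 = real (length F)" "m6 18 = real (Ob + R)" "m6 19 = real (R + 1)"
            "m6 (2 * Ob) = real (n ^ N)" "\<And>a. 20 \<le> a \<Longrightarrow> a \<noteq> 2 * Ob \<Longrightarrow> m6 a = m5 a"
            unfolding m6_def epilogue1_def using reg5 a b c by (simp_all add: R_def)
        qed
        show "wp (Seq (Blk (epilogue1 T)) (Seq copy_code (Blk (epilogue2 T))))
          (length (epilogue1 T) + ((n ^ N * n * 7 + 2) + length (epilogue2 T))) Q m5"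
        proof (rule wp_Seq, rule wp_Blk, goal_cases)
          case 1
          show ?case by (auto simp: epilogue1_def)
        next
          case 2
          show ?case unfolding m6_def[symmetric]
          proof (rule wp_Seq, rule wp_mono[OF copy_code_wp[OF m6(1) m6(3-5)]])
            show "20 \<le> R + 1" "20 \<le> Ob + R" by (auto simp: R_def)
            show "Ob + R + length F \<le> R + 1 \<or> R + 1 + length F \<le> Ob + R" using len_le lenF by auto
            show "length F * 7 + 2 \<le> n ^ N * n * 7 + 2" by (simp add: lenF)
          next
            fix m7 :: mem
            assume "(\<forall>a. a \<notin> {0, 2, 12} \<and> \<not> (R + 1 \<le> a \<and> a < R + 1 + length F) \<longrightarrow> m7 a = m6 a) \<and>
              (\<forall>i<length F. m7 (R + 1 + i) = m6 (Ob + R + i))"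
            hence m7_other: "\<And>a. a \<notin> {0, 2, 12} \<Longrightarrow> a < R + 1 \<or> Ob \<le> a \<Longrightarrow> m7 a = m6 a"
              and m7_copy: "\<And>i. i < length F \<Longrightarrow> m7 (R + 1 + i) = m6 (Ob + R + i)"
              using len_le lenF by auto
            have Ob20: "20 \<le> Ob" using Ob5 RB by (simp add: R_def)
            have reg7: "m7 1 = 1" "m7 10 = real Ob" "m7 (2 * Ob) = real (n ^ N)"
              using m7_other[of 1] m7_other[of 10] m7_other[of "2 * Ob"] m6 Ob20 by (auto simp: R_def)
            define m8 where "m8 = m7(2 := real (5 * T + 19), 0 := real (Ob + Suc R - 2))"
            define m9 where "m9 = fold eff (restore_code (Suc R)) m8"
            have s: "m9 0 = real Ob" "\<And>a. 2 \<le> a \<Longrightarrow> a < Suc R \<Longrightarrow> m9 a = m8 (Ob + a - 1)"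
              "\<And>a. a \<noteq> 0 \<Longrightarrow> \<not> (2 \<le> a \<and> a < Suc R) \<Longrightarrow> m9 a = m8 a"
              using fold_restore[of "Suc R" m8 Ob] reg7 Ob5 RB
              unfolding m9_def[symmetric] by (simp_all add: m8_def R_def)
            have "real Ob + real (5 * T + 19) = real (Ob + Suc R - 2)" by (simp add: R_def)
            hence "fold eff (epilogue2 T) m7 = fold eff [Load 0 1, Add 0 0 0, Load 0 0] m9"
              unfolding epilogue2_def m9_def m8_def SR using reg7 by simp
            also have "\<dots> = m9(1 := m9 Ob, 0 := m9 (2 * Ob))"
            proof -
              have "addr (2 * real Ob) = 2 * Ob" using addr_real[of "2 * Ob"] by simp
              thus ?thesis using s(1) Ob20 by (simp add: fun_eq_iff)
            qed
            finally have ev: "fold eff (epilogue2 T) m7 = m9(1 := m9 Ob, 0 := m9 (2 * Ob))" .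
            have hi: "m9 a = m7 a" if "Ob \<le> a" for a
              using s(3)[of a] that Ob5 RB by (simp add: m8_def R_def)
            have src: "m7 (Ob + i) = real (F ! i)" if "i < length F" for i
              using m7_other[of "Ob + i"] m6_other[of "Ob + i"] m5_F[OF that] that Ob20 len_le lenF by auto
            have "good_output n (m9(1 := m9 Ob, 0 := m9 (2 * Ob))) (candidates N (\<lambda>_. 0))"
              unfolding good_output_def F_def[symmetric] length_candidates
            proof (intro conjI allI impI)
              show "(m9(1 := m9 Ob, 0 := m9 (2 * Ob))) 0 = real (n ^ N)"
                using hi[of "2 * Ob"] reg7 by simp
              fix i assume i: "i < length F"
              \<comment> \<open>Entry \<open>i\<close> ends at address \<open>1 + i\<close>: loaded
                into address 1 at the end, restored into a register, or moved by
                \<open>copy_code\<close>.\<close>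
              consider "i = 0" | "1 \<le> i" "i < R" | l where "i = R + l"
                by (metis le_iff_add less_one not_less)
              thus "(m9(1 := m9 Ob, 0 := m9 (2 * Ob))) (1 + i) = real (F ! i)"
              proof cases
                case 1
                thus ?thesis using hi[of Ob] src[of 0] i by simp
              next
                case 2
                have "m9 (Suc i) = m8 (Ob + i)" using s(2)[of "Suc i"] 2 by simp
                also have "\<dots> = m7 (Ob + i)" using Ob20 by (simp add: m8_def)
                finally show ?thesis using src[OF i] 2 by simp
              next
                case 3
                have "m9 (Suc i) = m8 (Suc i)" using s(3)[of "Suc i"] 3 by simp
                also have "\<dots> = m7 (R + 1 + l)" using 3 R20 by (simp add: m8_def)
                also have "\<dots> = m6 (Ob + i)" using m7_copy[of l] i 3 by (simp add: add.assoc)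
                also have "\<dots> = real (F ! i)"
                  using m6_other[of "Ob + i"] m5_F[OF i] i Ob20 len_le lenF by auto
                finally show ?thesis using 3 by (simp add: R_def)
              qed
            qed
            thus "wp (Blk (epilogue2 T)) (length (epilogue2 T)) Q m7"
              unfolding ev[symmetric] Q_def[symmetric]
              by (intro wp_Blk) (auto simp: epilogue2_def restore_code_def)
          qed
        qed
      qed simp
    qed auto
  qed simp
  moreover have "\<forall>i\<in>set (prologue3 T). \<not> is_jump i" by (auto simp: prologue3_def)
  ultimately have main3: "wp (Seq (Blk (prologue3 T)) (Seq copy_code (Seq (rank_code 6 8)
     (Seq (nest_code A T N) (Seq (Blk (epilogue1 T)) (Seq copy_code (Blk (epilogue2 T))))))))
     (length (prologue3 T) + ((3 * n * 7 + 2) + ((n * (n * 14 + 16) + 2) +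
     (nest_time T n N + (length (epilogue1 T) + ((n ^ N * n * 7 + 2) + length (epilogue2 T))))))) Q m1"
    unfolding m2_def by (intro wp_Seq[OF wp_Blk])
  have "\<forall>i\<in>set (prologue2 T). \<not> is_jump i" by (auto simp: prologue2_def save_code_def)
  hence "wp (main_code A T) (main_time T n) Q m"
    unfolding main_code_def main_time_def
    by (rule wp_Seq[OF wp_Blk]) (rule main3[unfolded m1_def N_def])
  thus ?thesis unfolding Q_def N_def .
qed


lemma program_wp:
  assumes n: "0 < n"
  shows "wp (program A T) (program_time T n)
    (\<lambda>m'. good_output n m' (layout.candidates n A T p r q (5 * T) (\<lambda>_. 0))) (snd (init n p r q))"
proof -
  define m0 where "m0 = snd (init n p r q)"
  define B where "B = 2 ^ (5 * T + 24) * n"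
  obtain l where l: "5 * T + 24 = l" by simp
  have "(2::nat) ^ 1 \<le> 2 ^ (5 * T + 24)" by (rule power_increasing) auto
  hence "2 ^ 1 * 1 \<le> B" unfolding B_def using n by (intro mult_mono) auto
  hence "2 \<le> B" by simp
  have m0: "m0 0 = real n" by (simp add: m0_def init_def)
  define m where "m = m0(0 := real B, B := m0 1, 1 := 0)"
  have "fold eff (prologue1 T) m0 = m"
  proof -
    have "2 ^ l * real n = real B" by (simp add: B_def l)
    thus ?thesis using \<open>2 \<le> B\<close> unfolding prologue1_def l m_def by (simp add: funpow_double m0)
  qed
  moreover have "\<not> m 0 \<le> m 1" using \<open>2 \<le> B\<close> by (simp add: m_def)
  ultimately have "wp (IfLe 0 1 (Blk [Const 0 1]) (main_code A T)) (main_time T n + 2)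
    (\<lambda>m'. good_output n m' (layout.candidates n A T p r q (5 * T) (\<lambda>_. 0))) (fold eff (prologue1 T) m0)"
    using main_code_wp[OF n m0_def B_def m_def] by (intro wp_IfLe) auto
  moreover have "\<forall>i\<in>set (prologue1 T). \<not> is_jump i" by (auto simp: prologue1_def)
  ultimately show ?thesis
    unfolding program_def program_time_def m0_def by (intro wp_Seq[OF wp_Blk])
qed

lemma program_wp_0:
  "wp (program A T) (program_time T 0) (\<lambda>m'. good_output 0 m' [[]]) (snd (init 0 p r q))"
proof -
  define m0 where "m0 = snd (init 0 p r q)"
  have m0: "m0 = (\<lambda>_. 0)" by (auto simp: m0_def init_def)
  obtain l where l: "5 * T + 24 = l" by simp
  have "fold eff (prologue1 T) m0 = m0"
    unfolding prologue1_def l m0 by (simp add: funpow_double fun_eq_iff)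
  moreover have "wp (IfLe 0 1 (Blk [Const 0 1]) (main_code A T)) (main_time T 0 + 2)
    (\<lambda>m'. good_output 0 m' [[]]) m0"
    by (intro wp_IfLe) (auto simp: m0 main_time_def good_output_def intro!: wp_Blk_le)
  ultimately have "wp (IfLe 0 1 (Blk [Const 0 1]) (main_code A T)) (main_time T 0 + 2)
    (\<lambda>m'. good_output 0 m' [[]]) (fold eff (prologue1 T) m0)" by simp
  moreover have "\<forall>i\<in>set (prologue1 T). \<not> is_jump i" by (auto simp: prologue1_def)
  ultimately show ?thesis
    unfolding program_def program_time_def m0_def by (intro wp_Seq[OF wp_Blk])
qed

section \<open>Polynomial running time and conclusion\<close>

definition poly_bounded :: "(nat \<Rightarrow> nat) \<Rightarrow> bool" where
  "poly_bounded f \<longleftrightarrow> (\<exists>c d. \<forall>n. f n \<le> c * (n + 1) ^ d)"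

lemma poly_bounded_const: "poly_bounded (\<lambda>_. k)"
  unfolding poly_bounded_def by (intro exI[of _ k] exI[of _ 0]) simp

lemma poly_bounded_id: "poly_bounded (\<lambda>n. n)"
  unfolding poly_bounded_def by (intro exI[of _ 1]) simp

lemma poly_bounded_add:
  assumes "poly_bounded f" "poly_bounded g"
  shows "poly_bounded (\<lambda>n. f n + g n)"
proof -
  obtain c d c' d' where *: "\<And>n. f n \<le> c * (n + 1) ^ d" "\<And>n. g n \<le> c' * (n + 1) ^ d'"
    using assms unfolding poly_bounded_def by auto
  have "f n + g n \<le> (c + c') * (n + 1) ^ (d + d')" for n
  proof -
    have 1: "c * (n + 1) ^ d \<le> c * (n + 1) ^ (d + d')" and 2: "c' * (n + 1) ^ d' \<le> c' * (n + 1) ^ (d + d')"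
      by (intro mult_left_mono power_increasing; simp)+
    from add_mono[OF order_trans[OF *(1) 1] order_trans[OF *(2) 2]] show ?thesis
      unfolding add_mult_distrib .
  qed
  thus ?thesis unfolding poly_bounded_def by blast
qed

lemma poly_bounded_mult:
  assumes "poly_bounded f" "poly_bounded g"
  shows "poly_bounded (\<lambda>n. f n * g n)"
proof -
  obtain c d c' d' where *: "\<And>n. f n \<le> c * (n + 1) ^ d" "\<And>n. g n \<le> c' * (n + 1) ^ d'"
    using assms unfolding poly_bounded_def by auto
  have "f n * g n \<le> (c * c') * (n + 1) ^ (d + d')" for n
    using mult_mono[OF *[of n]] by (simp add: power_add algebra_simps)
  thus ?thesis unfolding poly_bounded_def by blast
qed

lemmas poly_bounded_intros = poly_bounded_const poly_bounded_id poly_bounded_add poly_bounded_mult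

lemma poly_bounded_power: "poly_bounded (\<lambda>n. n ^ k)"
  by (induction k) (auto intro: poly_bounded_intros)

lemma poly_bounded_nest_time: "poly_bounded (\<lambda>n. nest_time T n d)"
proof (induction d)
  case 0
  show ?case unfolding nest_time.simps by (intro poly_bounded_intros)
next
  case (Suc d)
  show ?case unfolding nest_time.simps by (intro poly_bounded_intros Suc)
qed

lemma poly_bounded_program_time: "poly_bounded (program_time T)"
  unfolding program_time_def[abs_def] main_time_def
  by (intro poly_bounded_intros poly_bounded_power poly_bounded_nest_time)

theorem theorem2:
  fixes \<epsilon> :: real
  assumes "\<epsilon> > 0"
  shows "\<exists>(P :: instr list) (c :: nat) (d :: nat).
    \<forall>n p r q. valid_instance n p r q \<longrightarrow>
      (\<exists>k. k \<le> c * (n + 1) ^ d \<and>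
           halted P (steps P k (init n p r q)) \<and>
           valid_output n (snd (steps P k (init n p r q))) \<and>
           (\<forall>\<sigma>'. pareto_optimal n p r q \<sigma>' \<longrightarrow>
              (\<exists>\<sigma> \<in> output_set n (snd (steps P k (init n p r q))).
                 Lmax p r q \<sigma> \<le> (1 + \<epsilon>) * Lmax p r q \<sigma>' \<and> Cmax p r \<sigma> \<le> Cmax p r \<sigma>')))"
proof -
  define K where "K = nat \<lceil>4 / \<epsilon>\<rceil>"
  define T where "T = (2 * (K * (K + 2)) + 2) * (K + 1)"
  have "4 / \<epsilon> \<le> real K" unfolding K_def by (rule real_nat_ceiling_ge)
  moreover have "0 < 4 / \<epsilon>" using assms by simp
  ultimately have "0 < real K" by linarith
  hence K: "1 \<le> K" by simp
  have K\<epsilon>: "4 / real K \<le> \<epsilon>"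
    using \<open>4 / \<epsilon> \<le> real K\<close> \<open>0 < real K\<close> assms by (simp add: field_simps)
  define P where "P = code 0 (program (K + 1) T) @ [Halt]"
  obtain c d where time: "\<And>n. program_time T n \<le> c * (n + 1) ^ d"
    using poly_bounded_program_time unfolding poly_bounded_def by blast
  show ?thesis
  proof (rule exI[of _ P], rule exI[of _ c], rule exI[of _ d], intro allI impI)
    fix n p r q assume valid: "valid_instance n p r q"
    define L where "L = (if n = 0 then [[]] else layout.candidates n (K + 1) T p r q (5 * T) (\<lambda>_. 0))"
    have "wp (program (K + 1) T) (program_time T n) (\<lambda>m. good_output n m L) (snd (init n p r q))"
      using program_wp[of n "K + 1" T p r q] program_wp_0[of "K + 1" T p r q] by (cases "n = 0") (auto simp: L_def)
    from halts[OF this] obtain k where k: "k \<le> program_time T n" "halted P (steps P k (init n p r q))"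
      "good_output n (snd (steps P k (init n p r q))) L"
      unfolding P_def by (auto simp: init_def)
    \<comment> \<open>\<open>candidates\<close> does not depend on the two base addresses, so any
      admissible pair gives access to its properties.\<close>
    have layout: "layout n T ((5 * T + 24) * n) (5 * ((5 * T + 24) * n))" if "0 < n"
      using that by unfold_locales auto
    have seqs: "is_seq n \<sigma>" if "\<sigma> \<in> set L" for \<sigma>
      using layout.is_seq_candidates[OF layout] that by (auto simp: L_def is_seq_def split: if_splits)
    note out = good_output_valid[OF k(3) seqs]
    have "\<exists>\<sigma>\<in>set L. Lmax p r q \<sigma> \<le> (1 + \<epsilon>) * Lmax p r q \<sigma>' \<and> Cmax p r \<sigma> \<le> Cmax p r \<sigma>'"
      if "pareto_optimal n p r q \<sigma>'" for \<sigma>'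
    proof (cases "n = 0")
      case True
      hence "\<sigma>' = []" using that by (simp add: pareto_optimal_def is_seq_def)
      thus ?thesis using True by (simp add: L_def Lmax_def Cmax_def)
    next
      case False
      hence n: "0 < n" by simp
      have seq: "is_seq n \<sigma>'" using that by (simp add: pareto_optimal_def)
      obtain x where x: "\<And>i. i < 5 * T \<Longrightarrow> x i < n"
        "Lmax p r q (candidate (K + 1) T n p r q x) \<le> (1 + 4 / K) * Lmax p r q \<sigma>'"
        "Cmax p r (candidate (K + 1) T n p r q x) \<le> Cmax p r \<sigma>'"
        by (rule candidate_approximates[OF valid seq n K T_def]) (rule that)
      \<comment> \<open>The enumeration starts from the zero tuple, so entries beyond
        \<open>5 * T\<close> are set to zero.\<close>
      define y where "y i = (if i < 5 * T then x i else 0)" for i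
      have "candidate (K + 1) T n p r q x = candidate (K + 1) T n p r q y"
        by (rule candidate_cong) (simp add: y_def)
      moreover have "candidate (K + 1) T n p r q y \<in> set L"
        using layout.in_candidates[OF layout[OF n], of "5 * T" y "\<lambda>_. 0"] x(1) False
        by (simp add: L_def y_def)
      moreover have "0 \<le> Lmax p r q \<sigma>'"
      proof -
        obtain S :: "nat \<Rightarrow> real" and \<pi> :: "nat \<Rightarrow> nat" where
          "\<And>j. j < n \<Longrightarrow> r j \<le> S j \<and> S j + p j \<le> Cmax p r \<sigma>' \<and> S j + p j + q j \<le> Lmax p r q \<sigma>'"
          by (rule seq_start_times[OF seq valid]) blast
        from this[OF n] show ?thesis using valid n unfolding valid_instance_def by force
      qed
      hence "(1 + 4 / K) * Lmax p r q \<sigma>' \<le> (1 + \<epsilon>) * Lmax p r q \<sigma>'"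
        using K\<epsilon> by (intro mult_right_mono) auto
      ultimately show ?thesis using x(2,3) by (metis order_trans)
    qed
    thus "\<exists>k. k \<le> c * (n + 1) ^ d \<and> halted P (steps P k (init n p r q)) \<and>
      valid_output n (snd (steps P k (init n p r q))) \<and>
      (\<forall>\<sigma>'. pareto_optimal n p r q \<sigma>' \<longrightarrow> (\<exists>\<sigma> \<in> output_set n (snd (steps P k (init n p r q))).
         Lmax p r q \<sigma> \<le> (1 + \<epsilon>) * Lmax p r q \<sigma>' \<and> Cmax p r \<sigma> \<le> Cmax p r \<sigma>'))"
      using k out le_trans[OF k(1) time] by (intro exI[of _ k]) auto
  qed
qed

end
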